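(* Let $\Gamma$ be an abelian group, $\mathsf{k}$ a commutative $\Gamma$-graded ring, $R$ a $\Gamma$-graded $\mathsf{k}$-algebra, and $P$ and $Q$ non-zero graded finitely generated projective $R$-modules. Let $P$ be the image of a graded idempotent endomorphism of $\bigoplus_{j=1}^nR(\beta_j)$ with matrix $e\in\mathbb M_n(R)(\overline\beta)_0$ and $Q$ the image of a graded idempotent endomorphism of $\bigoplus_{k=1}^mR(\gamma_k)$ with matrix $f\in\mathbb M_m(R)(\overline\gamma)_0$, where $\overline\beta=(\beta_1,\dots,\beta_n)\in\Gamma^n$ and $\overline\gamma=(\gamma_1,\dots,\gamma_m)\in\Gamma^m$. Then there is a $\Gamma$-graded algebra isomorphism $$R\langle i,i^{-1}:\overline P\cong\overline Q\rangle\ \cong\ R\langle h,h^*\rangle\big/\langle ehf=h,\ fh^*e=h^*,\ hh^*=e,\ h^*h=f\rangle,$$ where $h=(h_{jk})$ is an $n\times m$ matrix of symbols $h_{jk}$ of degree $\gamma_k-\beta_j$ and $h^*=(h^*_{kj})$ is an $m\times n$ matrix of symbols $h^*_{kj}$ of degree $\beta_j-\gamma_k$, for $j=1,\dots,n$ and $k=1,\dots,m$.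
   Context: Rings are unital, modules are left modules, graded homomorphisms preserve degrees; $R(\alpha)$ is $R$ with grading $R(\alpha)_\gamma=R_{\alpha+\gamma}$. $\mathbb M_n(R)(\overline\beta)_0$ is the ring of $n\times n$ matrices with $(i,j)$-entry in $R_{\beta_j-\beta_i}$; such a matrix represents a graded endomorphism of $\bigoplus_jR(\beta_j)$ by right multiplication on row vectors. A graded $R$-ring$_{\mathsf{k}}$ is a $\Gamma$-graded $\mathsf{k}$-algebra (graded ring with graded homomorphism from $\mathsf{k}$ to its centre) with a graded $\mathsf{k}$-algebra homomorphism from $R$. $R\langle i,i^{-1}:\overline P\cong\overline Q\rangle$ denotes the graded $R$-ring$_{\mathsf{k}}$ $S$ obtained by adjoining to $R$ a universal graded homomorphism $\overline P\to\overline Q$ and then a universal graded inverse of it; i.e. it carries a universal graded $S$-module isomorphism $S\otimes_RP\cong S\otimes_RQ$: for any graded $R$-ring$_{\mathsf{k}}$ $T$ and graded $T$-isomorphism $g:T\otimes_RP\to T\otimes_RQ$ there is a unique homomorphism $S\to T$ of graded $R$-rings$_{\mathsf{k}}$ carrying the universal isomorphism to $g$. $R\langle h,h^*\rangle$ is the coproduct over $\mathsf{k}$ of $R$ with the free $\mathsf{k}$-algebra on the entries of $h$ and $h^*$; matrix relations mean the corresponding entrywise relations. *)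

theory Defs
  imports "HOL-Algebra.Module" "HOL-Algebra.QuotRing" "HOL-Algebra.Free_Abelian_Groups"
begin

section \<open>Graded rings and algebras\<close>

text \<open>The grading group is a type \<open>'g\<close> of class \<^class>\<open>ab_group_add\<close>. A grading is an internal direct
  sum decomposition; \<open>M\<close> below may be a ring or a module (only its additive structure is used).\<close>

definition is_grading :: "('a, 'z) ring_scheme \<Rightarrow> ('g \<Rightarrow> 'a set) \<Rightarrow> bool" where
  "is_grading M G \<longleftrightarrow>
     (\<forall>\<gamma>. additive_subgroup (G \<gamma>) M) \<and>
     (\<forall>x \<in> carrier M. \<exists>!c. (\<forall>\<gamma>. c \<gamma> \<in> G \<gamma>) \<and> finite {\<gamma>. c \<gamma> \<noteq> \<zero>\<^bsub>M\<^esub>} \<and>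
        x = (\<Oplus>\<^bsub>M\<^esub>\<gamma> \<in> {\<gamma>. c \<gamma> \<noteq> \<zero>\<^bsub>M\<^esub>}. c \<gamma>))"

record ('g, 'a) gring = "'a ring" +
  grade :: "'g \<Rightarrow> 'a set"

definition graded_ring :: "('g::ab_group_add, 'a, 'z) gring_scheme \<Rightarrow> bool" where
  "graded_ring A \<longleftrightarrow> ring A \<and> is_grading A (grade A) \<and>
     (\<forall>\<gamma> \<delta>. \<forall>x \<in> grade A \<gamma>. \<forall>y \<in> grade A \<delta>. x \<otimes>\<^bsub>A\<^esub> y \<in> grade A (\<gamma> + \<delta>))"

definition gring_hom ::
    "('g, 'a, 'y) gring_scheme \<Rightarrow> ('g, 'b, 'z) gring_scheme \<Rightarrow> ('a \<Rightarrow> 'b) set" where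
  "gring_hom A B = {\<phi> \<in> ring_hom A B. \<forall>\<gamma>. \<phi> ` grade A \<gamma> \<subseteq> grade B \<gamma>}"

text \<open>A graded algebra over a commutative graded ring \<open>\<k>\<close> (called \<open>K\<close>) carries its structure map
  \<open>kmap\<close>; a graded \<open>R\<close>-ring over \<open>K\<close> moreover carries the structure map \<open>rmap\<close> from \<open>R\<close>.\<close>

record ('g, 'k, 'a) galg = "('g, 'a) gring" +
  kmap :: "'k \<Rightarrow> 'a"

record ('g, 'k, 'r, 'a) grring = "('g, 'k, 'a) galg" +
  rmap :: "'r \<Rightarrow> 'a"

definition graded_algebra ::
    "('g::ab_group_add, 'k) gring \<Rightarrow> ('g, 'k, 'a, 'z) galg_scheme \<Rightarrow> bool" where
  "graded_algebra K A \<longleftrightarrow> graded_ring A \<and> kmap A \<in> gring_hom K A \<and>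
     (\<forall>c \<in> carrier K. \<forall>a \<in> carrier A. kmap A c \<otimes>\<^bsub>A\<^esub> a = a \<otimes>\<^bsub>A\<^esub> kmap A c)"

definition galg_hom ::
    "('g, 'k) gring \<Rightarrow> ('g, 'k, 'a, 'y) galg_scheme \<Rightarrow> ('g, 'k, 'b, 'z) galg_scheme \<Rightarrow> ('a \<Rightarrow> 'b) set" where
  "galg_hom K A B = {\<phi> \<in> gring_hom A B. \<forall>c \<in> carrier K. \<phi> (kmap A c) = kmap B c}"

definition galg_iso ::
    "('g, 'k) gring \<Rightarrow> ('g, 'k, 'a, 'y) galg_scheme \<Rightarrow> ('g, 'k, 'b, 'z) galg_scheme \<Rightarrow> ('a \<Rightarrow> 'b) set" where
  "galg_iso K A B = {\<phi> \<in> galg_hom K A B. bij_betw \<phi> (carrier A) (carrier B) \<and>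
     (\<forall>\<gamma>. \<phi> ` grade A \<gamma> = grade B \<gamma>)}"

definition graded_rring ::
    "('g::ab_group_add, 'k) gring \<Rightarrow> ('g, 'k, 'r) galg \<Rightarrow> ('g, 'k, 'r, 'a) grring \<Rightarrow> bool" where
  "graded_rring K R T \<longleftrightarrow> graded_algebra K T \<and> rmap T \<in> galg_hom K R T"

definition grring_hom ::
    "('g, 'k) gring \<Rightarrow> ('g, 'k, 'r) galg \<Rightarrow>
     ('g, 'k, 'r, 'a) grring \<Rightarrow> ('g, 'k, 'r, 'b) grring \<Rightarrow> ('a \<Rightarrow> 'b) set" where
  "grring_hom K R S T = {\<phi> \<in> galg_hom K S T. \<forall>r \<in> carrier R. \<phi> (rmap S r) = rmap T r}"


section \<open>Graded left modules\<close>

text \<open>The library's \<^locale>\<open>module\<close> is restricted to commutative base rings, so only its record type is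
  reused; the multiplication and unit that this record inherits from rings carry no meaning.\<close>

record ('g, 'a, 'b) gmod = "('a, 'b) module" +
  mgrade :: "'g \<Rightarrow> 'b set"

definition left_module :: "('a, 'y) ring_scheme \<Rightarrow> ('a, 'b, 'z) module_scheme \<Rightarrow> bool" where
  "left_module A M \<longleftrightarrow> ring A \<and> abelian_group M \<and>
     (\<forall>a \<in> carrier A. \<forall>x \<in> carrier M. a \<odot>\<^bsub>M\<^esub> x \<in> carrier M) \<and>
     (\<forall>a \<in> carrier A. \<forall>b \<in> carrier A. \<forall>x \<in> carrier M.
        (a \<oplus>\<^bsub>A\<^esub> b) \<odot>\<^bsub>M\<^esub> x = a \<odot>\<^bsub>M\<^esub> x \<oplus>\<^bsub>M\<^esub> b \<odot>\<^bsub>M\<^esub> x) \<and>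
     (\<forall>a \<in> carrier A. \<forall>x \<in> carrier M. \<forall>y \<in> carrier M.
        a \<odot>\<^bsub>M\<^esub> (x \<oplus>\<^bsub>M\<^esub> y) = a \<odot>\<^bsub>M\<^esub> x \<oplus>\<^bsub>M\<^esub> a \<odot>\<^bsub>M\<^esub> y) \<and>
     (\<forall>a \<in> carrier A. \<forall>b \<in> carrier A. \<forall>x \<in> carrier M.
        (a \<otimes>\<^bsub>A\<^esub> b) \<odot>\<^bsub>M\<^esub> x = a \<odot>\<^bsub>M\<^esub> (b \<odot>\<^bsub>M\<^esub> x)) \<and>
     (\<forall>x \<in> carrier M. \<one>\<^bsub>A\<^esub> \<odot>\<^bsub>M\<^esub> x = x)"

definition graded_module ::
    "('g::ab_group_add, 'a, 'y) gring_scheme \<Rightarrow> ('g, 'a, 'b) gmod \<Rightarrow> bool" where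
  "graded_module A M \<longleftrightarrow> graded_ring A \<and> left_module A M \<and> is_grading M (mgrade M) \<and>
     (\<forall>\<gamma> \<delta>. \<forall>a \<in> grade A \<gamma>. \<forall>x \<in> mgrade M \<delta>. a \<odot>\<^bsub>M\<^esub> x \<in> mgrade M (\<gamma> + \<delta>))"

definition gmod_hom ::
    "('g, 'a, 'y) gring_scheme \<Rightarrow> ('g, 'a, 'b) gmod \<Rightarrow> ('g, 'a, 'c) gmod \<Rightarrow> ('b \<Rightarrow> 'c) set" where
  "gmod_hom A M N = {h \<in> carrier M \<rightarrow> carrier N.
     (\<forall>x \<in> carrier M. \<forall>y \<in> carrier M. h (x \<oplus>\<^bsub>M\<^esub> y) = h x \<oplus>\<^bsub>N\<^esub> h y) \<and>
     (\<forall>a \<in> carrier A. \<forall>x \<in> carrier M. h (a \<odot>\<^bsub>M\<^esub> x) = a \<odot>\<^bsub>N\<^esub> h x) \<and>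
     (\<forall>\<gamma>. h ` mgrade M \<gamma> \<subseteq> mgrade N \<gamma>)}"

definition gmod_iso ::
    "('g, 'a, 'y) gring_scheme \<Rightarrow> ('g, 'a, 'b) gmod \<Rightarrow> ('g, 'a, 'c) gmod \<Rightarrow> ('b \<Rightarrow> 'c) set" where
  "gmod_iso A M N = {h \<in> gmod_hom A M N. bij_betw h (carrier M) (carrier N) \<and>
     (\<forall>\<gamma>. h ` mgrade M \<gamma> = mgrade N \<gamma>)}"

text \<open>The module \<open>R(\<beta>\<^sub>0) \<oplus> \<dots> \<oplus> R(\<beta>\<^bsub>n-1\<^esub>)\<close> of row vectors, where \<open>R(\<alpha>)\<^sub>\<gamma> = R\<^bsub>\<alpha>+\<gamma>\<^esub>\<close>. Indices start at 0.\<close>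

definition shifted_free ::
    "('g::ab_group_add, 'a, 'y) gring_scheme \<Rightarrow> nat \<Rightarrow> (nat \<Rightarrow> 'g) \<Rightarrow> ('g, 'a, nat \<Rightarrow> 'a) gmod" where
  "shifted_free A n \<beta> =
     \<lparr>carrier = {..<n} \<rightarrow>\<^sub>E carrier A, mult = undefined, one = undefined,
      ring.zero = (\<lambda>j \<in> {..<n}. \<zero>\<^bsub>A\<^esub>),
      ring.add = (\<lambda>v w. \<lambda>j \<in> {..<n}. v j \<oplus>\<^bsub>A\<^esub> w j),
      smult = (\<lambda>a v. \<lambda>j \<in> {..<n}. a \<otimes>\<^bsub>A\<^esub> v j),
      mgrade = (\<lambda>\<gamma>. {v \<in> {..<n} \<rightarrow>\<^sub>E carrier A. \<forall>j<n. v j \<in> grade A (\<beta> j + \<gamma>)})\<rparr>"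

text \<open>Being graded finitely generated projective is rendered as being a graded direct summand of a
  finite direct sum of shifts of the ring.\<close>

definition graded_fg_projective ::
    "('g::ab_group_add, 'a, 'y) gring_scheme \<Rightarrow> ('g, 'a, 'b) gmod \<Rightarrow> bool" where
  "graded_fg_projective A M \<longleftrightarrow> graded_module A M \<and>
     (\<exists>n \<beta> \<iota> \<pi>. \<iota> \<in> gmod_hom A M (shifted_free A n \<beta>) \<and> \<pi> \<in> gmod_hom A (shifted_free A n \<beta>) M \<and>
        (\<forall>x \<in> carrier M. \<pi> (\<iota> x) = x))"

text \<open>\<open>\<M>\<^sub>n(R)(\<beta>)\<^sub>0\<close>; matrix entries outside the index range are irrelevant.\<close>

definition degree0_matrices ::
    "('g::ab_group_add, 'a, 'y) gring_scheme \<Rightarrow> nat \<Rightarrow> (nat \<Rightarrow> 'g) \<Rightarrow> (nat \<Rightarrow> nat \<Rightarrow> 'a) set" where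
  "degree0_matrices A n \<beta> = {e. \<forall>i<n. \<forall>j<n. e i j \<in> grade A (\<beta> j - \<beta> i)}"

definition right_mult :: "('a, 'y) ring_scheme \<Rightarrow> nat \<Rightarrow> (nat \<Rightarrow> nat \<Rightarrow> 'a) \<Rightarrow> (nat \<Rightarrow> 'a) \<Rightarrow> (nat \<Rightarrow> 'a)" where
  "right_mult A n e v = (\<lambda>j \<in> {..<n}. \<Oplus>\<^bsub>A\<^esub>i \<in> {..<n}. v i \<otimes>\<^bsub>A\<^esub> e i j)"

definition image_module :: "('g, 'a, 'b) gmod \<Rightarrow> ('b \<Rightarrow> 'b) \<Rightarrow> ('g, 'a, 'b) gmod" where
  "image_module M E = M\<lparr>carrier := E ` carrier M, mgrade := (\<lambda>\<gamma>. mgrade M \<gamma> \<inter> E ` carrier M)\<rparr>"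

text \<open>\<open>M\<close> is (up to graded isomorphism) the image of the graded idempotent endomorphism of
  \<^term>\<open>shifted_free A n \<beta>\<close> with matrix \<open>e\<close>.\<close>

definition image_of_idempotent ::
    "('g::ab_group_add, 'a, 'y) gring_scheme \<Rightarrow> ('g, 'a, 'b) gmod \<Rightarrow>
     nat \<Rightarrow> (nat \<Rightarrow> 'g) \<Rightarrow> (nat \<Rightarrow> nat \<Rightarrow> 'a) \<Rightarrow> bool" where
  "image_of_idempotent A M n \<beta> e \<longleftrightarrow> e \<in> degree0_matrices A n \<beta> \<and>
     (\<forall>v \<in> carrier (shifted_free A n \<beta>).
        right_mult A n e (right_mult A n e v) = right_mult A n e v) \<and>
     gmod_iso A M (image_module (shifted_free A n \<beta>) (right_mult A n e)) \<noteq> {}"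


section \<open>Extension of scalars\<close>

text \<open>\<open>T \<otimes>\<^sub>R M\<close> is the free abelian group on \<open>T \<times> M\<close> modulo the usual relations.\<close>

definition tensor_relations ::
    "('g, 'k, 'r) galg \<Rightarrow> ('g, 'k, 'r, 't) grring \<Rightarrow> ('g, 'r, 'm) gmod \<Rightarrow> ('t \<times> 'm \<Rightarrow>\<^sub>0 int) set" where
  "tensor_relations R T M =
     {frag_of (s \<oplus>\<^bsub>T\<^esub> t, x) - frag_of (s, x) - frag_of (t, x) | s t x.
        s \<in> carrier T \<and> t \<in> carrier T \<and> x \<in> carrier M} \<union>
     {frag_of (t, x \<oplus>\<^bsub>M\<^esub> y) - frag_of (t, x) - frag_of (t, y) | t x y.
        t \<in> carrier T \<and> x \<in> carrier M \<and> y \<in> carrier M} \<union>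
     {frag_of (t \<otimes>\<^bsub>T\<^esub> rmap T r, x) - frag_of (t, r \<odot>\<^bsub>M\<^esub> x) | t r x.
        t \<in> carrier T \<and> r \<in> carrier R \<and> x \<in> carrier M}"

definition tensor_kernel ::
    "('g, 'k, 'r) galg \<Rightarrow> ('g, 'k, 'r, 't) grring \<Rightarrow> ('g, 'r, 'm) gmod \<Rightarrow> ('t \<times> 'm \<Rightarrow>\<^sub>0 int) set" where
  "tensor_kernel R T M =
     generate (free_Abelian_group (carrier T \<times> carrier M)) (tensor_relations R T M)"

definition tensor_class ::
    "('g, 'k, 'r) galg \<Rightarrow> ('g, 'k, 'r, 't) grring \<Rightarrow> ('g, 'r, 'm) gmod \<Rightarrow>
     ('t \<times> 'm \<Rightarrow>\<^sub>0 int) \<Rightarrow> ('t \<times> 'm \<Rightarrow>\<^sub>0 int) set" where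
  "tensor_class R T M c =
     tensor_kernel R T M #>\<^bsub>free_Abelian_group (carrier T \<times> carrier M)\<^esub> c"

definition tensor ::
    "('g::ab_group_add, 'k, 'r) galg \<Rightarrow> ('g, 'k, 'r, 't) grring \<Rightarrow> ('g, 'r, 'm) gmod \<Rightarrow>
     ('g, 't, ('t \<times> 'm \<Rightarrow>\<^sub>0 int) set) gmod" where
  "tensor R T M =
     (let F = free_Abelian_group (carrier T \<times> carrier M); D = F Mod tensor_kernel R T M
      in \<lparr>carrier = carrier D, mult = undefined, one = undefined,
          ring.zero = \<one>\<^bsub>D\<^esub>, ring.add = monoid.mult D,
          smult = (\<lambda>t X. \<Union>c \<in> X. tensor_class R T M
                     (frag_extend (\<lambda>(s, x). frag_of (t \<otimes>\<^bsub>T\<^esub> s, x)) c)),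
          mgrade = (\<lambda>\<gamma>. tensor_class R T M ` generate F
                     {frag_of (t, x) | t x \<delta> \<epsilon>. t \<in> grade T \<delta> \<and> x \<in> mgrade M \<epsilon> \<and> \<delta> + \<epsilon> = \<gamma>})\<rparr>)"

text \<open>The map \<open>\<phi> \<otimes> M : S \<otimes>\<^sub>R M \<rightarrow> T \<otimes>\<^sub>R M\<close> induced by a homomorphism \<open>\<phi> : S \<rightarrow> T\<close> of \<open>R\<close>-rings. All
  elements of the coset \<open>X\<close> have the same image, so that the union below is a single coset.\<close>

definition tensor_map ::
    "('g, 'k, 'r) galg \<Rightarrow> ('g, 'k, 'r, 't) grring \<Rightarrow> ('g, 'r, 'm) gmod \<Rightarrow> ('s \<Rightarrow> 't) \<Rightarrow>
     ('s \<times> 'm \<Rightarrow>\<^sub>0 int) set \<Rightarrow> ('t \<times> 'm \<Rightarrow>\<^sub>0 int) set" where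
  "tensor_map R T M \<phi> X =
     (\<Union>c \<in> X. tensor_class R T M (frag_extend (\<lambda>(s, x). frag_of (\<phi> s, x)) c))"


section \<open>The universal ring with an isomorphism between two modules\<close>

text \<open>\<open>\<phi> : S \<rightarrow> T\<close> carries \<open>u : S \<otimes>\<^sub>R P \<rightarrow> S \<otimes>\<^sub>R Q\<close> to \<open>g : T \<otimes>\<^sub>R P \<rightarrow> T \<otimes>\<^sub>R Q\<close>, i.e. \<open>T \<otimes>\<^sub>S u\<close> is \<open>g\<close>
  under the identification \<open>T \<otimes>\<^sub>S (S \<otimes>\<^sub>R P) = T \<otimes>\<^sub>R P\<close>. This is a commuting square, since the image of
  \<open>\<phi> \<otimes> P\<close> generates the \<open>T\<close>-module \<open>T \<otimes>\<^sub>R P\<close>.\<close>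

definition carries ::
    "('g::ab_group_add, 'k, 'r) galg \<Rightarrow> ('g, 'r, 'p) gmod \<Rightarrow> ('g, 'r, 'q) gmod \<Rightarrow>
     ('g, 'k, 'r, 's) grring \<Rightarrow> ('g, 'k, 'r, 't) grring \<Rightarrow> ('s \<Rightarrow> 't) \<Rightarrow>
     (('s \<times> 'p \<Rightarrow>\<^sub>0 int) set \<Rightarrow> ('s \<times> 'q \<Rightarrow>\<^sub>0 int) set) \<Rightarrow>
     (('t \<times> 'p \<Rightarrow>\<^sub>0 int) set \<Rightarrow> ('t \<times> 'q \<Rightarrow>\<^sub>0 int) set) \<Rightarrow> bool" where
  "carries R P Q S T \<phi> u g \<longleftrightarrow>
     (\<forall>X \<in> carrier (tensor R S P). g (tensor_map R T P \<phi> X) = tensor_map R T Q \<phi> (u X))"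

text \<open>\<open>S\<close> with the isomorphism \<open>u\<close> is \<open>R\<langle>i, i\<^sup>-\<^sup>1 : P \<cong> Q\<rangle>\<close>. Since HOL cannot quantify over types
  inside a formula, the type \<open>'t\<close> carrying the rings \<open>T\<close> of the universal property is a parameter.\<close>

definition universal_iso_ring ::
    "'t itself \<Rightarrow> ('g::ab_group_add, 'k) gring \<Rightarrow> ('g, 'k, 'r) galg \<Rightarrow>
     ('g, 'r, 'p) gmod \<Rightarrow> ('g, 'r, 'q) gmod \<Rightarrow> ('g, 'k, 'r, 's) grring \<Rightarrow>
     (('s \<times> 'p \<Rightarrow>\<^sub>0 int) set \<Rightarrow> ('s \<times> 'q \<Rightarrow>\<^sub>0 int) set) \<Rightarrow> bool" where
  "universal_iso_ring _ K R P Q S u \<longleftrightarrow>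
     graded_rring K R S \<and> u \<in> gmod_iso S (tensor R S P) (tensor R S Q) \<and>
     (\<forall>(T :: ('g, 'k, 'r, 't) grring) g.
        graded_rring K R T \<and> g \<in> gmod_iso T (tensor R T P) (tensor R T Q) \<longrightarrow>
        (\<exists>\<phi> \<in> grring_hom K R S T. carries R P Q S T \<phi> u g \<and>
           (\<forall>\<psi> \<in> grring_hom K R S T. carries R P Q S T \<psi> u g \<longrightarrow>
              (\<forall>s \<in> carrier S. \<psi> s = \<phi> s))))"


section \<open>Free algebras, coproducts and the presentation\<close>

definition quotient_class :: "('a, 'z) ring_scheme \<Rightarrow> 'a set \<Rightarrow> 'a \<Rightarrow> 'a set" where
  "quotient_class A rels x = (Idl\<^bsub>A\<^esub> rels) +>\<^bsub>A\<^esub> x"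

definition graded_quotient :: "('g, 'a, 'z) gring_scheme \<Rightarrow> 'a set \<Rightarrow> ('g, 'a set) gring" where
  "graded_quotient A rels =
     ring.extend (A Quot (Idl\<^bsub>A\<^esub> rels)) (gring.fields (\<lambda>\<gamma>. quotient_class A rels ` grade A \<gamma>))"

text \<open>The free ring \<open>\<int>\<langle>X\<rangle>\<close>. Each letter \<open>x\<close> is assigned a set \<open>D x\<close> of degrees, and degree \<open>\<gamma>\<close> is
  spanned by the words that acquire total degree \<open>\<gamma>\<close> from some choice of degrees of their letters.
  The letters will include all elements of given graded rings, so a letter may have no degree
  (inhomogeneous elements) or all degrees (zero); these subgroups form a grading only after
  imposing suitable relations.\<close>

definition word_degree :: "('x \<Rightarrow> 'g::ab_group_add set) \<Rightarrow> 'x list \<Rightarrow> 'g \<Rightarrow> bool" where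
  "word_degree D w \<gamma> \<longleftrightarrow> (\<exists>ds. list_all2 (\<lambda>x \<delta>. \<delta> \<in> D x) w ds \<and> sum_list ds = \<gamma>)"

definition free_gring :: "'x set \<Rightarrow> ('x \<Rightarrow> 'g::ab_group_add set) \<Rightarrow> ('g, 'x list \<Rightarrow>\<^sub>0 int) gring" where
  "free_gring X D =
     \<lparr>carrier = {c. Poly_Mapping.keys c \<subseteq> lists X},
      mult = (\<lambda>a b. frag_extend (\<lambda>v. frag_extend (\<lambda>w. frag_of (v @ w)) b) a),
      one = frag_of [], ring.zero = 0, ring.add = (+),
      grade = (\<lambda>\<gamma>. {c. Poly_Mapping.keys c \<subseteq> {w \<in> lists X. word_degree D w \<gamma>}})\<rparr>"

text \<open>Relations making \<open>a \<mapsto> \<iota> a\<close>, for \<open>\<iota>\<close> a map from the ring \<open>A\<close> to letters, a ring homomorphism.\<close>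

definition hom_relations :: "('a, 'z) ring_scheme \<Rightarrow> ('a \<Rightarrow> 'x) \<Rightarrow> ('x list \<Rightarrow>\<^sub>0 int) set" where
  "hom_relations A \<iota> =
     {frag_of [\<iota> (a \<oplus>\<^bsub>A\<^esub> b)] - frag_of [\<iota> a] - frag_of [\<iota> b] | a b. a \<in> carrier A \<and> b \<in> carrier A} \<union>
     {frag_of [\<iota> (a \<otimes>\<^bsub>A\<^esub> b)] - frag_of [\<iota> a, \<iota> b] | a b. a \<in> carrier A \<and> b \<in> carrier A} \<union>
     {frag_of [\<iota> \<one>\<^bsub>A\<^esub>] - frag_of []}"

text \<open>The free \<open>K\<close>-algebra on the set \<open>X\<close> of symbols, where \<open>x\<close> has degree \<open>d x\<close>.\<close>

definition free_galg_base ::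
    "('g::ab_group_add, 'k) gring \<Rightarrow> 'x set \<Rightarrow> ('x \<Rightarrow> 'g) \<Rightarrow> ('g, ('k + 'x) list \<Rightarrow>\<^sub>0 int) gring" where
  "free_galg_base K X d =
     free_gring (carrier K <+> X) (case_sum (\<lambda>c. {\<gamma>. c \<in> grade K \<gamma>}) (\<lambda>x. {d x}))"

definition free_galg_relations ::
    "('g::ab_group_add, 'k) gring \<Rightarrow> 'x set \<Rightarrow> (('k + 'x) list \<Rightarrow>\<^sub>0 int) set" where
  "free_galg_relations K X = hom_relations K Inl \<union>
     {frag_of [Inl c, Inr x] - frag_of [Inr x, Inl c] | c x. c \<in> carrier K \<and> x \<in> X}"

definition free_galg_letter ::
    "('g::ab_group_add, 'k) gring \<Rightarrow> 'x set \<Rightarrow> ('x \<Rightarrow> 'g) \<Rightarrow> 'k + 'x \<Rightarrow> (('k + 'x) list \<Rightarrow>\<^sub>0 int) set" where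
  "free_galg_letter K X d l =
     quotient_class (free_galg_base K X d) (free_galg_relations K X) (frag_of [l])"

definition free_galg ::
    "('g::ab_group_add, 'k) gring \<Rightarrow> 'x set \<Rightarrow> ('x \<Rightarrow> 'g) \<Rightarrow>
     ('g, 'k, (('k + 'x) list \<Rightarrow>\<^sub>0 int) set) galg" where
  "free_galg K X d =
     gring.extend (graded_quotient (free_galg_base K X d) (free_galg_relations K X))
       (galg.fields (\<lambda>c. free_galg_letter K X d (Inl c)))"

text \<open>The coproduct over \<open>K\<close> of two graded \<open>K\<close>-algebras \<open>A\<close> and \<open>B\<close>, viewed as a graded \<open>A\<close>-ring over
  \<open>K\<close>. The image of \<open>K\<close> is central in it because it commutes with the images of both \<open>A\<close> and \<open>B\<close>.\<close>

definition coproduct_base ::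
    "('g::ab_group_add, 'k, 'a) galg \<Rightarrow> ('g, 'k, 'b) galg \<Rightarrow> ('g, ('a + 'b) list \<Rightarrow>\<^sub>0 int) gring" where
  "coproduct_base A B =
     free_gring (carrier A <+> carrier B)
       (case_sum (\<lambda>a. {\<gamma>. a \<in> grade A \<gamma>}) (\<lambda>b. {\<gamma>. b \<in> grade B \<gamma>}))"

definition coproduct_relations ::
    "('g, 'k) gring \<Rightarrow> ('g, 'k, 'a) galg \<Rightarrow> ('g, 'k, 'b) galg \<Rightarrow> (('a + 'b) list \<Rightarrow>\<^sub>0 int) set" where
  "coproduct_relations K A B = hom_relations A Inl \<union> hom_relations B Inr \<union>
     {frag_of [Inl (kmap A c)] - frag_of [Inr (kmap B c)] | c. c \<in> carrier K}"

definition coproduct_letter ::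
    "('g::ab_group_add, 'k) gring \<Rightarrow> ('g, 'k, 'a) galg \<Rightarrow> ('g, 'k, 'b) galg \<Rightarrow>
     'a + 'b \<Rightarrow> (('a + 'b) list \<Rightarrow>\<^sub>0 int) set" where
  "coproduct_letter K A B l =
     quotient_class (coproduct_base A B) (coproduct_relations K A B) (frag_of [l])"

definition coproduct ::
    "('g::ab_group_add, 'k) gring \<Rightarrow> ('g, 'k, 'a) galg \<Rightarrow> ('g, 'k, 'b) galg \<Rightarrow>
     ('g, 'k, 'a, (('a + 'b) list \<Rightarrow>\<^sub>0 int) set) grring" where
  "coproduct K A B =
     galg.extend
       (gring.extend (graded_quotient (coproduct_base A B) (coproduct_relations K A B))
         (galg.fields (\<lambda>c. coproduct_letter K A B (Inl (kmap A c)))))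
       (grring.fields (\<lambda>a. coproduct_letter K A B (Inl a)))"

definition grring_quotient ::
    "('g, 'k, 'r, 'a) grring \<Rightarrow> 'a set \<Rightarrow> ('g, 'k, 'r, 'a set) grring" where
  "grring_quotient C rels =
     galg.extend
       (gring.extend (graded_quotient C rels)
         (galg.fields (\<lambda>c. quotient_class C rels (kmap C c))))
       (grring.fields (\<lambda>r. quotient_class C rels (rmap C r)))"

datatype h_symbol = H nat nat | HStar nat nat

definition h_symbols :: "nat \<Rightarrow> nat \<Rightarrow> h_symbol set" where
  "h_symbols n m = {H j k | j k. j < n \<and> k < m} \<union> {HStar k j | j k. j < n \<and> k < m}"

fun h_degree :: "(nat \<Rightarrow> 'g::ab_group_add) \<Rightarrow> (nat \<Rightarrow> 'g) \<Rightarrow> h_symbol \<Rightarrow> 'g" where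
  "h_degree \<beta> \<gamma> (H j k) = \<gamma> k - \<beta> j"
| "h_degree \<beta> \<gamma> (HStar k j) = \<beta> j - \<gamma> k"

type_synonym 'k h_free_elem = "(('k + h_symbol) list \<Rightarrow>\<^sub>0 int) set"
type_synonym ('k, 'r) h_elem = "(('r + 'k h_free_elem) list \<Rightarrow>\<^sub>0 int) set"

context
  fixes K :: "('g::ab_group_add, 'k) gring" and R :: "('g, 'k, 'r) galg"
    and n m :: nat and \<beta> \<gamma> :: "nat \<Rightarrow> 'g"
begin

definition h_free :: "('g, 'k, 'k h_free_elem) galg" where
  "h_free = free_galg K (h_symbols n m) (h_degree \<beta> \<gamma>)"

definition h_ring :: "('g, 'k, 'r, ('k, 'r) h_elem) grring" where
  "h_ring = coproduct K R h_free"

definition h_entry :: "h_symbol \<Rightarrow> ('k, 'r) h_elem" where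
  "h_entry x = coproduct_letter K R h_free (Inr (free_galg_letter K (h_symbols n m) (h_degree \<beta> \<gamma>) (Inr x)))"

end

definition mat_mult ::
    "('a, 'z) ring_scheme \<Rightarrow> nat \<Rightarrow> (nat \<Rightarrow> nat \<Rightarrow> 'a) \<Rightarrow> (nat \<Rightarrow> nat \<Rightarrow> 'a) \<Rightarrow> nat \<Rightarrow> nat \<Rightarrow> 'a" where
  "mat_mult C l A B i j = (\<Oplus>\<^bsub>C\<^esub>s \<in> {..<l}. A i s \<otimes>\<^bsub>C\<^esub> B s j)"

definition mat_relations ::
    "('a, 'z) ring_scheme \<Rightarrow> nat \<Rightarrow> nat \<Rightarrow> (nat \<Rightarrow> nat \<Rightarrow> 'a) \<Rightarrow> (nat \<Rightarrow> nat \<Rightarrow> 'a) \<Rightarrow> 'a set" where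
  "mat_relations C p q A B = {A i j \<ominus>\<^bsub>C\<^esub> B i j | i j. i < p \<and> j < q}"

definition h_relations ::
    "('g::ab_group_add, 'k) gring \<Rightarrow> ('g, 'k, 'r) galg \<Rightarrow> nat \<Rightarrow> nat \<Rightarrow> (nat \<Rightarrow> 'g) \<Rightarrow> (nat \<Rightarrow> 'g) \<Rightarrow>
     (nat \<Rightarrow> nat \<Rightarrow> 'r) \<Rightarrow> (nat \<Rightarrow> nat \<Rightarrow> 'r) \<Rightarrow> ('k, 'r) h_elem set" where
  "h_relations K R n m \<beta> \<gamma> e f =
     (let C = h_ring K R n m \<beta> \<gamma>;
          h = (\<lambda>j k. h_entry K R n m \<beta> \<gamma> (H j k));
          h' = (\<lambda>k j. h_entry K R n m \<beta> \<gamma> (HStar k j));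
          E = (\<lambda>i j. rmap C (e i j));
          F = (\<lambda>k l. rmap C (f k l))
      in mat_relations C n m (mat_mult C m (mat_mult C n E h) F) h \<union>
         mat_relations C m n (mat_mult C n (mat_mult C m F h') E) h' \<union>
         mat_relations C n n (mat_mult C m h h') E \<union>
         mat_relations C m m (mat_mult C n h' h) F)"

definition presented_ring ::
    "('g::ab_group_add, 'k) gring \<Rightarrow> ('g, 'k, 'r) galg \<Rightarrow> nat \<Rightarrow> nat \<Rightarrow> (nat \<Rightarrow> 'g) \<Rightarrow> (nat \<Rightarrow> 'g) \<Rightarrow>
     (nat \<Rightarrow> nat \<Rightarrow> 'r) \<Rightarrow> (nat \<Rightarrow> nat \<Rightarrow> 'r) \<Rightarrow> ('g, 'k, 'r, ('k, 'r) h_elem set) grring" where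
  "presented_ring K R n m \<beta> \<gamma> e f =
     grring_quotient (h_ring K R n m \<beta> \<gamma>) (h_relations K R n m \<beta> \<gamma> e f)"

end

theory Submission
  imports Defs "HOL-Algebra.Subrings"
begin

text \<open>
  A module that is the image of an idempotent matrix \<open>e\<close> has a finite generating family with coordinate
  functionals whose mutual values are the entries of \<open>e\<close>, and this persists under extension of scalars.
  In such coordinates an isomorphism \<open>T \<otimes> P \<cong> T \<otimes> Q\<close> and its inverse are exactly a pair of matrices over
  \<open>T\<close> subject to the four relations, so the presented ring has the required universal property.
  Its presentation contains inhomogeneous letters, so that its grading is not evident: the letters
  and their homogeneous components define a homomorphism into its own group ring over the grading
  group, whose coefficients are the projections onto the homogeneous parts.
\<close>

section \<open>Additive maps and finite sums\<close>

text \<open>With row vectors, composing two maps multiplies their matrices in the same order, so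
  \<open>hh' = e\<close> and \<open>h'h = f\<close> say that the maps are mutually inverse. The
  generators of P and Q need not be independent: \<open>h\<close> and \<open>ehf\<close> describe
  the same map, and the remaining two relations select the one matrix that consists of actual
  coordinates. The j-th generator of P has degree -\<beta>_j and the k-th coordinate on Q raises
  degrees by \<gamma>_k, whence the degree \<gamma>_k - \<beta>_j. Every element of R is a letter,
  and an inhomogeneous one has no degree, so the free ring is not graded and directness can only be
  established for the last quotient. The tool is a map on generators into the group ring, which
  carries no grading itself. Hence the lifting lemmas are stated for plain rings as targets, with no
  more than the image of K being central, and gradedness of a lift is a separate matter: the grading
  of a presented ring is the smallest multiplicative family that contains the letters in their
  degrees.\<close>

lemma abelian_group_homI':
  assumes "abelian_group A" "abelian_group B" "\<And>x. x \<in> carrier A \<Longrightarrow> h x \<in> carrier B"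
    "\<And>x y. x \<in> carrier A \<Longrightarrow> y \<in> carrier A \<Longrightarrow> h (x \<oplus>\<^bsub>A\<^esub> y) = h x \<oplus>\<^bsub>B\<^esub> h y"
  shows "abelian_group_hom A B h"
  using assms
  by (auto intro!: abelian_group_homI group_hom.intro group_hom_axioms.intro homI abelian_group.a_group)

lemma ring_hom_imp_abelian_group_hom:
  assumes "ring A" "ring B" "h \<in> ring_hom A B"
  shows "abelian_group_hom A B h"
  using assms by (auto intro!: abelian_group_homI' ring.is_abelian_group simp: ring_hom_def)

lemma (in abelian_group_hom) hom_finsum:
  assumes "f \<in> I \<rightarrow> carrier G"
  shows "h (\<Oplus>\<^bsub>G\<^esub>i\<in>I. f i) = (\<Oplus>\<^bsub>H\<^esub>i\<in>I. h (f i))"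
  using assms by (induction I rule: infinite_finite_induct) (auto simp: Pi_def)

lemma (in abelian_group_hom) hom_minus:
  "x \<in> carrier G \<Longrightarrow> y \<in> carrier G \<Longrightarrow> h (x \<ominus>\<^bsub>G\<^esub> y) = h x \<ominus>\<^bsub>H\<^esub> h y"
  by (simp add: a_minus_def)

lemma abelian_group_hom_compose:
  assumes "abelian_group_hom A B g" "abelian_group_hom B C h"
  shows "abelian_group_hom A C (\<lambda>x. h (g x))"
proof -
  interpret g: abelian_group_hom A B g by fact
  interpret h: abelian_group_hom B C h by fact
  show ?thesis by unfold_locales (auto intro!: homI)
qed

lemma (in abelian_group) minus_eq_zero_iff:
  assumes "x \<in> carrier G" "y \<in> carrier G"
  shows "x \<ominus> y = \<zero> \<longleftrightarrow> x = y"
proof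
  assume "x \<ominus> y = \<zero>"
  then have "(x \<ominus> y) \<oplus> y = y" using assms by simp
  then show "x = y" using assms by (simp add: a_minus_def a_assoc l_neg)
qed (use assms in \<open>simp add: a_minus_def r_neg\<close>)

lemma (in abelian_group) minus_eq_iff:
  assumes "x \<in> carrier G" "y \<in> carrier G" "z \<in> carrier G"
  shows "x \<ominus> y = z \<longleftrightarrow> x = y \<oplus> z"
proof -
  have "x \<ominus> y = z \<longleftrightarrow> x = z \<oplus> y"
  proof
    assume "x \<ominus> y = z"
    then have "z \<oplus> y = (x \<ominus> y) \<oplus> y" by simp
    then show "x = z \<oplus> y" using assms by (simp add: a_minus_def a_assoc l_neg)
  qed (use assms in \<open>simp add: a_minus_def a_assoc r_neg\<close>)
  then show ?thesis using assms by (simp add: a_comm)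
qed

lemma (in abelian_monoid) finsum_swap:
  assumes "finite I" "finite J" "\<And>i j. i \<in> I \<Longrightarrow> j \<in> J \<Longrightarrow> f i j \<in> carrier G"
  shows "(\<Oplus>i\<in>I. \<Oplus>j\<in>J. f i j) = (\<Oplus>j\<in>J. \<Oplus>i\<in>I. f i j)"
  using assms(1,3)
proof (induction I rule: finite_induct)
  case empty
  then show ?case by (simp add: finsum_zero)
next
  case (insert i I)
  have "(\<Oplus>i\<in>insert i I. \<Oplus>j\<in>J. f i j) = (\<Oplus>j\<in>J. f i j) \<oplus> (\<Oplus>j\<in>J. \<Oplus>i\<in>I. f i j)"
    using insert by (subst finsum_insert) (auto intro!: finsum_closed)
  also have "\<dots> = (\<Oplus>j\<in>J. f i j \<oplus> (\<Oplus>i\<in>I. f i j))"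
    using insert by (subst finsum_addf) (auto intro!: finsum_closed)
  also have "\<dots> = (\<Oplus>j\<in>J. \<Oplus>i\<in>insert i I. f i j)"
    using insert by (intro finsum_cong') (auto intro!: finsum_closed simp: Pi_def)
  finally show ?case .
qed

lemma (in additive_subgroup) finsum_in:
  assumes "abelian_group G" "\<And>i. i \<in> I \<Longrightarrow> f i \<in> H"
  shows "(\<Oplus>i\<in>I. f i) \<in> H"
proof -
  interpret G: abelian_group G by fact
  show ?thesis using assms(2) a_subset
    by (induction I rule: infinite_finite_induct)
       (auto simp: Pi_def subset_iff G.finsum_insert)
qed

lemma additive_subgroupI':
  assumes "abelian_group A" "U \<subseteq> carrier A" "\<zero>\<^bsub>A\<^esub> \<in> U"
    "\<And>x y. x \<in> U \<Longrightarrow> y \<in> U \<Longrightarrow> x \<oplus>\<^bsub>A\<^esub> y \<in> U" "\<And>x. x \<in> U \<Longrightarrow> \<ominus>\<^bsub>A\<^esub> x \<in> U"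
  shows "additive_subgroup U A"
proof -
  interpret abelian_group A by fact
  show ?thesis
    using assms by (intro additive_subgroupI add.subgroupI) auto
qed

lemma additive_subgroup_image:
  assumes "abelian_group_hom A B h" "additive_subgroup U A"
  shows "additive_subgroup (h ` U) B"
proof -
  interpret abelian_group_hom A B h by fact
  interpret U: additive_subgroup U A by fact
  have 1: "h x \<oplus>\<^bsub>B\<^esub> h y \<in> h ` U" if "x \<in> U" "y \<in> U" for x y
    using that by (metis U.a_Hcarr U.a_closed hom_add image_eqI)
  have 2: "\<ominus>\<^bsub>B\<^esub> h x \<in> h ` U" if "x \<in> U" for x
    using that by (metis U.a_Hcarr U.a_inv_closed hom_a_inv image_eqI)
  have 3: "\<zero>\<^bsub>B\<^esub> \<in> h ` U"
    by (metis U.zero_closed hom_zero image_eqI)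
  show ?thesis
    using 1 2 3 by (intro additive_subgroupI' H.abelian_group_axioms) auto
qed

lemma additive_subgroup_preimage:
  assumes "abelian_group_hom A B h" "additive_subgroup U B"
  shows "additive_subgroup {x \<in> carrier A. h x \<in> U} A"
proof -
  interpret abelian_group_hom A B h by fact
  interpret U: additive_subgroup U B by fact
  show ?thesis
    by (intro additive_subgroupI' G.abelian_group_axioms) auto
qed

lemma additive_subgroup_equalizer:
  assumes "abelian_group_hom A B g" "abelian_group_hom A B h"
  shows "additive_subgroup {x \<in> carrier A. g x = h x} A"
proof -
  interpret g: abelian_group_hom A B g by fact
  interpret h: abelian_group_hom A B h by fact
  show ?thesis
    by (intro additive_subgroupI' g.G.abelian_group_axioms) auto
qed

text \<open>The presented rings extend \<open>A Quot I\<close> by a grading and structure maps. The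
  ring axioms depend on five fields only, and have to be moved between records of different types
  that agree in these.\<close>

lemma ring_transfer:
  fixes A :: "('a, 'y) ring_scheme" and B :: "('a, 'z) ring_scheme"
  assumes "ring A" "carrier B = carrier A" "mult B = mult A" "one B = one A" "ring.zero B = ring.zero A"
    "add B = add A"
  shows "ring B"
proof -
  interpret ring A by fact
  show ?thesis
  proof (rule ringI)
    show "abelian_group B"
      using assms by (intro abelian_groupI) (auto simp: a_assoc a_comm a_lcomm intro!: bexI[of _ "\<ominus>\<^bsub>A\<^esub> x" for x] l_neg)
    show "monoid B"
      by (rule monoidI) (simp_all add: assms(2-) m_assoc)
  qed (simp_all add: assms(2-) l_distr r_distr)
qed

lemma ring_hom_compose:
  "g \<in> ring_hom A B \<Longrightarrow> h \<in> ring_hom B C \<Longrightarrow> (\<lambda>x. h (g x)) \<in> ring_hom A C"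
  by (auto simp: ring_hom_def Pi_def)

text \<open>Being a subring, the set where two homomorphisms agree is everything as soon as it
  contains generators. Claims about all elements of a presented ring are reduced to letters through
  this lemma or the next.\<close>

lemma subring_equalizer:
  assumes "ring A" "ring B" "g \<in> ring_hom A B" "h \<in> ring_hom A B"
  shows "subring {x \<in> carrier A. g x = h x} A"
proof -
  interpret A: ring A by fact
  interpret g: abelian_group_hom A B g using assms by (intro ring_hom_imp_abelian_group_hom)
  interpret h: abelian_group_hom A B h using assms by (intro ring_hom_imp_abelian_group_hom)
  show ?thesis
    using assms by (intro A.subringI) (auto simp: ring_hom_def)
qed

lemma subring_preimage:
  assumes "ring A" "ring B" "g \<in> ring_hom A B" "subring U B"
  shows "subring {x \<in> carrier A. g x \<in> U} A"
proof -
  interpret A: ring A by fact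
  interpret g: abelian_group_hom A B g using assms by (intro ring_hom_imp_abelian_group_hom)
  show ?thesis
    using assms(3) subringE[OF assms(4)] by (intro A.subringI) (auto simp: ring_hom_def)
qed

section \<open>Row vectors and matrices\<close>

text \<open>Unlike \<open>right_mult\<close> the result is not restricted to an index range. A row
  of \<open>mat_mult\<close> is therefore literally a \<open>row_mult\<close>, and associativity of
  matrix products becomes a statement about one row.\<close>

definition row_mult :: "('a, 'z) ring_scheme \<Rightarrow> nat \<Rightarrow> (nat \<Rightarrow> 'a) \<Rightarrow> (nat \<Rightarrow> nat \<Rightarrow> 'a) \<Rightarrow> nat \<Rightarrow> 'a" where
  "row_mult C l v A j = (\<Oplus>\<^bsub>C\<^esub>s \<in> {..<l}. v s \<otimes>\<^bsub>C\<^esub> A s j)"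

lemma mat_mult_row: "mat_mult C l A B i = row_mult C l (A i) B"
  by (simp add: fun_eq_iff mat_mult_def row_mult_def)

context ring
begin

lemma row_mult_closed:
  assumes "\<And>s. s < l \<Longrightarrow> v s \<in> carrier R" "\<And>s. s < l \<Longrightarrow> A s j \<in> carrier R"
  shows "row_mult R l v A j \<in> carrier R"
  unfolding row_mult_def by (rule finsum_closed) (use assms in auto)

lemma mat_mult_closed:
  assumes "\<And>s. s < l \<Longrightarrow> A i s \<in> carrier R" "\<And>s. s < l \<Longrightarrow> B s j \<in> carrier R"
  shows "mat_mult R l A B i j \<in> carrier R"
  unfolding mat_mult_row by (rule row_mult_closed) (use assms in auto)

lemma row_mult_cong:
  assumes "\<And>s. s < l \<Longrightarrow> v s = w s" "\<And>s. s < l \<Longrightarrow> A s j = B s j"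
    "\<And>s. s < l \<Longrightarrow> w s \<in> carrier R" "\<And>s. s < l \<Longrightarrow> B s j \<in> carrier R"
  shows "row_mult R l v A j = row_mult R l w B j"
  unfolding row_mult_def by (rule finsum_cong') (use assms in auto)

lemma row_mult_assoc:
  assumes "\<And>s. s < l \<Longrightarrow> v s \<in> carrier R" "\<And>s t. s < l \<Longrightarrow> t < m \<Longrightarrow> A s t \<in> carrier R"
    "\<And>t. t < m \<Longrightarrow> B t j \<in> carrier R"
  shows "row_mult R m (row_mult R l v A) B j = row_mult R l v (mat_mult R m A B) j"
proof -
  have "row_mult R m (row_mult R l v A) B j = (\<Oplus>t\<in>{..<m}. \<Oplus>s\<in>{..<l}. v s \<otimes> A s t \<otimes> B t j)"
    unfolding row_mult_def using assms
    by (intro finsum_cong') (auto intro!: finsum_ldistr finsum_closed simp: Pi_def)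
  also have "\<dots> = (\<Oplus>s\<in>{..<l}. \<Oplus>t\<in>{..<m}. v s \<otimes> A s t \<otimes> B t j)"
    using assms by (intro finsum_swap) auto
  also have "\<dots> = (\<Oplus>s\<in>{..<l}. \<Oplus>t\<in>{..<m}. v s \<otimes> (A s t \<otimes> B t j))"
    using assms by (intro finsum_cong') (auto intro!: finsum_closed simp: m_assoc Pi_def)
  also have "\<dots> = row_mult R l v (mat_mult R m A B) j"
    unfolding row_mult_def mat_mult_def using assms
    by (intro finsum_cong') (auto intro!: finsum_rdistr[symmetric] finsum_closed simp: Pi_def)
  finally show ?thesis .
qed

end

lemma ring_hom_row_mult:
  assumes "ring A" "ring B" "h \<in> ring_hom A B" "\<And>s. s < l \<Longrightarrow> v s \<in> carrier A" "\<And>s. s < l \<Longrightarrow> M s j \<in> carrier A"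
  shows "h (row_mult A l v M j) = row_mult B l (\<lambda>s. h (v s)) (\<lambda>s t. h (M s t)) j"
proof -
  interpret A: ring A by fact
  interpret B: ring B by fact
  interpret h: abelian_group_hom A B h using assms by (intro ring_hom_imp_abelian_group_hom)
  show ?thesis
    unfolding row_mult_def using assms
    by (subst h.hom_finsum) (auto intro!: B.finsum_cong' simp: ring_hom_def)
qed

lemma ring_hom_mat_mult:
  assumes "ring A" "ring B" "h \<in> ring_hom A B" "\<And>s. s < l \<Longrightarrow> M i s \<in> carrier A" "\<And>s. s < l \<Longrightarrow> N s j \<in> carrier A"
  shows "h (mat_mult A l M N i j) = mat_mult B l (\<lambda>s t. h (M s t)) (\<lambda>s t. h (N s t)) i j"
  unfolding mat_mult_row using ring_hom_row_mult[of A B h l "M i" N j] assms by simp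

section \<open>Multiplicative families of additive subgroups\<close>

text \<open>What remains of a grading without the direct sum decomposition. This much passes to
  images and preimages under ring homomorphisms, which directness does not.\<close>

definition graded_family :: "('a, 'z) ring_scheme \<Rightarrow> ('g::monoid_add \<Rightarrow> 'a set) \<Rightarrow> bool" where
  "graded_family A G \<longleftrightarrow> (\<forall>\<gamma>. additive_subgroup (G \<gamma>) A) \<and> \<one>\<^bsub>A\<^esub> \<in> G 0 \<and>
     (\<forall>\<gamma> \<delta>. \<forall>x \<in> G \<gamma>. \<forall>y \<in> G \<delta>. x \<otimes>\<^bsub>A\<^esub> y \<in> G (\<gamma> + \<delta>))"

lemma graded_familyD:
  assumes "graded_family A G"
  shows "additive_subgroup (G \<gamma>) A" "\<one>\<^bsub>A\<^esub> \<in> G 0" "x \<in> G \<gamma> \<Longrightarrow> x \<in> carrier A"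
    "x \<in> G \<gamma> \<Longrightarrow> y \<in> G \<delta> \<Longrightarrow> x \<otimes>\<^bsub>A\<^esub> y \<in> G (\<gamma> + \<delta>)"
  using assms by (auto simp: graded_family_def dest: additive_subgroup.a_Hcarr)

lemma graded_family_image:
  assumes "ring A" "ring B" "h \<in> ring_hom A B" "graded_family A G"
  shows "graded_family B (\<lambda>\<gamma>. h ` G \<gamma>)"
proof -
  have "h x \<otimes>\<^bsub>B\<^esub> h y \<in> h ` G (\<gamma> + \<delta>)" if "x \<in> G \<gamma>" "y \<in> G \<delta>" for x y \<gamma> \<delta>
    using graded_familyD[OF assms(4)] that assms(3)
    by (auto simp: ring_hom_def intro!: image_eqI[where x = "x \<otimes>\<^bsub>A\<^esub> y"])
  moreover have "\<one>\<^bsub>B\<^esub> \<in> h ` G 0"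
    using graded_familyD(2)[OF assms(4)] assms(3) by (auto simp: ring_hom_def intro!: image_eqI[where x = "\<one>\<^bsub>A\<^esub>"])
  ultimately show ?thesis
    using additive_subgroup_image[OF ring_hom_imp_abelian_group_hom[OF assms(1-3)] graded_familyD(1)[OF assms(4)]]
    by (auto simp: graded_family_def)
qed

lemma graded_family_preimage:
  assumes "ring A" "ring B" "h \<in> ring_hom A B" "graded_family B G"
  shows "graded_family A (\<lambda>\<gamma>. {x \<in> carrier A. h x \<in> G \<gamma>})"
  using assms graded_familyD[OF assms(4)]
    additive_subgroup_preimage[OF ring_hom_imp_abelian_group_hom[OF assms(1-3)] graded_familyD(1)[OF assms(4)]]
    ringE(2)[OF assms(1)]
  by (auto simp: graded_family_def ring_hom_def monoid.m_closed monoid.one_closed)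

section \<open>Quotients by generated ideals\<close>

text \<open>Records that \<open>B\<close> is \<open>A\<close> modulo the ideal generated by
  \<open>rels\<close>, with the image grading, without fixing how cosets are coded. One set of
  lemmas then serves the free algebra, the coproduct and the final quotient.\<close>

definition presents ::
    "('g, 'a, 'y) gring_scheme \<Rightarrow> 'a set \<Rightarrow> ('g, 'b, 'z) gring_scheme \<Rightarrow> ('a \<Rightarrow> 'b) \<Rightarrow> bool" where
  "presents A rels B q \<longleftrightarrow> ring A \<and> rels \<subseteq> carrier A \<and> ring B \<and> q \<in> ring_hom A B \<and>
     q ` carrier A = carrier B \<and> (\<forall>\<gamma>. grade B \<gamma> = q ` grade A \<gamma>) \<and>
     (\<forall>a \<in> carrier A. q a = \<zero>\<^bsub>B\<^esub> \<longleftrightarrow> a \<in> Idl\<^bsub>A\<^esub> rels)"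

lemma quotient_presents:
  fixes A :: "('g, 'a, 'y) gring_scheme" and B :: "('g, 'a set, 'z) gring_scheme"
  assumes "ring A" "rels \<subseteq> carrier A"
    "carrier B = carrier (graded_quotient A rels)" "mult B = mult (graded_quotient A rels)"
    "one B = one (graded_quotient A rels)" "ring.zero B = ring.zero (graded_quotient A rels)"
    "add B = add (graded_quotient A rels)" "grade B = grade (graded_quotient A rels)"
  shows "presents A rels B (quotient_class A rels)"
proof -
  interpret A: ring A by fact
  let ?I = "Idl\<^bsub>A\<^esub> rels"
  interpret I: ideal ?I A using assms(2) by (rule A.genideal_ideal)
  have eqs: "carrier B = carrier (A Quot ?I)" "mult B = mult (A Quot ?I)" "one B = one (A Quot ?I)"
    "ring.zero B = ring.zero (A Quot ?I)" "add B = add (A Quot ?I)"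
    "grade B = (\<lambda>\<gamma>. quotient_class A rels ` grade A \<gamma>)"
    using assms by (simp_all add: graded_quotient_def ring.defs gring.defs)
  have 1: "ring B" by (rule ring_transfer[OF I.quotient_is_ring eqs(1-5)])
  have "quotient_class A rels = (+>\<^bsub>A\<^esub>) ?I"
    by (simp add: fun_eq_iff quotient_class_def)
  then have 2: "quotient_class A rels \<in> ring_hom A B"
    using I.rcos_ring_hom by (simp add: ring_hom_def eqs)
  have 3: "quotient_class A rels ` carrier A = carrier B"
    by (auto simp: eqs quotient_class_def FactRing_def A_RCOSETS_def')
  have 4: "quotient_class A rels a = \<zero>\<^bsub>B\<^esub> \<longleftrightarrow> a \<in> ?I" if "a \<in> carrier A" for a
    using that I.rcos_const_imp_mem[of a] I.a_rcos_const[of a] by (auto simp: eqs quotient_class_def FactRing_def)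
  show ?thesis
    using assms(1,2) 1 2 3 4 by (auto simp: presents_def eqs(6))
qed

lemma presents_relation:
  assumes "presents A rels B q" "r \<in> rels"
  shows "q r = \<zero>\<^bsub>B\<^esub>"
proof -
  have "r \<in> carrier A" using assms by (auto simp: presents_def)
  moreover have "r \<in> Idl\<^bsub>A\<^esub> rels" using assms ring.genideal_self[of A rels] by (auto simp: presents_def)
  ultimately show ?thesis using assms by (auto simp: presents_def)
qed

lemma presents_relation_eq:
  assumes "presents A rels B q" "a \<ominus>\<^bsub>A\<^esub> b \<in> rels" "a \<in> carrier A" "b \<in> carrier A"
  shows "q a = q b"
proof -
  have r: "ring A" "ring B" "q \<in> ring_hom A B" using assms by (auto simp: presents_def)
  interpret q: abelian_group_hom A B q using r by (intro ring_hom_imp_abelian_group_hom)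
  have "q a \<ominus>\<^bsub>B\<^esub> q b = \<zero>\<^bsub>B\<^esub>"
    using presents_relation[OF assms(1,2)] assms(3,4) by (simp add: q.hom_minus)
  then show ?thesis using assms(3,4) by (simp add: q.H.minus_eq_zero_iff)
qed

text \<open>The kernel of \<open>h\<close> is an ideal containing \<open>rels\<close>, hence
  contains all that \<open>q\<close> kills, so \<open>h\<close> is constant on the fibres of
  \<open>q\<close> and any choice of representatives defines the same \<psi>. The target is a plain
  ring because it will also be a group ring.\<close>

lemma presents_lift:
  assumes P: "presents A rels B q" and T: "ring T" and h: "h \<in> ring_hom A T"
    and rels: "\<And>r. r \<in> rels \<Longrightarrow> h r = \<zero>\<^bsub>T\<^esub>"
  obtains \<psi> where "\<psi> \<in> ring_hom B T" "\<And>a. a \<in> carrier A \<Longrightarrow> \<psi> (q a) = h a"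
proof -
  have r: "ring A" "ring B" "q \<in> ring_hom A B" "q ` carrier A = carrier B" "rels \<subseteq> carrier A"
    using P by (auto simp: presents_def)
  interpret A: ring A by fact
  interpret B: ring B by fact
  interpret T: ring T by fact
  interpret q: abelian_group_hom A B q using r by (intro ring_hom_imp_abelian_group_hom)
  interpret h: abelian_group_hom A T h using r T h by (intro ring_hom_imp_abelian_group_hom)
  interpret hh: ring_hom_ring A T h by (rule ring_hom_ringI2) fact+
  have ker: "Idl\<^bsub>A\<^esub> rels \<subseteq> a_kernel A T h"
  proof (rule A.genideal_minimal[OF hh.kernel_is_ideal])
    show "rels \<subseteq> a_kernel A T h" unfolding a_kernel_def' using rels r(5) by blast
  qed
  have eq: "h a = h b" if "q a = q b" "a \<in> carrier A" "b \<in> carrier A" for a b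
  proof -
    have "q (a \<ominus>\<^bsub>A\<^esub> b) = \<zero>\<^bsub>B\<^esub>" using that by (simp add: q.hom_minus B.minus_eq_zero_iff)
    then have "a \<ominus>\<^bsub>A\<^esub> b \<in> a_kernel A T h"
      using ker P A.minus_closed[OF that(2,3)] unfolding presents_def by blast
    then have "h (a \<ominus>\<^bsub>A\<^esub> b) = \<zero>\<^bsub>T\<^esub>" unfolding a_kernel_def' by blast
    then show ?thesis using that by (simp add: h.hom_minus T.minus_eq_zero_iff)
  qed
  define \<psi> where "\<psi> b = h (SOME a. a \<in> carrier A \<and> q a = b)" for b
  have \<psi>: "\<psi> (q a) = h a" if "a \<in> carrier A" for a
    unfolding \<psi>_def by (rule eq) (use someI[of "\<lambda>x. x \<in> carrier A \<and> q x = q a" a] that in auto)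
  have "\<psi> \<in> ring_hom B T"
  proof (rule ring_hom_memI)
    fix x y assume "x \<in> carrier B" "y \<in> carrier B"
    then obtain a b where ab: "a \<in> carrier A" "b \<in> carrier A" "x = q a" "y = q b"
      using r(4) by blast
    show "\<psi> x \<in> carrier T" using ab by (simp add: \<psi>)
    have "x \<otimes>\<^bsub>B\<^esub> y = q (a \<otimes>\<^bsub>A\<^esub> b)" using ab r(3) by (simp add: ring_hom_def)
    then show "\<psi> (x \<otimes>\<^bsub>B\<^esub> y) = \<psi> x \<otimes>\<^bsub>T\<^esub> \<psi> y" using ab h by (simp add: \<psi> ring_hom_def)
    have "\<psi> (x \<oplus>\<^bsub>B\<^esub> y) = \<psi> (q (a \<oplus>\<^bsub>A\<^esub> b))" using ab by simp
    then show "\<psi> (x \<oplus>\<^bsub>B\<^esub> y) = \<psi> x \<oplus>\<^bsub>T\<^esub> \<psi> y" using ab by (simp add: \<psi> del: q.hom_add)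
  next
    have "\<one>\<^bsub>B\<^esub> = q \<one>\<^bsub>A\<^esub>" using r(3) by (simp add: ring_hom_def)
    then show "\<psi> \<one>\<^bsub>B\<^esub> = \<one>\<^bsub>T\<^esub>" using h by (simp add: \<psi> ring_hom_def)
  qed
  then show ?thesis using \<psi> that by blast
qed

lemma presents_graded_family:
  assumes "presents A rels B q" "graded_family A (grade A)"
  shows "graded_family B (grade B)"
proof -
  have "grade B = (\<lambda>\<gamma>. q ` grade A \<gamma>)" using assms(1) by (auto simp: presents_def)
  then show ?thesis using graded_family_image[of A B q "grade A"] assms by (auto simp: presents_def)
qed

section \<open>Free rings\<close>

lemma frag_extend_fun_diff:
  "frag_extend (\<lambda>v. f v - g v) a = frag_extend f a - frag_extend g a"
proof -
  have "Poly_Mapping.keys a \<subseteq> UNIV" by simp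
  then show ?thesis
    by (induction a rule: frag_induction) (auto simp: frag_extend_diff)
qed

text \<open>Formal integer combinations arise from single words by forming differences, which
  supplies negatives as well; additivity is therefore phrased through \<open>-\<close>.\<close>

lemma frag_eqI:
  assumes "Poly_Mapping.keys a \<subseteq> S"
    and "\<And>x y. f (x - y) = f x - f y" "\<And>x y. g (x - y) = g x - g y"
    and "\<And>w. w \<in> S \<Longrightarrow> f (frag_of w) = g (frag_of w)"
  shows "f a = (g a :: 'b::ab_group_add)"
  using assms(1)
proof (induction a rule: frag_induction)
  case zero
  have "f 0 = 0" "g 0 = 0" using assms(2)[of 0 0] assms(3)[of 0 0] by auto
  then show ?case by simp
qed (auto simp: assms)

text \<open>The product of \<open>free_gring\<close>, detached from the alphabet and the degrees:
  its laws hold for all combinations of words, with no carrier conditions to discharge.\<close>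

definition word_mult :: "('x list \<Rightarrow>\<^sub>0 int) \<Rightarrow> ('x list \<Rightarrow>\<^sub>0 int) \<Rightarrow> 'x list \<Rightarrow>\<^sub>0 int" where
  "word_mult a b = frag_extend (\<lambda>v. frag_extend (\<lambda>w. frag_of (v @ w)) b) a"

lemma word_mult_diff:
  "word_mult (a - b) c = word_mult a c - word_mult b c"
  "word_mult c (a - b) = word_mult c a - word_mult c b"
  by (simp_all add: word_mult_def frag_extend_diff frag_extend_fun_diff)

lemma word_mult_of [simp]: "word_mult (frag_of v) (frag_of w) = frag_of (v @ w)"
  by (simp add: word_mult_def)

lemma word_mult_assoc: "word_mult (word_mult a b) c = word_mult a (word_mult b c)"
proof (rule frag_eqI[where S = UNIV and a = a])
  fix u
  show "word_mult (word_mult (frag_of u) b) c = word_mult (frag_of u) (word_mult b c)"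
  proof (rule frag_eqI[where S = UNIV and a = b])
    fix v
    show "word_mult (word_mult (frag_of u) (frag_of v)) c = word_mult (frag_of u) (word_mult (frag_of v) c)"
      by (rule frag_eqI[where S = UNIV and a = c]) (auto simp: word_mult_diff)
  qed (auto simp: word_mult_diff)
qed (auto simp: word_mult_diff)

lemma word_mult_one: "word_mult (frag_of []) a = a" "word_mult a (frag_of []) = a"
  by (rule frag_eqI[where S = UNIV and a = a]; simp add: word_mult_diff)+

lemma word_mult_add:
  "word_mult (a + b) c = word_mult a c + word_mult b c"
  "word_mult c (a + b) = word_mult c a + word_mult c b"
  using word_mult_diff(1)[of "a + b" b c] word_mult_diff(2)[of c "a + b" b] by simp_all

lemma word_mult_keys:
  assumes "Poly_Mapping.keys a \<subseteq> V" "Poly_Mapping.keys b \<subseteq> W" "\<And>v w. v \<in> V \<Longrightarrow> w \<in> W \<Longrightarrow> v @ w \<in> U"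
  shows "Poly_Mapping.keys (word_mult a b) \<subseteq> U"
proof -
  have "Poly_Mapping.keys (word_mult a b)
      \<subseteq> (\<Union>v\<in>Poly_Mapping.keys a. \<Union>w\<in>Poly_Mapping.keys b. {v @ w})"
    unfolding word_mult_def
    by (rule order.trans[OF keys_frag_extend], rule UN_mono, simp, rule order.trans[OF keys_frag_extend]) simp
  then show ?thesis using assms by fastforce
qed

lemma free_gring_simps [simp]:
  "carrier (free_gring X D) = {c. Poly_Mapping.keys c \<subseteq> lists X}"
  "\<one>\<^bsub>free_gring X D\<^esub> = frag_of []" "\<zero>\<^bsub>free_gring X D\<^esub> = 0"
  "a \<oplus>\<^bsub>free_gring X D\<^esub> b = a + b" "a \<otimes>\<^bsub>free_gring X D\<^esub> b = word_mult a b"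
  "grade (free_gring X D) \<gamma> = {c. Poly_Mapping.keys c \<subseteq> {w \<in> lists X. word_degree D w \<gamma>}}"
  by (simp_all add: free_gring_def word_mult_def)

lemma keys_plus_subset:
  "Poly_Mapping.keys a \<subseteq> S \<Longrightarrow> Poly_Mapping.keys b \<subseteq> S \<Longrightarrow> Poly_Mapping.keys (a + b) \<subseteq> S"
  using Poly_Mapping.keys_add[of a b] by blast

lemma keys_minus_subset:
  "Poly_Mapping.keys (a :: 'a \<Rightarrow>\<^sub>0 int) \<subseteq> S \<Longrightarrow> Poly_Mapping.keys b \<subseteq> S \<Longrightarrow> Poly_Mapping.keys (a - b) \<subseteq> S"
  using keys_diff[of a b] by blast

lemma ring_free_gring: "ring (free_gring X D)"
proof (rule ringI)
  show "abelian_group (free_gring X D)"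
  proof (rule abelian_groupI)
    fix x assume "x \<in> carrier (free_gring X D)"
    then show "\<exists>y\<in>carrier (free_gring X D). y \<oplus>\<^bsub>free_gring X D\<^esub> x = \<zero>\<^bsub>free_gring X D\<^esub>"
      by (intro bexI[of _ "- x"]) auto
  qed (simp_all add: keys_plus_subset add_ac)
  show "monoid (free_gring X D)"
  proof (rule monoidI)
    fix x y assume "x \<in> carrier (free_gring X D)" "y \<in> carrier (free_gring X D)"
    then have "Poly_Mapping.keys (word_mult x y) \<subseteq> lists X"
      by (intro word_mult_keys[of _ "lists X" _ "lists X"]) simp_all
    then show "x \<otimes>\<^bsub>free_gring X D\<^esub> y \<in> carrier (free_gring X D)" by simp
  qed (simp_all add: word_mult_assoc word_mult_one)
qed (auto simp: word_mult_add)

lemma free_gring_minus: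
  assumes "a \<in> carrier (free_gring X D)" "b \<in> carrier (free_gring X D)"
  shows "a \<ominus>\<^bsub>free_gring X D\<^esub> b = a - b" "\<ominus>\<^bsub>free_gring X D\<^esub> b = - b"
proof -
  interpret ring "free_gring X D" by (rule ring_free_gring)
  show *: "\<ominus>\<^bsub>free_gring X D\<^esub> b = - b"
    using assms(2) by (intro minus_equality) auto
  show "a \<ominus>\<^bsub>free_gring X D\<^esub> b = a - b"
    by (simp add: a_minus_def *)
qed

lemma word_degree_Nil: "word_degree D [] \<gamma> \<longleftrightarrow> \<gamma> = 0"
  by (auto simp: word_degree_def)

lemma word_degree_Cons:
  "word_degree D (x # w) \<gamma> \<longleftrightarrow> (\<exists>\<delta> \<epsilon>. \<delta> \<in> D x \<and> word_degree D w \<epsilon> \<and> \<gamma> = \<delta> + \<epsilon>)"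
proof
  assume "word_degree D (x # w) \<gamma>"
  then obtain ds where "list_all2 (\<lambda>x \<delta>. \<delta> \<in> D x) (x # w) ds" "sum_list ds = \<gamma>"
    by (auto simp: word_degree_def)
  then show "\<exists>\<delta> \<epsilon>. \<delta> \<in> D x \<and> word_degree D w \<epsilon> \<and> \<gamma> = \<delta> + \<epsilon>"
    by (cases ds) (auto simp: word_degree_def)
next
  assume "\<exists>\<delta> \<epsilon>. \<delta> \<in> D x \<and> word_degree D w \<epsilon> \<and> \<gamma> = \<delta> + \<epsilon>"
  then obtain \<delta> ds where "\<delta> \<in> D x" "list_all2 (\<lambda>x \<delta>. \<delta> \<in> D x) w ds" "\<gamma> = \<delta> + sum_list ds"
    by (auto simp: word_degree_def)
  then show "word_degree D (x # w) \<gamma>"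
    by (auto simp: word_degree_def intro!: exI[of _ "\<delta> # ds"])
qed

lemma word_degree_append:
  "word_degree D v \<gamma> \<Longrightarrow> word_degree D w \<delta> \<Longrightarrow> word_degree D (v @ w) (\<gamma> + \<delta>)"
proof (induction v arbitrary: \<gamma>)
  case (Cons x v)
  then obtain \<epsilon> \<eta> where "\<epsilon> \<in> D x" "word_degree D v \<eta>" "\<gamma> = \<epsilon> + \<eta>" by (auto simp: word_degree_Cons)
  then show ?case using Cons by (auto simp: word_degree_Cons add.assoc)
qed (simp add: word_degree_Nil)

text \<open>Degrees of words add up under concatenation. More cannot be expected here, since a word
  may have several degrees or none, so that the subgroups need neither be independent nor
  span.\<close>

lemma graded_family_free_gring: "graded_family (free_gring X D) (grade (free_gring X D))"
proof -
  have "additive_subgroup (grade (free_gring X D) \<gamma>) (free_gring X D)" for \<gamma>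
  proof (rule additive_subgroupI'[OF ring.is_abelian_group[OF ring_free_gring]])
    show sub: "grade (free_gring X D) \<gamma> \<subseteq> carrier (free_gring X D)" by auto
    fix x assume "x \<in> grade (free_gring X D) \<gamma>"
    with subsetD[OF sub this] show "\<ominus>\<^bsub>free_gring X D\<^esub> x \<in> grade (free_gring X D) \<gamma>"
      using free_gring_minus(2)[of 0 X D x] by simp
  qed (simp_all add: keys_plus_subset)
  moreover have "word_mult a b \<in> grade (free_gring X D) (\<gamma> + \<delta>)"
    if "a \<in> grade (free_gring X D) \<gamma>" "b \<in> grade (free_gring X D) \<delta>" for a b \<gamma> \<delta>
    using that unfolding free_gring_simps mem_Collect_eq
    by (rule word_mult_keys) (auto intro: word_degree_append)
  ultimately show ?thesis
    by (simp add: graded_family_def word_degree_Nil)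
qed

lemma subring_free_gring:
  assumes U: "subring U (free_gring X D)" and X: "\<And>x. x \<in> X \<Longrightarrow> frag_of [x] \<in> U"
  shows "carrier (free_gring X D) \<subseteq> U"
proof
  fix c assume "c \<in> carrier (free_gring X D)"
  then have c: "Poly_Mapping.keys c \<subseteq> lists X" by simp
  note U' = subringE[OF U]
  have w: "frag_of w \<in> U" if "w \<in> lists X" for w
    using that
  proof (induction w)
    case Nil
    then show ?case using U'(3) by simp
  next
    case (Cons x w)
    then show ?case using U'(6)[of "frag_of [x]" "frag_of w"] X by simp
  qed
  from c show "c \<in> U"
  proof (induction c rule: frag_induction)
    case zero then show ?case using U'(2) by simp
  next
    case (diff a b)
    have "a \<in> carrier (free_gring X D)" "b \<in> carrier (free_gring X D)" using diff U'(1) by auto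
    then show ?case using U'(7)[OF diff(1)] U'(5)[OF diff(2)] U'(7)[OF diff(1) U'(5)[OF diff(2)]]
      by (simp add: free_gring_minus)
  qed (auto simp: w)
qed

text \<open>Minimality of the grading: it lies in every multiplicative family that has the letters
  in their degrees. To show that a map is graded it thus suffices to look at letters.\<close>

lemma grade_free_gring_subset:
  assumes G: "graded_family (free_gring X D) G"
    and X: "\<And>x \<delta>. x \<in> X \<Longrightarrow> \<delta> \<in> D x \<Longrightarrow> frag_of [x] \<in> G \<delta>"
  shows "grade (free_gring X D) \<gamma> \<subseteq> G \<gamma>"
proof
  fix c assume "c \<in> grade (free_gring X D) \<gamma>"
  then have c: "Poly_Mapping.keys c \<subseteq> {w \<in> lists X. word_degree D w \<gamma>}" by simp
  have w: "frag_of w \<in> G \<delta>" if "w \<in> lists X" "word_degree D w \<delta>" for w \<delta>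
    using that
  proof (induction w arbitrary: \<delta>)
    case Nil
    then show ?case using graded_familyD(2)[OF G] by (simp add: word_degree_Nil)
  next
    case (Cons x w)
    then obtain \<epsilon> \<eta> where "\<epsilon> \<in> D x" "word_degree D w \<eta>" "\<delta> = \<epsilon> + \<eta>" by (auto simp: word_degree_Cons)
    then show ?case using graded_familyD(4)[OF G, of "frag_of [x]" \<epsilon> "frag_of w" \<eta>] Cons X by simp
  qed
  interpret G: additive_subgroup "G \<gamma>" "free_gring X D" by (rule graded_familyD(1)[OF G])
  from c show "c \<in> G \<gamma>"
  proof (induction c rule: frag_induction)
    case zero then show ?case using G.zero_closed by simp
  next
    case (diff a b)
    have "a \<in> carrier (free_gring X D)" "b \<in> carrier (free_gring X D)" using diff G.a_subset by auto
    then show ?case using G.a_closed[OF diff(1) G.a_inv_closed[OF diff(2)]]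
      by (simp add: free_gring_minus)
  qed (auto simp: w)
qed

text \<open>A word is evaluated to the product of the values of its letters, and the universal
  property of the free abelian group extends this additively. Multiplicativity is shown for a word
  on the left (\<open>m1\<close>), then for any left factor (\<open>m2\<close>).\<close>

lemma free_gring_lift:
  assumes T: "ring T" and \<phi>: "\<And>x. x \<in> X \<Longrightarrow> \<phi> x \<in> carrier T"
  obtains h where "h \<in> ring_hom (free_gring X D) T" "\<And>x. x \<in> X \<Longrightarrow> h (frag_of [x]) = \<phi> x"
proof -
  interpret T: ring T by fact
  define ev where "ev w = foldr (\<lambda>x t. \<phi> x \<otimes>\<^bsub>T\<^esub> t) w \<one>\<^bsub>T\<^esub>" for w
  have ev_closed: "ev w \<in> carrier T" if "w \<in> lists X" for w
    using that by (induction w) (auto simp: ev_def \<phi>)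
  have ev_append: "ev (v @ w) = ev v \<otimes>\<^bsub>T\<^esub> ev w" if "v \<in> lists X" "w \<in> lists X" for v w
    using that(1)
  proof (induction v)
    case (Cons x v)
    then show ?case using ev_closed[OF Cons(2)] ev_closed[OF that(2)] \<phi>
      by (simp add: ev_def T.m_assoc)
  qed (use ev_closed[OF that(2)] in \<open>simp add: ev_def\<close>)
  have "ev ` lists X \<subseteq> carrier (add_monoid T)" using ev_closed by auto
  then obtain h where h: "h \<in> hom (free_Abelian_group (lists X)) (add_monoid T)"
    and hw: "\<And>w. w \<in> lists X \<Longrightarrow> h (frag_of w) = ev w"
    using comm_group.free_Abelian_group_universal[OF T.a_comm_group, of ev "lists X"] by auto
  let ?F = "free_gring X D"
  have h_hom: "abelian_group_hom ?F T h"
    using h by (intro abelian_group_homI' T.abelian_group_axioms ring.is_abelian_group ring_free_gring)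
      (auto simp: hom_def)
  interpret h: abelian_group_hom ?F T h by (rule h_hom)
  have h_diff: "h (a - b) = h a \<ominus>\<^bsub>T\<^esub> h b" if "a \<in> carrier ?F" "b \<in> carrier ?F" for a b
    using h.hom_minus[OF that] by (simp only: free_gring_minus[OF that])
  have m1: "h (word_mult (frag_of v) b) = ev v \<otimes>\<^bsub>T\<^esub> h b" if "b \<in> carrier ?F" "v \<in> lists X" for v b
  proof -
    have "Poly_Mapping.keys b \<subseteq> lists X" using that by simp
    \<comment> \<open>Membership in the carrier is carried through the induction because
      \<open>h\<close> respects differences only there.\<close>
    then have "Poly_Mapping.keys b \<subseteq> lists X \<and> h (word_mult (frag_of v) b) = ev v \<otimes>\<^bsub>T\<^esub> h b"
    proof (induction b rule: frag_induction)
      case zero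
      then show ?case using h.hom_zero ev_closed[OF that(2)] by (simp add: word_mult_def)
    next
      case (one w)
      then show ?case using that by (simp add: hw ev_append)
    next
      case (diff a b)
      have k: "Poly_Mapping.keys (word_mult (frag_of v) c) \<subseteq> lists X" if "Poly_Mapping.keys c \<subseteq> lists X" for c
        using that \<open>v \<in> lists X\<close> by (intro word_mult_keys[of _ "lists X" _ "lists X"]) auto
      have "h a \<in> carrier T" "h b \<in> carrier T" using diff by simp_all
      then show ?case using diff k ev_closed[OF that(2)]
        by (simp add: word_mult_diff h_diff keys_minus_subset a_minus_def T.r_distr T.r_minus)
    qed
    then show ?thesis ..
  qed
  have m2: "h (word_mult a b) = h a \<otimes>\<^bsub>T\<^esub> h b" if "a \<in> carrier ?F" "b \<in> carrier ?F" for a b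
  proof -
    have "Poly_Mapping.keys a \<subseteq> lists X" using that by simp
    then have "Poly_Mapping.keys a \<subseteq> lists X \<and> h (word_mult a b) = h a \<otimes>\<^bsub>T\<^esub> h b"
    proof (induction a rule: frag_induction)
      case zero
      then show ?case using h.hom_zero h.hom_closed[OF that(2)] by (simp add: word_mult_def)
    next
      case (one w)
      then show ?case using that m1 by (simp add: hw)
    next
      case (diff a c)
      have k: "Poly_Mapping.keys (word_mult c b) \<subseteq> lists X" if "Poly_Mapping.keys c \<subseteq> lists X" for c
        using that \<open>b \<in> carrier ?F\<close> by (intro word_mult_keys[of _ "lists X" _ "lists X"]) auto
      have "h a \<in> carrier T" "h b \<in> carrier T" "h c \<in> carrier T" using diff that by simp_all
      then show ?case using diff k
        by (simp add: word_mult_diff h_diff keys_minus_subset a_minus_def T.l_distr T.l_minus)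
    qed
    then show ?thesis ..
  qed
  have "h (frag_of []) = \<one>\<^bsub>T\<^esub>" by (simp add: hw ev_def)
  then have "h \<in> ring_hom ?F T"
    using h.hom_closed h.hom_add m2 by (intro ring_hom_memI) auto
  moreover have "h (frag_of [x]) = \<phi> x" if "x \<in> X" for x
    using that \<phi> by (simp add: hw ev_def)
  ultimately show ?thesis using that by blast
qed

section \<open>Letters that stand for the elements of a ring\<close>

lemma hom_relations_carrier:
  assumes "ring A" "\<And>a. a \<in> carrier A \<Longrightarrow> \<iota> a \<in> X"
  shows "hom_relations A \<iota> \<subseteq> carrier (free_gring X D)"
proof -
  interpret ring A by fact
  show ?thesis
    unfolding hom_relations_def
    by (intro Un_least subsetI; elim CollectE exE conjE singletonE; simp add: keys_minus_subset assms(2))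
qed

lemma free_ring_hom_words:
  assumes "ring T" "h \<in> ring_hom (free_gring X D) T"
  shows "h (frag_of []) = \<one>\<^bsub>T\<^esub>"
    "x \<in> X \<Longrightarrow> y \<in> X \<Longrightarrow> h (frag_of [x, y]) = h (frag_of [x]) \<otimes>\<^bsub>T\<^esub> h (frag_of [y])"
    "a \<in> carrier (free_gring X D) \<Longrightarrow> b \<in> carrier (free_gring X D) \<Longrightarrow> h (a - b) = h a \<ominus>\<^bsub>T\<^esub> h b"
proof -
  interpret h: abelian_group_hom "free_gring X D" T h
    using assms by (intro ring_hom_imp_abelian_group_hom ring_free_gring)
  show "h (frag_of []) = \<one>\<^bsub>T\<^esub>" using ring_hom_one[OF assms(2)] by simp
  show "h (frag_of [x, y]) = h (frag_of [x]) \<otimes>\<^bsub>T\<^esub> h (frag_of [y])" if "x \<in> X" "y \<in> X"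
    using ring_hom_mult[OF assms(2), of "frag_of [x]" "frag_of [y]"] that by simp
  show "h (a - b) = h a \<ominus>\<^bsub>T\<^esub> h b" if "a \<in> carrier (free_gring X D)" "b \<in> carrier (free_gring X D)"
    using h.hom_minus[OF that] free_gring_minus[OF that] by simp
qed

lemma hom_relations_vanish:
  assumes A: "ring A" and X: "\<And>a. a \<in> carrier A \<Longrightarrow> \<iota> a \<in> X" and T: "ring T"
    and h: "h \<in> ring_hom (free_gring X D) T" and \<rho>: "\<rho> \<in> ring_hom A T"
    and eq: "\<And>a. a \<in> carrier A \<Longrightarrow> h (frag_of [\<iota> a]) = \<rho> a" and r: "r \<in> hom_relations A \<iota>"
  shows "h r = \<zero>\<^bsub>T\<^esub>"
proof -
  interpret A: ring A by fact
  interpret T: ring T by fact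
  note w = free_ring_hom_words[OF T h]
  have \<rho>c: "\<rho> a \<in> carrier T" if "a \<in> carrier A" for a using \<rho> that by (auto simp: ring_hom_def)
  have z: "a \<oplus>\<^bsub>T\<^esub> b \<ominus>\<^bsub>T\<^esub> a \<ominus>\<^bsub>T\<^esub> b = \<zero>\<^bsub>T\<^esub>" if "a \<in> carrier T" "b \<in> carrier T" for a b
    using that by algebra
  show ?thesis
    using r unfolding hom_relations_def
    by (elim UnE CollectE exE conjE singletonE)
       (use X \<rho> in \<open>simp_all add: w eq keys_minus_subset \<rho>c z ring_hom_def T.minus_eq_zero_iff\<close>)
qed

text \<open>Counterpart of \<open>hom_relations_vanish\<close>: that lemma yields maps out of a ring
  with such letters, this one the structure map into it. Each relation is one axiom of a
  homomorphism, read in the quotient.\<close>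

lemma hom_relations_hom:
  assumes A: "ring A" and X: "\<And>a. a \<in> carrier A \<Longrightarrow> \<iota> a \<in> X"
    and P: "presents (free_gring X D) rels B q" and sub: "hom_relations A \<iota> \<subseteq> rels"
  shows "(\<lambda>a. q (frag_of [\<iota> a])) \<in> ring_hom A B"
proof -
  interpret A: ring A by fact
  have B: "ring B" and q: "q \<in> ring_hom (free_gring X D) B" using P by (auto simp: presents_def)
  interpret B: ring B by fact
  note w = free_ring_hom_words[OF B q]
  have cl: "q (frag_of [\<iota> a]) \<in> carrier B" if "a \<in> carrier A" for a
    using X[OF that] by (intro ring_hom_closed[OF q]) simp
  have rel: "q r = \<zero>\<^bsub>B\<^esub>" if "r \<in> hom_relations A \<iota>" for r
    using presents_relation[OF P] that sub by blast
  show ?thesis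
  proof (rule ring_hom_memI)
    fix a b assume ab: "a \<in> carrier A" "b \<in> carrier A"
    show "q (frag_of [\<iota> a]) \<in> carrier B" using ab by (simp add: cl)
    have "q (frag_of [\<iota> (a \<otimes>\<^bsub>A\<^esub> b)] - frag_of [\<iota> a, \<iota> b]) = \<zero>\<^bsub>B\<^esub>"
      by (rule rel) (use ab in \<open>auto simp: hom_relations_def\<close>)
    then show "q (frag_of [\<iota> (a \<otimes>\<^bsub>A\<^esub> b)]) = q (frag_of [\<iota> a]) \<otimes>\<^bsub>B\<^esub> q (frag_of [\<iota> b])"
      using ab X cl by (simp add: w B.minus_eq_zero_iff)
    have "q (frag_of [\<iota> (a \<oplus>\<^bsub>A\<^esub> b)] - frag_of [\<iota> a] - frag_of [\<iota> b]) = \<zero>\<^bsub>B\<^esub>"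
      by (rule rel) (use ab in \<open>auto simp: hom_relations_def\<close>)
    then have "q (frag_of [\<iota> (a \<oplus>\<^bsub>A\<^esub> b)]) \<ominus>\<^bsub>B\<^esub> q (frag_of [\<iota> a]) = q (frag_of [\<iota> b])"
      using ab X cl by (simp add: w B.minus_eq_zero_iff keys_minus_subset)
    then show "q (frag_of [\<iota> (a \<oplus>\<^bsub>A\<^esub> b)]) = q (frag_of [\<iota> a]) \<oplus>\<^bsub>B\<^esub> q (frag_of [\<iota> b])"
      using ab cl B.minus_eq_iff by (simp add: B.minus_eq_iff)
  next
    have "q (frag_of [\<iota> \<one>\<^bsub>A\<^esub>] - frag_of []) = \<zero>\<^bsub>B\<^esub>"
      by (rule rel) (auto simp: hom_relations_def)
    then show "q (frag_of [\<iota> \<one>\<^bsub>A\<^esub>]) = \<one>\<^bsub>B\<^esub>"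
      using X cl by (simp add: w B.minus_eq_zero_iff)
  qed
qed

section \<open>Group rings and homogeneous components\<close>

definition support :: "('a, 'z) ring_scheme \<Rightarrow> ('g \<Rightarrow> 'a) \<Rightarrow> 'g set" where
  "support A c = {\<gamma>. c \<gamma> \<noteq> \<zero>\<^bsub>A\<^esub>}"

text \<open>The monomial with coefficient \<open>a\<close> at the group element \<alpha>.\<close>

definition gmono :: "('a, 'z) ring_scheme \<Rightarrow> 'g \<Rightarrow> 'a \<Rightarrow> 'g \<Rightarrow> 'a" where
  "gmono A \<alpha> a = (\<lambda>\<gamma>. if \<gamma> = \<alpha> then a else \<zero>\<^bsub>A\<^esub>)"

text \<open>The group ring A[\<Gamma>], coded by coefficient functions of finite support. The
  convolution runs over the support of the left factor, which makes the sum finite.\<close>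

definition group_ring :: "('a, 'z) ring_scheme \<Rightarrow> ('g::ab_group_add \<Rightarrow> 'a) ring" where
  "group_ring A =
     \<lparr>carrier = {c. (\<forall>\<gamma>. c \<gamma> \<in> carrier A) \<and> finite (support A c)},
      mult = (\<lambda>c d \<gamma>. \<Oplus>\<^bsub>A\<^esub>\<alpha> \<in> support A c. c \<alpha> \<otimes>\<^bsub>A\<^esub> d (\<gamma> - \<alpha>)),
      one = gmono A 0 \<one>\<^bsub>A\<^esub>, ring.zero = (\<lambda>_. \<zero>\<^bsub>A\<^esub>), ring.add = (\<lambda>c d \<gamma>. c \<gamma> \<oplus>\<^bsub>A\<^esub> d \<gamma>)\<rparr>"

text \<open>The map from A[\<Gamma>] to A that sends every group element to 1; on a family of
  homogeneous components it puts the element together again.\<close>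

definition augmentation :: "('a, 'z) ring_scheme \<Rightarrow> ('g \<Rightarrow> 'a) \<Rightarrow> 'a" where
  "augmentation A c = (\<Oplus>\<^bsub>A\<^esub>\<alpha> \<in> support A c. c \<alpha>)"

lemma group_ring_simps:
  "c \<in> carrier (group_ring A) \<longleftrightarrow> (\<forall>\<gamma>. c \<gamma> \<in> carrier A) \<and> finite (support A c)"
  "\<one>\<^bsub>group_ring A\<^esub> = gmono A 0 \<one>\<^bsub>A\<^esub>" "\<zero>\<^bsub>group_ring A\<^esub> = (\<lambda>_. \<zero>\<^bsub>A\<^esub>)"
  "(c \<oplus>\<^bsub>group_ring A\<^esub> d) = (\<lambda>\<gamma>. c \<gamma> \<oplus>\<^bsub>A\<^esub> d \<gamma>)"
  "(c \<otimes>\<^bsub>group_ring A\<^esub> d) = (\<lambda>\<gamma>. \<Oplus>\<^bsub>A\<^esub>\<alpha> \<in> support A c. c \<alpha> \<otimes>\<^bsub>A\<^esub> d (\<gamma> - \<alpha>))"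
  by (simp_all add: group_ring_def)

context ring
begin

lemma support_add_subset:
  assumes "\<And>\<gamma>. c \<gamma> \<in> carrier R" "\<And>\<gamma>. d \<gamma> \<in> carrier R"
  shows "support R (\<lambda>\<gamma>. c \<gamma> \<oplus> d \<gamma>) \<subseteq> support R c \<union> support R d"
  using assms by (auto simp: support_def)

lemma abelian_group_group_ring: "abelian_group (group_ring R)"
proof (rule abelian_groupI)
  fix c d :: "'g::ab_group_add \<Rightarrow> 'a" assume "c \<in> carrier (group_ring R)" "d \<in> carrier (group_ring R)"
  then show "c \<oplus>\<^bsub>group_ring R\<^esub> d \<in> carrier (group_ring R)"
    using finite_subset[OF support_add_subset[of c d]] by (simp add: group_ring_simps)
next
  fix c assume c: "c \<in> carrier (group_ring R)"
  have "support R (\<lambda>\<gamma>. \<ominus> c \<gamma>) \<subseteq> support R c"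
    by (auto simp: support_def)
  then have "(\<lambda>\<gamma>. \<ominus> c \<gamma>) \<in> carrier (group_ring R)"
    using c by (auto simp: group_ring_simps intro: finite_subset)
  then show "\<exists>d\<in>carrier (group_ring R). d \<oplus>\<^bsub>group_ring R\<^esub> c = \<zero>\<^bsub>group_ring R\<^esub>"
    using c by (intro bexI[of _ "\<lambda>\<gamma>. \<ominus> c \<gamma>"]) (auto simp: group_ring_simps l_neg)
qed (auto simp: group_ring_simps support_def a_assoc a_comm a_lcomm fun_eq_iff)

text \<open>Products with different left factors are sums over different index sets; they can be
  added once both run over a common finite set.\<close>

lemma group_ring_mult_superset:
  assumes "c \<in> carrier (group_ring R)" "\<And>\<gamma>. d \<gamma> \<in> carrier R" "finite S" "support R c \<subseteq> S"
  shows "(c \<otimes>\<^bsub>group_ring R\<^esub> d) \<gamma> = (\<Oplus>\<alpha>\<in>S. c \<alpha> \<otimes> d (\<gamma> - \<alpha>))"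
  unfolding group_ring_simps
  by (rule add.finprod_mono_neutral_cong_left) (use assms in \<open>auto simp: group_ring_simps support_def\<close>)

lemma augmentation_superset:
  assumes "\<And>\<gamma>. c \<gamma> \<in> carrier R" "finite S" "support R c \<subseteq> S"
  shows "augmentation R c = (\<Oplus>\<alpha>\<in>S. c \<alpha>)"
  unfolding augmentation_def
  by (rule add.finprod_mono_neutral_cong_left) (use assms in \<open>auto simp: support_def\<close>)

lemma gmono_closed: "a \<in> carrier R \<Longrightarrow> gmono R \<alpha> a \<in> carrier (group_ring R)"
  by (auto simp: group_ring_simps gmono_def support_def)

lemma support_gmono: "support R (gmono R \<alpha> a) \<subseteq> {\<alpha>}"
  by (auto simp: gmono_def support_def)

lemma gmono_mult_eval:
  assumes "a \<in> carrier R" "\<And>\<gamma>. d \<gamma> \<in> carrier R"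
  shows "(gmono R \<alpha> a \<otimes>\<^bsub>group_ring R\<^esub> d) \<gamma> = a \<otimes> d (\<gamma> - \<alpha>)"
  using group_ring_mult_superset[OF gmono_closed[OF assms(1)] assms(2) _ support_gmono] assms
  by (simp add: gmono_def finsum_insert finsum_empty)

lemma gmono_mult:
  assumes "a \<in> carrier R" "b \<in> carrier R"
  shows "gmono R \<alpha> a \<otimes>\<^bsub>group_ring R\<^esub> gmono R \<beta> b = gmono R (\<alpha> + \<beta>) (a \<otimes> b)"
proof
  fix \<gamma>
  have "\<gamma> - \<alpha> = \<beta> \<longleftrightarrow> \<gamma> = \<alpha> + \<beta>" by (auto simp: algebra_simps)
  then show "(gmono R \<alpha> a \<otimes>\<^bsub>group_ring R\<^esub> gmono R \<beta> b) \<gamma> = gmono R (\<alpha> + \<beta>) (a \<otimes> b) \<gamma>"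
    using assms by (subst gmono_mult_eval) (auto simp: gmono_def)
qed

lemma group_ring_mult_closed:
  assumes c: "c \<in> carrier (group_ring R)" and d: "d \<in> carrier (group_ring R)"
  shows "c \<otimes>\<^bsub>group_ring R\<^esub> d \<in> carrier (group_ring R)"
proof -
  have "support R (c \<otimes>\<^bsub>group_ring R\<^esub> d) \<subseteq> (\<lambda>(\<alpha>, \<beta>). \<alpha> + \<beta>) ` (support R c \<times> support R d)"
  proof
    fix \<gamma> assume "\<gamma> \<in> support R (c \<otimes>\<^bsub>group_ring R\<^esub> d)"
    then have "(\<Oplus>\<alpha>\<in>support R c. c \<alpha> \<otimes> d (\<gamma> - \<alpha>)) \<noteq> \<zero>" by (simp add: support_def group_ring_simps)
    then obtain \<alpha> where "\<alpha> \<in> support R c" "c \<alpha> \<otimes> d (\<gamma> - \<alpha>) \<noteq> \<zero>"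
      using add.finprod_one_eqI[of "support R c" "\<lambda>\<alpha>. c \<alpha> \<otimes> d (\<gamma> - \<alpha>)"] by blast
    moreover from this have "\<gamma> - \<alpha> \<in> support R d"
      using c by (auto simp: support_def group_ring_simps)
    ultimately show "\<gamma> \<in> (\<lambda>(\<alpha>, \<beta>). \<alpha> + \<beta>) ` (support R c \<times> support R d)"
      by (auto intro!: image_eqI[of _ _ "(\<alpha>, \<gamma> - \<alpha>)"])
  qed
  then have "finite (support R (c \<otimes>\<^bsub>group_ring R\<^esub> d))"
    using c d by (auto simp: group_ring_simps intro: finite_subset)
  then show ?thesis
    using c d by (simp add: group_ring_simps)
qed

lemma group_ring_distr:
  assumes c: "c \<in> carrier (group_ring R)" and d: "d \<in> carrier (group_ring R)" and b: "b \<in> carrier (group_ring R)"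
  shows "(c \<oplus>\<^bsub>group_ring R\<^esub> d) \<otimes>\<^bsub>group_ring R\<^esub> b = (c \<otimes>\<^bsub>group_ring R\<^esub> b) \<oplus>\<^bsub>group_ring R\<^esub> (d \<otimes>\<^bsub>group_ring R\<^esub> b)"
    and "b \<otimes>\<^bsub>group_ring R\<^esub> (c \<oplus>\<^bsub>group_ring R\<^esub> d) = (b \<otimes>\<^bsub>group_ring R\<^esub> c) \<oplus>\<^bsub>group_ring R\<^esub> (b \<otimes>\<^bsub>group_ring R\<^esub> d)"
proof -
  let ?S = "support R c \<union> support R d"
  have cd: "c \<oplus>\<^bsub>group_ring R\<^esub> d \<in> carrier (group_ring R)"
    using c d by (rule abelian_groupE(1)[OF abelian_group_group_ring])
  have cl: "\<And>\<gamma>. c \<gamma> \<in> carrier R" "\<And>\<gamma>. d \<gamma> \<in> carrier R" "\<And>\<gamma>. b \<gamma> \<in> carrier R" "finite ?S"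
    using assms by (auto simp: group_ring_simps)
  have sub: "support R (c \<oplus>\<^bsub>group_ring R\<^esub> d) \<subseteq> ?S"
    using support_add_subset[of c d] cl by (simp add: group_ring_simps)
  show "(c \<oplus>\<^bsub>group_ring R\<^esub> d) \<otimes>\<^bsub>group_ring R\<^esub> b = (c \<otimes>\<^bsub>group_ring R\<^esub> b) \<oplus>\<^bsub>group_ring R\<^esub> (d \<otimes>\<^bsub>group_ring R\<^esub> b)"
  proof
    fix \<gamma>
    have "((c \<oplus>\<^bsub>group_ring R\<^esub> d) \<otimes>\<^bsub>group_ring R\<^esub> b) \<gamma> = (\<Oplus>\<alpha>\<in>?S. c \<alpha> \<otimes> b (\<gamma> - \<alpha>) \<oplus> d \<alpha> \<otimes> b (\<gamma> - \<alpha>))"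
      using group_ring_mult_superset[OF cd cl(3) cl(4) sub] cl
      by (simp add: group_ring_simps(4) l_distr)
    also have "\<dots> = (c \<otimes>\<^bsub>group_ring R\<^esub> b) \<gamma> \<oplus> (d \<otimes>\<^bsub>group_ring R\<^esub> b) \<gamma>"
      using cl by (subst group_ring_mult_superset[OF c cl(3) cl(4)], simp,
          subst group_ring_mult_superset[OF d cl(3) cl(4)], simp, subst finsum_addf) (auto)
    finally show "((c \<oplus>\<^bsub>group_ring R\<^esub> d) \<otimes>\<^bsub>group_ring R\<^esub> b) \<gamma> =
        (c \<otimes>\<^bsub>group_ring R\<^esub> b \<oplus>\<^bsub>group_ring R\<^esub> d \<otimes>\<^bsub>group_ring R\<^esub> b) \<gamma>"
      by (simp add: group_ring_simps(4))
  qed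
  show "b \<otimes>\<^bsub>group_ring R\<^esub> (c \<oplus>\<^bsub>group_ring R\<^esub> d) = (b \<otimes>\<^bsub>group_ring R\<^esub> c) \<oplus>\<^bsub>group_ring R\<^esub> (b \<otimes>\<^bsub>group_ring R\<^esub> d)"
    using cl by (simp add: group_ring_simps fun_eq_iff r_distr finsum_addf Pi_def)
qed

text \<open>One point of the support is split off at a time. The sets \<open>U\<close> let the
  monomial case remember a property of the coefficients, such as being central; otherwise they are
  \<open>UNIV\<close>.\<close>

lemma group_ring_induct [consumes 2, case_names zero gmono add]:
  assumes c: "c \<in> carrier (group_ring R)" and U: "\<And>\<gamma>. c \<gamma> \<in> U \<gamma>"
    and zero: "P \<zero>\<^bsub>group_ring R\<^esub>"
    and gmono: "\<And>\<alpha> a. a \<in> carrier R \<Longrightarrow> a \<in> U \<alpha> \<Longrightarrow> P (gmono R \<alpha> a)"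
    and add: "\<And>c d. c \<in> carrier (group_ring R) \<Longrightarrow> d \<in> carrier (group_ring R) \<Longrightarrow> P c \<Longrightarrow> P d
      \<Longrightarrow> P (c \<oplus>\<^bsub>group_ring R\<^esub> d)"
  shows "P c"
proof -
  have "P c" if "finite S" "c \<in> carrier (group_ring R)" "support R c = S" "\<forall>\<gamma>\<in>S. c \<gamma> \<in> U \<gamma>" for S c
    using that
  proof (induction S arbitrary: c rule: finite_induct)
    case empty
    then have "c = \<zero>\<^bsub>group_ring R\<^esub>" by (auto simp: group_ring_simps support_def fun_eq_iff)
    then show ?case using zero by simp
  next
    case (insert \<alpha> S)
    let ?d = "c(\<alpha> := \<zero>)"
    have cl: "\<And>\<gamma>. c \<gamma> \<in> carrier R" using insert.prems by (simp add: group_ring_simps)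
    have S: "support R ?d = S" using insert by (auto simp: support_def)
    then have d: "?d \<in> carrier (group_ring R)"
      using cl insert by (auto simp: group_ring_simps)
    have "P (gmono R \<alpha> (c \<alpha>) \<oplus>\<^bsub>group_ring R\<^esub> ?d)"
      using insert S d cl by (intro add gmono gmono_closed) auto
    moreover have "gmono R \<alpha> (c \<alpha>) \<oplus>\<^bsub>group_ring R\<^esub> ?d = c"
      using cl by (auto simp: group_ring_simps gmono_def fun_eq_iff)
    ultimately show ?case by simp
  qed
  then show ?thesis using c U by (auto simp: group_ring_simps)
qed

lemma gmono_hom: "abelian_group_hom R (group_ring R) (gmono R \<alpha>)"
  by (intro abelian_group_homI' abelian_group_axioms abelian_group_group_ring gmono_closed)
     (auto simp: group_ring_simps gmono_def fun_eq_iff)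

lemma group_ring_eval_hom: "abelian_group_hom (group_ring R) R (\<lambda>c. c \<gamma>)"
  by (intro abelian_group_homI' abelian_group_axioms abelian_group_group_ring) (auto simp: group_ring_simps)

text \<open>Both sides of associativity are additive in each factor, so three nested inductions
  reduce it to monomials, where it is associativity in the ring and in \<Gamma>.\<close>

lemma ring_group_ring: "ring (group_ring R :: ('g::ab_group_add \<Rightarrow> 'a) ring)"
proof (rule ringI)
  let ?G = "group_ring R :: ('g \<Rightarrow> 'a) ring"
  note [simp] = group_ring_mult_closed gmono_closed abelian_groupE(1,2)[OF abelian_group_group_ring]
  show "abelian_group ?G" by (rule abelian_group_group_ring)
  have zero: "\<zero>\<^bsub>?G\<^esub> \<otimes>\<^bsub>?G\<^esub> c = \<zero>\<^bsub>?G\<^esub>" "c \<otimes>\<^bsub>?G\<^esub> \<zero>\<^bsub>?G\<^esub> = \<zero>\<^bsub>?G\<^esub>" if "c \<in> carrier ?G" for c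
    using that by (auto simp: group_ring_simps support_def finsum_zero finsum_empty intro!: ext add.finprod_one_eqI)
  show "monoid ?G"
  proof (rule monoidI)
    show "(a \<otimes>\<^bsub>?G\<^esub> b) \<otimes>\<^bsub>?G\<^esub> c = a \<otimes>\<^bsub>?G\<^esub> (b \<otimes>\<^bsub>?G\<^esub> c)"
      if abc: "a \<in> carrier ?G" "b \<in> carrier ?G" "c \<in> carrier ?G" for a b c
      using abc(1) UNIV_I
    proof (induction a rule: group_ring_induct)
      case (gmono \<alpha> x)
      show ?case
        using abc(2) UNIV_I
      proof (induction b rule: group_ring_induct)
        case (gmono \<beta> y)
        show ?case
          using abc(3) UNIV_I
        proof (induction c rule: group_ring_induct)
          case (gmono \<gamma> z)
          then show ?case using \<open>x \<in> carrier R\<close> \<open>y \<in> carrier R\<close> by (simp add: gmono_mult m_assoc add.assoc)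
        qed (use \<open>x \<in> carrier R\<close> \<open>y \<in> carrier R\<close> in \<open>auto simp: zero group_ring_distr\<close>)
      qed (use \<open>x \<in> carrier R\<close> abc in \<open>auto simp: zero group_ring_distr\<close>)
    qed (use abc in \<open>auto simp: zero group_ring_distr\<close>)
    show "\<one>\<^bsub>?G\<^esub> \<otimes>\<^bsub>?G\<^esub> c = c" "c \<otimes>\<^bsub>?G\<^esub> \<one>\<^bsub>?G\<^esub> = c" if "c \<in> carrier ?G" for c
      using that UNIV_I
    proof (induction c rule: group_ring_induct)
      case (gmono \<alpha> a)
      case 1 then show ?case using gmono by (simp add: group_ring_simps(2) gmono_mult)
    next
      case (gmono \<alpha> a)
      case 2 then show ?case using gmono by (simp add: group_ring_simps(2) gmono_mult)
    qed (auto simp: zero group_ring_distr group_ring_simps(2))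
  qed (simp_all add: group_ring_simps(2))
qed (simp_all add: group_ring_distr)

lemma augmentation_gmono: "a \<in> carrier R \<Longrightarrow> augmentation R (gmono R (\<alpha> :: 'g::ab_group_add) a) = a"
  using augmentation_superset[OF _ _ support_gmono[of \<alpha> a]] gmono_closed[of a \<alpha>]
  by (auto simp: group_ring_simps(1) gmono_def finsum_insert finsum_empty)

lemma augmentation_hom: "abelian_group_hom (group_ring R) R (augmentation R)"
proof (intro abelian_group_homI' abelian_group_axioms abelian_group_group_ring)
  fix c d :: "'g::ab_group_add \<Rightarrow> 'a" assume c: "c \<in> carrier (group_ring R)" and d: "d \<in> carrier (group_ring R)"
  show "augmentation R c \<in> carrier R"
    using c by (auto simp: augmentation_def group_ring_simps intro!: finsum_closed)
  let ?S = "support R c \<union> support R d"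
  have cl: "\<And>\<gamma>. c \<gamma> \<in> carrier R" "\<And>\<gamma>. d \<gamma> \<in> carrier R" "finite ?S"
    using c d by (auto simp: group_ring_simps)
  have "augmentation R (c \<oplus>\<^bsub>group_ring R\<^esub> d) = (\<Oplus>\<alpha>\<in>?S. c \<alpha> \<oplus> d \<alpha>)"
    using support_add_subset[of c d] cl by (subst augmentation_superset[of _ ?S]) (auto simp: group_ring_simps)
  also have "\<dots> = augmentation R c \<oplus> augmentation R d"
    using cl by (subst (1 2) augmentation_superset[of _ ?S]) (auto simp: finsum_addf)
  finally show "augmentation R (c \<oplus>\<^bsub>group_ring R\<^esub> d) = augmentation R c \<oplus> augmentation R d" .
qed

lemma augmentation_ring_hom: "augmentation R \<in> ring_hom (group_ring R) R"
proof -
  interpret G: ring "group_ring R" by (rule ring_group_ring)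
  interpret a: abelian_group_hom "group_ring R" R "augmentation R" by (rule augmentation_hom)
  show ?thesis
  proof (rule ring_hom_memI)
    fix c d :: "'g::ab_group_add \<Rightarrow> 'a" assume cd: "c \<in> carrier (group_ring R)" "d \<in> carrier (group_ring R)"
    show "augmentation R (c \<otimes>\<^bsub>group_ring R\<^esub> d) = augmentation R c \<otimes> augmentation R d"
      using cd(1) UNIV_I
    proof (induction c rule: group_ring_induct)
      case (gmono \<alpha> x)
      show ?case
        using cd(2) UNIV_I
      proof (induction d rule: group_ring_induct)
        case (gmono \<beta> y)
        then show ?case using \<open>x \<in> carrier R\<close> by (simp add: gmono_mult augmentation_gmono)
      qed (use \<open>x \<in> carrier R\<close> in \<open>auto simp: G.r_distr r_distr gmono_closed\<close>)
    qed (use cd in \<open>auto simp: G.l_distr l_distr\<close>)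
  qed (auto simp: group_ring_simps(2) augmentation_gmono)
qed

text \<open>On monomials, central coefficients commute and the group elements commute since \<Gamma>
  is abelian. This keeps the image of \<open>K\<close> central when a presented ring is mapped to
  its group ring.\<close>

lemma group_ring_central:
  assumes c: "c \<in> carrier (group_ring R)" and d: "d \<in> carrier (group_ring R)"
    and comm: "\<And>\<gamma> x. x \<in> carrier R \<Longrightarrow> c \<gamma> \<otimes> x = x \<otimes> c \<gamma>"
  shows "c \<otimes>\<^bsub>group_ring R\<^esub> d = d \<otimes>\<^bsub>group_ring R\<^esub> c"
proof -
  interpret G: ring "group_ring R" by (rule ring_group_ring)
  have U: "c \<gamma> \<in> {a. \<forall>x\<in>carrier R. a \<otimes> x = x \<otimes> a}" for \<gamma> using comm by simp
  show ?thesis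
    using c U
  proof (induction c rule: group_ring_induct)
    case (gmono \<alpha> x)
    note x = this
    show ?case
      using d UNIV_I
    proof (induction d rule: group_ring_induct)
      case (gmono \<beta> y)
      then show ?case using x by (simp add: gmono_mult add.commute)
    qed (use \<open>x \<in> carrier R\<close> in \<open>auto simp: G.r_distr G.l_distr gmono_closed\<close>)
  qed (use d in \<open>auto simp: G.r_distr G.l_distr\<close>)
qed

end

lemma group_ring_map:
  assumes "ring A" "ring B" "\<phi> \<in> ring_hom A B"
  shows "(\<lambda>c \<gamma>. \<phi> (c \<gamma>)) \<in> ring_hom (group_ring A) (group_ring B)"
proof -
  interpret A: ring A by fact
  interpret B: ring B by fact
  interpret \<phi>: abelian_group_hom A B \<phi> using assms by (intro ring_hom_imp_abelian_group_hom)
  have supp: "support B (\<lambda>\<gamma>. \<phi> (c \<gamma>)) \<subseteq> support A c" for c :: "'g \<Rightarrow> _"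
    by (auto simp: support_def)
  have cl: "(\<lambda>\<gamma>. \<phi> (c \<gamma>)) \<in> carrier (group_ring B)" if "c \<in> carrier (group_ring A)" for c
    using that finite_subset[OF supp] by (auto simp: group_ring_simps)
  show ?thesis
  proof (rule ring_hom_memI)
    fix c d :: "'g::ab_group_add \<Rightarrow> 'a" assume c: "c \<in> carrier (group_ring A)" and d: "d \<in> carrier (group_ring A)"
    show "(\<lambda>\<gamma>. \<phi> ((c \<otimes>\<^bsub>group_ring A\<^esub> d) \<gamma>)) = (\<lambda>\<gamma>. \<phi> (c \<gamma>)) \<otimes>\<^bsub>group_ring B\<^esub> (\<lambda>\<gamma>. \<phi> (d \<gamma>))"
    proof
      fix \<gamma>
      \<comment> \<open>\<open>\<phi>\<close> may annihilate coefficients, so the product is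
        expanded over the possibly larger support of \<open>c\<close>.\<close>
      have "(\<lambda>\<gamma>. \<phi> (c \<gamma>)) \<otimes>\<^bsub>group_ring B\<^esub> (\<lambda>\<gamma>. \<phi> (d \<gamma>)) =
          (\<lambda>\<gamma>. \<Oplus>\<^bsub>B\<^esub>\<alpha>\<in>support A c. \<phi> (c \<alpha>) \<otimes>\<^bsub>B\<^esub> \<phi> (d (\<gamma> - \<alpha>)))"
        using c d by (intro ext B.group_ring_mult_superset cl supp) (auto simp: group_ring_simps)
      then show "\<phi> ((c \<otimes>\<^bsub>group_ring A\<^esub> d) \<gamma>) = ((\<lambda>\<gamma>. \<phi> (c \<gamma>)) \<otimes>\<^bsub>group_ring B\<^esub> (\<lambda>\<gamma>. \<phi> (d \<gamma>))) \<gamma>"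
        using c d assms(3)
        by (simp add: group_ring_simps \<phi>.hom_finsum Pi_def) (auto intro!: B.finsum_cong' simp: ring_hom_def)
    qed
  qed (use cl assms(3) in \<open>auto simp: group_ring_simps(1,2,4) gmono_def fun_eq_iff ring_hom_def\<close>)
qed

section \<open>Homogeneous components as a map into the group ring\<close>

definition components :: "('g::ab_group_add, 'a, 'z) gring_scheme \<Rightarrow> 'a \<Rightarrow> 'g \<Rightarrow> 'a" where
  "components A x = (THE c. (\<forall>\<gamma>. c \<gamma> \<in> grade A \<gamma>) \<and> finite {\<gamma>. c \<gamma> \<noteq> \<zero>\<^bsub>A\<^esub>} \<and>
        x = (\<Oplus>\<^bsub>A\<^esub>\<gamma> \<in> {\<gamma>. c \<gamma> \<noteq> \<zero>\<^bsub>A\<^esub>}. c \<gamma>))"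

lemma graded_ringD:
  assumes "graded_ring A"
  shows "ring A" "additive_subgroup (grade A \<gamma>) A" "x \<in> grade A \<gamma> \<Longrightarrow> x \<in> carrier A"
    "x \<in> grade A \<gamma> \<Longrightarrow> y \<in> grade A \<delta> \<Longrightarrow> x \<otimes>\<^bsub>A\<^esub> y \<in> grade A (\<gamma> + \<delta>)"
  using assms by (auto simp: graded_ring_def is_grading_def dest: additive_subgroup.a_Hcarr)

lemma components:
  assumes "graded_ring A" "x \<in> carrier A"
  shows "components A x \<gamma> \<in> grade A \<gamma>" "components A x \<in> carrier (group_ring A)"
    "augmentation A (components A x) = x"
proof -
  have "\<exists>!c. (\<forall>\<gamma>. c \<gamma> \<in> grade A \<gamma>) \<and> finite {\<gamma>. c \<gamma> \<noteq> \<zero>\<^bsub>A\<^esub>} \<and> x = (\<Oplus>\<^bsub>A\<^esub>\<gamma> \<in> {\<gamma>. c \<gamma> \<noteq> \<zero>\<^bsub>A\<^esub>}. c \<gamma>)"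
    using assms by (auto simp: graded_ring_def is_grading_def)
  from theI'[OF this]
  have *: "(\<forall>\<gamma>. components A x \<gamma> \<in> grade A \<gamma>) \<and> finite {\<gamma>. components A x \<gamma> \<noteq> \<zero>\<^bsub>A\<^esub>} \<and>
      x = (\<Oplus>\<^bsub>A\<^esub>\<gamma> \<in> {\<gamma>. components A x \<gamma> \<noteq> \<zero>\<^bsub>A\<^esub>}. components A x \<gamma>)"
    unfolding components_def .
  then show "components A x \<gamma> \<in> grade A \<gamma>" by simp
  show "components A x \<in> carrier (group_ring A)"
    using * graded_ringD(3)[OF assms(1)] by (auto simp: group_ring_simps support_def)
  show "augmentation A (components A x) = x" using * by (simp add: augmentation_def support_def)
qed

lemma components_unique:
  assumes A: "graded_ring A" and c: "c \<in> carrier (group_ring A)" and hom: "\<And>\<gamma>. c \<gamma> \<in> grade A \<gamma>"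
  shows "components A (augmentation A c) = c"
proof -
  interpret ring A using A by (rule graded_ringD)
  let ?x = "augmentation A c"
  have x: "?x \<in> carrier A"
    using abelian_group_hom.hom_closed[OF augmentation_hom c] .
  have "\<exists>!c. (\<forall>\<gamma>. c \<gamma> \<in> grade A \<gamma>) \<and> finite {\<gamma>. c \<gamma> \<noteq> \<zero>\<^bsub>A\<^esub>} \<and> ?x = (\<Oplus>\<^bsub>A\<^esub>\<gamma> \<in> {\<gamma>. c \<gamma> \<noteq> \<zero>\<^bsub>A\<^esub>}. c \<gamma>)"
    using A x by (auto simp: graded_ring_def is_grading_def)
  from the1_equality[OF this]
  show ?thesis
    using c hom unfolding components_def by (auto simp: augmentation_def support_def group_ring_simps)
qed

lemma components_eqI:
  assumes "graded_ring A" "c \<in> carrier (group_ring A)" "\<And>\<gamma>. c \<gamma> \<in> grade A \<gamma>" "augmentation A c = x"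
  shows "components A x = c"
  using components_unique[OF assms(1-3)] assms(4) by simp

lemma gmono_in_grade:
  assumes "graded_ring A" "x \<in> grade A \<alpha>"
  shows "gmono A \<alpha> x \<gamma> \<in> grade A \<gamma>"
  using assms additive_subgroup.zero_closed[OF graded_ringD(2)[OF assms(1)]] by (auto simp: gmono_def)

lemma components_homogeneous:
  assumes "graded_ring A" "x \<in> grade A \<alpha>"
  shows "components A x = gmono A \<alpha> x"
proof -
  interpret ring A using assms(1) by (rule graded_ringD)
  have "x \<in> carrier A" using assms by (rule graded_ringD)
  then show ?thesis
    using gmono_in_grade[OF assms] assms(1) by (intro components_eqI gmono_closed augmentation_gmono)
qed

text \<open>Since \<alpha> + (\<gamma> - \<alpha>) = \<gamma>, convolution preserves the functions
  whose value at each degree lies in that degree.\<close>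

lemma group_ring_mult_in_grade:
  assumes A: "ring A" and sub: "\<And>\<gamma>. additive_subgroup (G \<gamma>) A"
    and mult: "\<And>\<gamma> \<delta> x y. x \<in> G \<gamma> \<Longrightarrow> y \<in> G \<delta> \<Longrightarrow> x \<otimes>\<^bsub>A\<^esub> y \<in> G (\<gamma> + \<delta>)"
    and cd: "\<And>\<gamma>. c \<gamma> \<in> G \<gamma>" "\<And>\<gamma>. d \<gamma> \<in> G \<gamma>"
  shows "(c \<otimes>\<^bsub>group_ring A\<^esub> d) \<gamma> \<in> G \<gamma>"
proof -
  have "c \<alpha> \<otimes>\<^bsub>A\<^esub> d (\<gamma> - \<alpha>) \<in> G \<gamma>" for \<alpha>
    using mult[OF cd, of \<alpha> "\<gamma> - \<alpha>"] by simp
  then show ?thesis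
    unfolding group_ring_simps
    by (intro additive_subgroup.finsum_in[OF sub] ring.is_abelian_group[OF A])
qed

text \<open>Decompose 1 into components \<open>u \<gamma>\<close>. For x of degree \<alpha>,
  comparing the components of degree \<alpha> in x = x1 gives x = x \<open>u 0\<close>. Applied to
  the components of 1 and summed up, this says 1 = 1 \<open>u 0\<close> =
  \<open>u 0\<close>.\<close>

lemma one_in_grade_zero:
  fixes A :: "('g::ab_group_add, 'a, 'z) gring_scheme"
  assumes A: "graded_ring A"
  shows "\<one>\<^bsub>A\<^esub> \<in> grade A 0"
proof -
  interpret ring A using A by (rule graded_ringD)
  interpret G: ring "group_ring A :: ('g \<Rightarrow> 'a) ring" by (rule ring_group_ring)
  define u where "u = components A \<one>\<^bsub>A\<^esub>"
  have u: "u \<in> carrier (group_ring A)" "\<And>\<gamma>. u \<gamma> \<in> grade A \<gamma>" "augmentation A u = \<one>\<^bsub>A\<^esub>"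
    using components[OF A] by (auto simp: u_def)
  have ucl: "u \<gamma> \<in> carrier A" for \<gamma> using u(2) graded_ringD(3)[OF A] by blast
  have hom: "x \<otimes>\<^bsub>A\<^esub> u 0 = x" if x: "x \<in> grade A \<alpha>" for x \<alpha>
  proof -
    have xc: "x \<in> carrier A" using A x by (rule graded_ringD)
    have "augmentation A (gmono A \<alpha> x \<otimes>\<^bsub>group_ring A\<^esub> u) = x"
      using ring_hom_mult[OF augmentation_ring_hom gmono_closed[OF xc] u(1)] u(3) xc
      by (simp add: augmentation_gmono)
    then have "components A x = gmono A \<alpha> x \<otimes>\<^bsub>group_ring A\<^esub> u"
      using u A gmono_in_grade[OF A x] graded_ringD(4)[OF A]
      by (intro components_eqI G.m_closed gmono_closed xc group_ring_mult_in_grade[OF ring_axioms graded_ringD(2)[OF A]])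
    then have "gmono A \<alpha> x \<alpha> = (gmono A \<alpha> x \<otimes>\<^bsub>group_ring A\<^esub> u) \<alpha>"
      using components_homogeneous[OF A x] by simp
    then show ?thesis
      using gmono_mult_eval[OF xc ucl, where \<alpha> = \<alpha> and \<gamma> = \<alpha>] by (simp add: gmono_def)
  qed
  have "\<one>\<^bsub>A\<^esub> = (\<Oplus>\<^bsub>A\<^esub>\<alpha>\<in>support A u. u \<alpha> \<otimes>\<^bsub>A\<^esub> u 0)"
    using u(3) hom[OF u(2)] by (simp add: augmentation_def)
  also have "\<dots> = augmentation A u \<otimes>\<^bsub>A\<^esub> u 0"
    using u(1) ucl unfolding augmentation_def
    by (intro finsum_ldistr[symmetric]) (auto simp: group_ring_simps)
  also have "\<dots> = u 0" using u(3) ucl by simp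
  finally show ?thesis using u(2)[of 0] by simp
qed

lemma graded_ring_family: "graded_ring A \<Longrightarrow> graded_family A (grade A)"
  using graded_ringD[of A] one_in_grade_zero[of A] by (auto simp: graded_family_def)

text \<open>Everything follows from uniqueness of the decomposition: the convolution of two families
  of components has homogeneous values, and its augmentation is the product of the two
  elements.\<close>

lemma components_ring_hom:
  fixes A :: "('g::ab_group_add, 'a, 'z) gring_scheme"
  assumes A: "graded_ring A"
  shows "components A \<in> ring_hom A (group_ring A)"
proof -
  interpret ring A using A by (rule graded_ringD)
  interpret G: ring "group_ring A :: ('g \<Rightarrow> 'a) ring" by (rule ring_group_ring)
  interpret a: abelian_group_hom "group_ring A :: ('g \<Rightarrow> 'a) ring" A "augmentation A" by (rule augmentation_hom)
  note c = components[OF A]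
  show ?thesis
  proof (rule ring_hom_memI)
    fix x y assume xy: "x \<in> carrier A" "y \<in> carrier A"
    show "components A x \<in> carrier (group_ring A)" using xy by (simp add: c)
    show "components A (x \<otimes>\<^bsub>A\<^esub> y) = components A x \<otimes>\<^bsub>group_ring A\<^esub> components A y"
    proof (rule components_eqI[OF A])
      show "augmentation A (components A x \<otimes>\<^bsub>group_ring A\<^esub> components A y) = x \<otimes>\<^bsub>A\<^esub> y"
        using xy c(2,3) by (simp add: ring_hom_mult[OF augmentation_ring_hom])
    qed (use xy c(1,2) graded_ringD(4)[OF A] in \<open>auto intro!: group_ring_mult_in_grade[OF ring_axioms graded_ringD(2)[OF A]]\<close>)
    show "components A (x \<oplus>\<^bsub>A\<^esub> y) = components A x \<oplus>\<^bsub>group_ring A\<^esub> components A y"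
    proof (rule components_eqI[OF A])
      show "(components A x \<oplus>\<^bsub>group_ring A\<^esub> components A y) \<gamma> \<in> grade A \<gamma>" for \<gamma>
        using xy c(1) additive_subgroup.a_closed[OF graded_ringD(2)[OF A]] by (simp add: group_ring_simps)
    qed (use xy c(2,3) in auto)
  next
    show "components A \<one>\<^bsub>A\<^esub> = \<one>\<^bsub>group_ring A\<^esub>"
      using components_homogeneous[OF A one_in_grade_zero[OF A]] by (simp add: group_ring_simps)
  qed
qed

lemma components_gring_hom:
  assumes A: "graded_ring A" and B: "graded_ring B" and \<phi>: "\<phi> \<in> gring_hom A B" and x: "x \<in> carrier A"
  shows "components B (\<phi> x) = (\<lambda>\<gamma>. \<phi> (components A x \<gamma>))"
proof (rule components_eqI[OF B])
  interpret A: ring A using A by (rule graded_ringD)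
  interpret B: ring B using B by (rule graded_ringD)
  have h: "\<phi> \<in> ring_hom A B" using \<phi> by (simp add: gring_hom_def)
  interpret \<phi>: abelian_group_hom A B \<phi> using A.ring_axioms B.ring_axioms h by (rule ring_hom_imp_abelian_group_hom)
  note c = components[OF A x]
  show cl: "(\<lambda>\<gamma>. \<phi> (components A x \<gamma>)) \<in> carrier (group_ring B)"
    using ring_hom_closed[OF group_ring_map[OF A.ring_axioms B.ring_axioms h] c(2)] .
  show "\<phi> (components A x \<gamma>) \<in> grade B \<gamma>" for \<gamma>
    using \<phi> c(1) by (auto simp: gring_hom_def)
  have "augmentation B (\<lambda>\<gamma>. \<phi> (components A x \<gamma>)) = (\<Oplus>\<^bsub>B\<^esub>\<gamma>\<in>support A (components A x). \<phi> (components A x \<gamma>))"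
    using c(2) by (intro B.augmentation_superset) (auto simp: group_ring_simps support_def)
  also have "\<dots> = \<phi> (augmentation A (components A x))"
    using c(2) unfolding augmentation_def by (subst \<phi>.hom_finsum) (auto simp: group_ring_simps)
  finally show "augmentation B (\<lambda>\<gamma>. \<phi> (components A x \<gamma>)) = \<phi> x" using c(3) by simp
qed

text \<open>Converse to \<open>components_ring_hom\<close>. The coefficients of
  \<open>\<phi> x\<close> decompose x because the augmentation returns x. For uniqueness, apply
  \<open>\<phi>\<close> to any decomposition: the summands become monomials, so the coefficient at
  \<delta> is the summand of degree \<delta>.\<close>

lemma graded_ring_by_projections:
  fixes B :: "('g::ab_group_add, 'a, 'z) gring_scheme"
  assumes B: "ring B" and fam: "graded_family B (grade B)" and \<phi>: "\<phi> \<in> ring_hom B (group_ring B)"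
    and hom: "\<And>\<gamma> b. b \<in> grade B \<gamma> \<Longrightarrow> \<phi> b = gmono B \<gamma> b"
    and grade: "\<And>x \<gamma>. x \<in> carrier B \<Longrightarrow> \<phi> x \<gamma> \<in> grade B \<gamma>"
    and aug: "\<And>x. x \<in> carrier B \<Longrightarrow> augmentation B (\<phi> x) = x"
  shows "graded_ring B"
proof -
  interpret B: ring B by fact
  interpret \<phi>: abelian_group_hom B "group_ring B" \<phi>
    by (rule ring_hom_imp_abelian_group_hom[OF B B.ring_group_ring \<phi>])
  note famD = graded_familyD[OF fam]
  have "\<exists>!c. (\<forall>\<gamma>. c \<gamma> \<in> grade B \<gamma>) \<and> finite {\<gamma>. c \<gamma> \<noteq> \<zero>\<^bsub>B\<^esub>} \<and> x = (\<Oplus>\<^bsub>B\<^esub>\<gamma> \<in> {\<gamma>. c \<gamma> \<noteq> \<zero>\<^bsub>B\<^esub>}. c \<gamma>)"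
    if x: "x \<in> carrier B" for x
  proof (rule ex1I[of _ "\<phi> x"])
    show "(\<forall>\<gamma>. \<phi> x \<gamma> \<in> grade B \<gamma>) \<and> finite {\<gamma>. \<phi> x \<gamma> \<noteq> \<zero>\<^bsub>B\<^esub>} \<and> x = (\<Oplus>\<^bsub>B\<^esub>\<gamma> \<in> {\<gamma>. \<phi> x \<gamma> \<noteq> \<zero>\<^bsub>B\<^esub>}. \<phi> x \<gamma>)"
      using grade[OF x] aug[OF x] \<phi>.hom_closed[OF x] by (simp add: group_ring_simps augmentation_def support_def)
    fix c assume c: "(\<forall>\<gamma>. c \<gamma> \<in> grade B \<gamma>) \<and> finite {\<gamma>. c \<gamma> \<noteq> \<zero>\<^bsub>B\<^esub>} \<and> x = (\<Oplus>\<^bsub>B\<^esub>\<gamma> \<in> {\<gamma>. c \<gamma> \<noteq> \<zero>\<^bsub>B\<^esub>}. c \<gamma>)"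
    let ?S = "{\<gamma>. c \<gamma> \<noteq> \<zero>\<^bsub>B\<^esub>}"
    have cl: "c \<gamma> \<in> carrier B" for \<gamma> using c famD(3) by blast
    have c_mono: "\<phi> (c \<gamma>) = gmono B \<gamma> (c \<gamma>)" for \<gamma> using c hom by blast
    show "c = \<phi> x"
    proof
      fix \<delta>
      interpret ev: abelian_group_hom "group_ring B :: ('g \<Rightarrow> 'a) ring" B "\<lambda>c. c \<delta>" by (rule B.group_ring_eval_hom)
      have "\<phi> x = (\<Oplus>\<^bsub>group_ring B\<^esub>\<gamma>\<in>?S. \<phi> (c \<gamma>))"
        using c cl by (simp add: \<phi>.hom_finsum)
      then have "\<phi> x \<delta> = (\<Oplus>\<^bsub>B\<^esub>\<gamma>\<in>?S. \<phi> (c \<gamma>) \<delta>)"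
        using cl by (simp add: ev.hom_finsum)
      also have "\<dots> = (\<Oplus>\<^bsub>B\<^esub>\<gamma>\<in>?S. if \<delta> = \<gamma> then c \<gamma> else \<zero>\<^bsub>B\<^esub>)"
        using cl by (intro B.finsum_cong') (auto simp: c_mono gmono_def)
      also have "\<dots> = c \<delta>"
      proof (cases "\<delta> \<in> ?S")
        case True
        then show ?thesis using c cl by (intro B.finsum_singleton) auto
      next
        case False
        then show ?thesis using c by (auto intro!: B.add.finprod_one_eqI)
      qed
      finally show "c \<delta> = \<phi> x \<delta>" by simp
    qed
  qed
  then show ?thesis
    using famD B by (auto simp: graded_ring_def is_grading_def)
qed

section \<open>Free algebras and coproducts\<close>

lemma presents_free_gring:
  assumes P: "presents (free_gring X D) rels B q"
  shows presents_letter: "x \<in> X \<Longrightarrow> q (frag_of [x]) \<in> carrier B"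
    and presents_letter_grade: "x \<in> X \<Longrightarrow> \<delta> \<in> D x \<Longrightarrow> q (frag_of [x]) \<in> grade B \<delta>"
    and presents_subring: "subring U B \<Longrightarrow> (\<And>x. x \<in> X \<Longrightarrow> q (frag_of [x]) \<in> U) \<Longrightarrow> carrier B \<subseteq> U"
    and presents_grade: "graded_family B G \<Longrightarrow>
      (\<And>x \<delta>. x \<in> X \<Longrightarrow> \<delta> \<in> D x \<Longrightarrow> q (frag_of [x]) \<in> G \<delta>) \<Longrightarrow> grade B \<gamma> \<subseteq> G \<gamma>"
proof -
  let ?F = "free_gring X D"
  have B: "ring B" and q: "q \<in> ring_hom ?F B" and onto: "q ` carrier ?F = carrier B"
    and gr: "\<And>\<gamma>. grade B \<gamma> = q ` grade ?F \<gamma>"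
    using P by (auto simp: presents_def)
  show "q (frag_of [x]) \<in> carrier B" if "x \<in> X"
    using that by (intro ring_hom_closed[OF q]) simp
  show "q (frag_of [x]) \<in> grade B \<delta>" if "x \<in> X" "\<delta> \<in> D x"
    using that unfolding gr by (intro imageI) (auto simp: word_degree_Cons word_degree_Nil)
  show "carrier B \<subseteq> U" if U: "subring U B" and l: "\<And>x. x \<in> X \<Longrightarrow> q (frag_of [x]) \<in> U"
  proof -
    have "carrier ?F \<subseteq> {a \<in> carrier ?F. q a \<in> U}"
    proof (rule subring_free_gring[OF subring_preimage[OF ring_free_gring B q U]])
      show "frag_of [x] \<in> {a \<in> carrier ?F. q a \<in> U}" if "x \<in> X" for x using l[OF that] that by simp
    qed
    then have "q ` carrier ?F \<subseteq> U" by blast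
    then show ?thesis unfolding onto .
  qed
  show "grade B \<gamma> \<subseteq> G \<gamma>" if G: "graded_family B G"
    and l: "\<And>x \<delta>. x \<in> X \<Longrightarrow> \<delta> \<in> D x \<Longrightarrow> q (frag_of [x]) \<in> G \<delta>"
  proof -
    have "grade ?F \<gamma> \<subseteq> {a \<in> carrier ?F. q a \<in> G \<gamma>}"
    proof (rule grade_free_gring_subset[OF graded_family_preimage[OF ring_free_gring B q G]])
      show "frag_of [x] \<in> {a \<in> carrier ?F. q a \<in> G \<delta>}" if "x \<in> X" "\<delta> \<in> D x" for x \<delta>
        using l[OF that] that by simp
    qed
    then have "q ` grade ?F \<gamma> \<subseteq> G \<gamma>" by blast
    then show ?thesis unfolding gr .
  qed
qed

lemma presents_free_gring_family:
  "presents (free_gring X D) rels B q \<Longrightarrow> graded_family B (grade B)"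
  by (rule presents_graded_family[OF _ graded_family_free_gring])

lemma free_galg_presents:
  assumes K: "ring K"
  shows "presents (free_galg_base K X d) (free_galg_relations K X) (free_galg K X d)
    (quotient_class (free_galg_base K X d) (free_galg_relations K X))"
proof -
  let ?X = "carrier K <+> X"
  have "free_galg_relations K X \<subseteq> carrier (free_galg_base K X d)"
    unfolding free_galg_relations_def free_galg_base_def
  proof (rule Un_least)
    show "hom_relations K Inl \<subseteq> carrier (free_gring ?X (case_sum (\<lambda>c. {\<gamma>. c \<in> grade K \<gamma>}) (\<lambda>x. {d x})))"
      by (rule hom_relations_carrier[OF K]) auto
    show "{frag_of [Inl c, Inr x] - frag_of [Inr x, Inl c] |c x. c \<in> carrier K \<and> x \<in> X}
        \<subseteq> carrier (free_gring ?X (case_sum (\<lambda>c. {\<gamma>. c \<in> grade K \<gamma>}) (\<lambda>x. {d x})))"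
    proof clarify
      fix c x assume "c \<in> carrier K" "x \<in> X"
      then show "frag_of [Inl c, Inr x] - frag_of [Inr x, Inl c] \<in> carrier (free_gring ?X (case_sum (\<lambda>c. {\<gamma>. c \<in> grade K \<gamma>}) (\<lambda>x. {d x})))"
        by (simp add: keys_minus_subset InlI InrI)
    qed
  qed
  moreover have "ring (free_galg_base K X d)"
    unfolding free_galg_base_def by (rule ring_free_gring)
  ultimately show ?thesis
    by (intro quotient_presents) (simp_all add: free_galg_def gring.defs)
qed

context
  fixes K :: "('g::ab_group_add, 'k) gring" and X :: "'x set" and d :: "'x \<Rightarrow> 'g"
  assumes K: "ring K"
begin

lemmas free_galg_presents' = free_galg_presents[OF K, of X d, unfolded free_galg_base_def]

lemma free_galg_letter_eq:
  "free_galg_letter K X d l = quotient_class (free_gring (carrier K <+> X)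
     (case_sum (\<lambda>c. {\<gamma>. c \<in> grade K \<gamma>}) (\<lambda>x. {d x}))) (free_galg_relations K X) (frag_of [l])"
  by (simp add: free_galg_letter_def free_galg_base_def)

lemma ring_free_galg: "ring (free_galg K X d)"
  using free_galg_presents' by (simp add: presents_def)

lemma free_galg_letter_closed: "l \<in> carrier K <+> X \<Longrightarrow> free_galg_letter K X d l \<in> carrier (free_galg K X d)"
  unfolding free_galg_letter_eq by (rule presents_letter[OF free_galg_presents'])

lemma free_galg_symbol_grade: "x \<in> X \<Longrightarrow> free_galg_letter K X d (Inr x) \<in> grade (free_galg K X d) (d x)"
  unfolding free_galg_letter_eq by (rule presents_letter_grade[OF free_galg_presents']) auto

lemma kmap_free_galg: "kmap (free_galg K X d) c = free_galg_letter K X d (Inl c)"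
  by (simp add: free_galg_def gring.defs galg.defs)

lemma free_galg_kmap_hom: "kmap (free_galg K X d) \<in> ring_hom K (free_galg K X d)"
proof -
  have "(\<lambda>c. free_galg_letter K X d (Inl c)) \<in> ring_hom K (free_galg K X d)"
    unfolding free_galg_letter_eq
    by (rule hom_relations_hom[OF K _ free_galg_presents']) (auto simp: free_galg_relations_def)
  then show ?thesis by (simp add: kmap_free_galg[abs_def])
qed

lemma free_galg_commute:
  assumes "c \<in> carrier K" "x \<in> X"
  shows "kmap (free_galg K X d) c \<otimes>\<^bsub>free_galg K X d\<^esub> free_galg_letter K X d (Inr x) =
    free_galg_letter K X d (Inr x) \<otimes>\<^bsub>free_galg K X d\<^esub> kmap (free_galg K X d) c"
proof -
  let ?F = "free_gring (carrier K <+> X) (case_sum (\<lambda>c. {\<gamma>. c \<in> grade K \<gamma>}) (\<lambda>x. {d x}))"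
  let ?q = "quotient_class ?F (free_galg_relations K X)"
  have cl: "frag_of [Inl c, Inr x] \<in> carrier ?F" "frag_of [Inr x, Inl c] \<in> carrier ?F" using assms by auto
  have "?q (frag_of [Inl c, Inr x]) = ?q (frag_of [Inr x, Inl c])"
    using free_gring_minus(1)[OF cl] assms
    by (intro presents_relation_eq[OF free_galg_presents'] cl) (auto simp: free_galg_relations_def)
  moreover have "?q \<in> ring_hom ?F (free_galg K X d)"
    using free_galg_presents' by (simp add: presents_def)
  note w = free_ring_hom_words(2)[OF ring_free_galg this]
  ultimately show ?thesis
    using assms by (simp add: kmap_free_galg free_galg_letter_eq w InlI InrI)
qed

lemma free_galg_subring:
  assumes "subring U (free_galg K X d)" "\<And>c. c \<in> carrier K \<Longrightarrow> kmap (free_galg K X d) c \<in> U"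
    "\<And>x. x \<in> X \<Longrightarrow> free_galg_letter K X d (Inr x) \<in> U"
  shows "carrier (free_galg K X d) \<subseteq> U"
  using assms(2,3) unfolding kmap_free_galg free_galg_letter_eq
  by (intro presents_subring[OF free_galg_presents' assms(1)]) auto

lemma free_galg_grade:
  assumes "graded_family (free_galg K X d) G" "\<And>c \<gamma>. c \<in> carrier K \<Longrightarrow> c \<in> grade K \<gamma> \<Longrightarrow> kmap (free_galg K X d) c \<in> G \<gamma>"
    "\<And>x. x \<in> X \<Longrightarrow> free_galg_letter K X d (Inr x) \<in> G (d x)"
  shows "grade (free_galg K X d) \<gamma> \<subseteq> G \<gamma>"
  using assms(2,3) unfolding kmap_free_galg free_galg_letter_eq
  by (intro presents_grade[OF free_galg_presents' assms(1)]) auto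

lemma free_galg_lift:
  assumes T: "ring T" and \<kappa>: "\<kappa> \<in> ring_hom K T" and \<eta>: "\<And>x. x \<in> X \<Longrightarrow> \<eta> x \<in> carrier T"
    and comm: "\<And>c x. c \<in> carrier K \<Longrightarrow> x \<in> X \<Longrightarrow> \<kappa> c \<otimes>\<^bsub>T\<^esub> \<eta> x = \<eta> x \<otimes>\<^bsub>T\<^esub> \<kappa> c"
  obtains \<psi> where "\<psi> \<in> ring_hom (free_galg K X d) T"
    "\<And>c. c \<in> carrier K \<Longrightarrow> \<psi> (kmap (free_galg K X d) c) = \<kappa> c"
    "\<And>x. x \<in> X \<Longrightarrow> \<psi> (free_galg_letter K X d (Inr x)) = \<eta> x"
proof -
  interpret T: ring T by fact
  let ?X = "carrier K <+> X"
  let ?D = "case_sum (\<lambda>c. {\<gamma>. c \<in> grade K \<gamma>}) (\<lambda>x. {d x})"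
  have \<kappa>c: "\<kappa> c \<in> carrier T" if "c \<in> carrier K" for c using \<kappa> that by (rule ring_hom_closed)
  obtain h where h: "h \<in> ring_hom (free_gring ?X ?D) T"
    and hx: "\<And>x. x \<in> ?X \<Longrightarrow> h (frag_of [x]) = case_sum \<kappa> \<eta> x"
  proof (rule free_gring_lift[OF T, of ?X "case_sum \<kappa> \<eta>" ?D])
    show "case_sum \<kappa> \<eta> x \<in> carrier T" if "x \<in> ?X" for x using that \<kappa>c \<eta> by auto
  qed (rule that)
  note w = free_ring_hom_words[OF T h]
  have 1: "h r = \<zero>\<^bsub>T\<^esub>" if "r \<in> hom_relations K Inl" for r
    by (rule hom_relations_vanish[OF K _ T h \<kappa> _ that]) (auto simp: hx InlI InrI)
  have 2: "h (frag_of [Inl c, Inr x] - frag_of [Inr x, Inl c]) = \<zero>\<^bsub>T\<^esub>" if "c \<in> carrier K" "x \<in> X" for c x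
    using that comm \<kappa>c \<eta> by (simp add: w hx InlI InrI T.minus_eq_zero_iff)
  have "h r = \<zero>\<^bsub>T\<^esub>" if "r \<in> free_galg_relations K X" for r
    using that 1 2 by (auto simp: free_galg_relations_def)
  then obtain \<psi> where \<psi>: "\<psi> \<in> ring_hom (free_galg K X d) T"
    "\<And>a. a \<in> carrier (free_gring ?X ?D) \<Longrightarrow> \<psi> (quotient_class (free_gring ?X ?D) (free_galg_relations K X) a) = h a"
    using presents_lift[OF free_galg_presents' T h] by blast
  show ?thesis
    by (rule that[OF \<psi>(1)]) (simp_all add: kmap_free_galg free_galg_letter_eq \<psi>(2) hx InlI InrI)
qed

end

section \<open>Coproducts over the base ring\<close>

lemma coproduct_presents:
  fixes K :: "('g::ab_group_add, 'k) gring" and A :: "('g, 'k, 'a) galg" and B :: "('g, 'k, 'b) galg"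
  assumes "ring K" and A: "ring A" and B: "ring B"
    and hom: "kmap A \<in> ring_hom K A" "kmap B \<in> ring_hom K B"
  shows "presents (coproduct_base A B) (coproduct_relations K A B) (coproduct K A B)
    (quotient_class (coproduct_base A B) (coproduct_relations K A B))"
proof -
  have "coproduct_relations K A B \<subseteq> carrier (coproduct_base A B)"
    unfolding coproduct_relations_def coproduct_base_def
  proof (intro Un_least)
    show "hom_relations A Inl \<subseteq> carrier (free_gring (carrier A <+> carrier B) (case_sum (\<lambda>a. {\<gamma>. a \<in> grade A \<gamma>}) (\<lambda>b. {\<gamma>. b \<in> grade B \<gamma>})))"
      by (rule hom_relations_carrier[OF A]) auto
    show "hom_relations B Inr \<subseteq> carrier (free_gring (carrier A <+> carrier B) (case_sum (\<lambda>a. {\<gamma>. a \<in> grade A \<gamma>}) (\<lambda>b. {\<gamma>. b \<in> grade B \<gamma>})))"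
      by (rule hom_relations_carrier[OF B]) auto
    show "{frag_of [Inl (kmap A c)] - frag_of [Inr (kmap B c)] |c. c \<in> carrier K} \<subseteq> carrier (free_gring (carrier A <+> carrier B) (case_sum (\<lambda>a. {\<gamma>. a \<in> grade A \<gamma>}) (\<lambda>b. {\<gamma>. b \<in> grade B \<gamma>})))"
    proof clarify
      fix c assume "c \<in> carrier K"
      then have "kmap A c \<in> carrier A" "kmap B c \<in> carrier B" using ring_hom_closed[OF hom(1)] ring_hom_closed[OF hom(2)] by auto
      then show "frag_of [Inl (kmap A c)] - frag_of [Inr (kmap B c)] \<in> carrier (free_gring (carrier A <+> carrier B) (case_sum (\<lambda>a. {\<gamma>. a \<in> grade A \<gamma>}) (\<lambda>b. {\<gamma>. b \<in> grade B \<gamma>})))"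
        by (simp add: keys_minus_subset InlI InrI)
    qed
  qed
  moreover have "ring (coproduct_base A B)"
    unfolding coproduct_base_def by (rule ring_free_gring)
  ultimately show ?thesis
    by (intro quotient_presents) (simp_all add: coproduct_def gring.defs galg.defs)
qed

context
  fixes K :: "('g::ab_group_add, 'k) gring" and A :: "('g, 'k, 'a) galg" and B :: "('g, 'k, 'b) galg"
  assumes K: "ring K" and A: "ring A" and B: "ring B"
    and hom: "kmap A \<in> ring_hom K A" "kmap B \<in> ring_hom K B"
begin

lemmas coproduct_presents' = coproduct_presents[OF K A B hom, unfolded coproduct_base_def]

lemma coproduct_letter_eq:
  "coproduct_letter K A B l = quotient_class (free_gring (carrier A <+> carrier B)
     (case_sum (\<lambda>a. {\<gamma>. a \<in> grade A \<gamma>}) (\<lambda>b. {\<gamma>. b \<in> grade B \<gamma>}))) (coproduct_relations K A B) (frag_of [l])"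
  by (simp add: coproduct_letter_def coproduct_base_def)

lemma rmap_coproduct: "rmap (coproduct K A B) a = coproduct_letter K A B (Inl a)"
  by (simp add: coproduct_def gring.defs galg.defs grring.defs)

lemma kmap_coproduct: "kmap (coproduct K A B) c = rmap (coproduct K A B) (kmap A c)"
  by (simp add: coproduct_def gring.defs galg.defs grring.defs)

lemma ring_coproduct: "ring (coproduct K A B)"
  using coproduct_presents' by (simp add: presents_def)

text \<open>Enough for an intermediate ring: directness of the grading is settled once, for the
  quotient by the matrix relations.\<close>

lemma coproduct_family: "graded_family (coproduct K A B) (grade (coproduct K A B))"
  by (rule presents_free_gring_family[OF coproduct_presents'])

lemma coproduct_rmap_hom: "rmap (coproduct K A B) \<in> ring_hom A (coproduct K A B)"
proof -
  have "(\<lambda>a. coproduct_letter K A B (Inl a)) \<in> ring_hom A (coproduct K A B)"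
    unfolding coproduct_letter_eq
    by (rule hom_relations_hom[OF A _ coproduct_presents']) (auto simp: coproduct_relations_def)
  then show ?thesis by (simp add: rmap_coproduct[abs_def])
qed

lemma coproduct_inr_hom: "(\<lambda>b. coproduct_letter K A B (Inr b)) \<in> ring_hom B (coproduct K A B)"
  unfolding coproduct_letter_eq
  by (rule hom_relations_hom[OF B _ coproduct_presents']) (auto simp: coproduct_relations_def)

lemma coproduct_rmap_grade: "a \<in> carrier A \<Longrightarrow> a \<in> grade A \<gamma> \<Longrightarrow> rmap (coproduct K A B) a \<in> grade (coproduct K A B) \<gamma>"
  unfolding rmap_coproduct coproduct_letter_eq by (rule presents_letter_grade[OF coproduct_presents']) auto

lemma coproduct_inr_grade: "b \<in> carrier B \<Longrightarrow> b \<in> grade B \<gamma> \<Longrightarrow> coproduct_letter K A B (Inr b) \<in> grade (coproduct K A B) \<gamma>"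
  unfolding coproduct_letter_eq by (rule presents_letter_grade[OF coproduct_presents']) auto

lemma coproduct_kmap_inr:
  assumes "c \<in> carrier K"
  shows "coproduct_letter K A B (Inr (kmap B c)) = rmap (coproduct K A B) (kmap A c)"
proof -
  let ?F = "free_gring (carrier A <+> carrier B) (case_sum (\<lambda>a. {\<gamma>. a \<in> grade A \<gamma>}) (\<lambda>b. {\<gamma>. b \<in> grade B \<gamma>}))"
  have cl: "frag_of [Inl (kmap A c)] \<in> carrier ?F" "frag_of [Inr (kmap B c)] \<in> carrier ?F"
    using ring_hom_closed[OF hom(1) assms] ring_hom_closed[OF hom(2) assms] by auto
  show ?thesis
    unfolding rmap_coproduct coproduct_letter_eq using free_gring_minus(1)[OF cl] assms
    by (intro presents_relation_eq[OF coproduct_presents', symmetric] cl) (auto simp: coproduct_relations_def)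
qed

lemma coproduct_subring:
  assumes "subring U (coproduct K A B)" "\<And>a. a \<in> carrier A \<Longrightarrow> rmap (coproduct K A B) a \<in> U"
    "\<And>b. b \<in> carrier B \<Longrightarrow> coproduct_letter K A B (Inr b) \<in> U"
  shows "carrier (coproduct K A B) \<subseteq> U"
  using assms(2,3) unfolding rmap_coproduct coproduct_letter_eq
  by (intro presents_subring[OF coproduct_presents' assms(1)]) auto

lemma coproduct_grade:
  assumes "graded_family (coproduct K A B) G"
    "\<And>a \<gamma>. a \<in> carrier A \<Longrightarrow> a \<in> grade A \<gamma> \<Longrightarrow> rmap (coproduct K A B) a \<in> G \<gamma>"
    "\<And>b \<gamma>. b \<in> carrier B \<Longrightarrow> b \<in> grade B \<gamma> \<Longrightarrow> coproduct_letter K A B (Inr b) \<in> G \<gamma>"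
  shows "grade (coproduct K A B) \<gamma> \<subseteq> G \<gamma>"
  using assms(2,3) unfolding rmap_coproduct coproduct_letter_eq
  by (intro presents_grade[OF coproduct_presents' assms(1)]) auto

lemma coproduct_lift:
  assumes T: "ring T" and f: "f \<in> ring_hom A T" and g: "g \<in> ring_hom B T"
    and comp: "\<And>c. c \<in> carrier K \<Longrightarrow> f (kmap A c) = g (kmap B c)"
  obtains \<psi> where "\<psi> \<in> ring_hom (coproduct K A B) T"
    "\<And>a. a \<in> carrier A \<Longrightarrow> \<psi> (rmap (coproduct K A B) a) = f a"
    "\<And>b. b \<in> carrier B \<Longrightarrow> \<psi> (coproduct_letter K A B (Inr b)) = g b"
proof -
  interpret T: ring T by fact
  let ?X = "carrier A <+> carrier B"
  let ?D = "case_sum (\<lambda>a. {\<gamma>. a \<in> grade A \<gamma>}) (\<lambda>b. {\<gamma>. b \<in> grade B \<gamma>})"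
  note fc = ring_hom_closed[OF f] and gc = ring_hom_closed[OF g]
  obtain h where h: "h \<in> ring_hom (free_gring ?X ?D) T"
    and hx: "\<And>x. x \<in> ?X \<Longrightarrow> h (frag_of [x]) = case_sum f g x"
  proof (rule free_gring_lift[OF T, of ?X "case_sum f g" ?D])
    show "case_sum f g x \<in> carrier T" if "x \<in> ?X" for x using that fc gc by auto
  qed (rule that)
  note w = free_ring_hom_words[OF T h]
  have 1: "h r = \<zero>\<^bsub>T\<^esub>" if "r \<in> hom_relations A Inl" for r
    by (rule hom_relations_vanish[OF A _ T h f _ that]) (auto simp: hx InlI InrI)
  have 2: "h r = \<zero>\<^bsub>T\<^esub>" if "r \<in> hom_relations B Inr" for r
    by (rule hom_relations_vanish[OF B _ T h g _ that]) (auto simp: hx InlI InrI)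
  have 3: "h (frag_of [Inl (kmap A c)] - frag_of [Inr (kmap B c)]) = \<zero>\<^bsub>T\<^esub>" if "c \<in> carrier K" for c
    using that fc gc comp ring_hom_closed[OF hom(1) that] ring_hom_closed[OF hom(2) that]
    by (simp add: w hx InlI InrI T.minus_eq_zero_iff)
  have "h r = \<zero>\<^bsub>T\<^esub>" if "r \<in> coproduct_relations K A B" for r
    using that 1 2 3 unfolding coproduct_relations_def by blast
  then obtain \<psi> where \<psi>: "\<psi> \<in> ring_hom (coproduct K A B) T"
    "\<And>a. a \<in> carrier (free_gring ?X ?D) \<Longrightarrow> \<psi> (quotient_class (free_gring ?X ?D) (coproduct_relations K A B) a) = h a"
    using presents_lift[OF coproduct_presents' T h] by blast
  show ?thesis
    by (rule that[OF \<psi>(1)]) (simp_all add: rmap_coproduct coproduct_letter_eq \<psi>(2) hx InlI InrI)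
qed

end

section \<open>The presented ring\<close>

text \<open>The four defining relations as a condition on matrices over any ring. In this form they
  can be pushed along homomorphisms and compared with the coordinates of an isomorphism.\<close>

definition iso_matrices ::
    "('a, 'z) ring_scheme \<Rightarrow> nat \<Rightarrow> nat \<Rightarrow> (nat \<Rightarrow> nat \<Rightarrow> 'a) \<Rightarrow> (nat \<Rightarrow> nat \<Rightarrow> 'a) \<Rightarrow>
     (nat \<Rightarrow> nat \<Rightarrow> 'a) \<Rightarrow> (nat \<Rightarrow> nat \<Rightarrow> 'a) \<Rightarrow> bool" where
  "iso_matrices T n m E F h h' \<longleftrightarrow>
     (\<forall>i<n. \<forall>j<m. mat_mult T m (mat_mult T n E h) F i j = h i j) \<and>
     (\<forall>i<m. \<forall>j<n. mat_mult T n (mat_mult T m F h') E i j = h' i j) \<and>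
     (\<forall>i<n. \<forall>j<n. mat_mult T m h h' i j = E i j) \<and>
     (\<forall>i<m. \<forall>j<m. mat_mult T n h' h i j = F i j)"

lemma mat_relations_vanish_iff:
  assumes "ring C" "ring T" "\<psi> \<in> ring_hom C T"
    and "\<And>i j. i < p \<Longrightarrow> j < q \<Longrightarrow> A i j \<in> carrier C" "\<And>i j. i < p \<Longrightarrow> j < q \<Longrightarrow> B i j \<in> carrier C"
  shows "(\<forall>r \<in> mat_relations C p q A B. \<psi> r = \<zero>\<^bsub>T\<^esub>) \<longleftrightarrow> (\<forall>i<p. \<forall>j<q. \<psi> (A i j) = \<psi> (B i j))"
proof -
  interpret \<psi>: abelian_group_hom C T \<psi> using assms by (intro ring_hom_imp_abelian_group_hom)
  have "\<psi> (A i j \<ominus>\<^bsub>C\<^esub> B i j) = \<zero>\<^bsub>T\<^esub> \<longleftrightarrow> \<psi> (A i j) = \<psi> (B i j)" if "i < p" "j < q" for i j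
    using assms that by (simp add: \<psi>.hom_minus \<psi>.H.minus_eq_zero_iff)
  then show ?thesis unfolding mat_relations_def by blast
qed

text \<open>The degrees telescope: (\<open>v s\<close> - u) + (w - \<open>v s\<close>) does not
  depend on the summation index, so a product of matrices of monomials is again one.\<close>

lemma mat_mult_gmono:
  assumes B: "ring B" and M: "\<And>s. s < l \<Longrightarrow> M i s \<in> carrier B" and N: "\<And>s. s < l \<Longrightarrow> N s j \<in> carrier B"
    and M': "\<And>s. s < l \<Longrightarrow> M' i s = gmono B (v s - u) (M i s)"
    and N': "\<And>s. s < l \<Longrightarrow> N' s j = gmono B (w - v s) (N s j)"
  shows "mat_mult (group_ring B) l M' N' i j = gmono B (w - u) (mat_mult B l M N i j)"
proof -
  interpret B: ring B by fact
  interpret g: abelian_group_hom B "group_ring B" "gmono B (w - u)" by (rule B.gmono_hom)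
  have "mat_mult (group_ring B) l M' N' i j = (\<Oplus>\<^bsub>group_ring B\<^esub>s\<in>{..<l}. gmono B (w - u) (M i s \<otimes>\<^bsub>B\<^esub> N s j))"
    unfolding mat_mult_def
  proof (rule g.H.finsum_cong')
    show "M' i s \<otimes>\<^bsub>group_ring B\<^esub> N' s j = gmono B (w - u) (M i s \<otimes>\<^bsub>B\<^esub> N s j)" if "s \<in> {..<l}" for s
      using that M[of s] N[of s] M'[of s] N'[of s] by (simp add: B.gmono_mult)
  qed (use M N in auto)
  also have "\<dots> = gmono B (w - u) (mat_mult B l M N i j)"
    unfolding mat_mult_def using M N by (subst g.hom_finsum) auto
  finally show ?thesis .
qed

locale presentation =
  fixes K :: "('g::ab_group_add, 'k) gring" and R :: "('g, 'k, 'r) galg"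
    and n m :: nat and \<beta> \<gamma> :: "nat \<Rightarrow> 'g" and e f :: "nat \<Rightarrow> nat \<Rightarrow> 'r"
  assumes graded_K: "graded_ring K" and alg_R: "graded_algebra K R"
    and e_deg: "e \<in> degree0_matrices R n \<beta>" and f_deg: "f \<in> degree0_matrices R m \<gamma>"
begin

abbreviation "Fr \<equiv> h_free K n m \<beta> \<gamma>"
abbreviation "C \<equiv> h_ring K R n m \<beta> \<gamma>"
abbreviation "B \<equiv> presented_ring K R n m \<beta> \<gamma> e f"
abbreviation "rels \<equiv> h_relations K R n m \<beta> \<gamma> e f"
abbreviation "XS \<equiv> h_symbols n m"
abbreviation "hC x \<equiv> h_entry K R n m \<beta> \<gamma> x"

definition hB :: "h_symbol \<Rightarrow> ('k, 'r) h_elem set" where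
  "hB x = quotient_class C rels (hC x)"

lemma graded_R: "graded_ring R" and ring_R: "ring R" and kmap_R: "kmap R \<in> gring_hom K R" "kmap R \<in> ring_hom K R"
  and ring_K: "ring K"
  using alg_R graded_K by (auto simp: graded_algebra_def gring_hom_def graded_ring_def)

lemma kmap_R_central: "c \<in> carrier K \<Longrightarrow> a \<in> carrier R \<Longrightarrow> kmap R c \<otimes>\<^bsub>R\<^esub> a = a \<otimes>\<^bsub>R\<^esub> kmap R c"
  using alg_R by (auto simp: graded_algebra_def)

lemma e_grade: "i < n \<Longrightarrow> j < n \<Longrightarrow> e i j \<in> grade R (\<beta> j - \<beta> i)"
  and f_grade: "k < m \<Longrightarrow> l < m \<Longrightarrow> f k l \<in> grade R (\<gamma> l - \<gamma> k)"
  using e_deg f_deg by (auto simp: degree0_matrices_def)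

lemma e_closed: "i < n \<Longrightarrow> j < n \<Longrightarrow> e i j \<in> carrier R"
  and f_closed: "k < m \<Longrightarrow> l < m \<Longrightarrow> f k l \<in> carrier R"
  using e_grade f_grade graded_ringD(3)[OF graded_R] by blast+

lemma ring_Fr: "ring Fr" and kmap_Fr: "kmap Fr \<in> ring_hom K Fr"
  unfolding h_free_def using ring_K by (rule ring_free_galg, rule free_galg_kmap_hom)

lemma H_symbols [simp]: "H j k \<in> XS \<longleftrightarrow> j < n \<and> k < m" "HStar k j \<in> XS \<longleftrightarrow> j < n \<and> k < m"
  by (auto simp: h_symbols_def)

lemmas cop = ring_K ring_R ring_Fr kmap_R(2) kmap_Fr

lemma ring_C: "ring C"
  unfolding h_ring_def by (rule ring_coproduct[OF cop])

lemma rmap_C_hom: "rmap C \<in> ring_hom R C"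
  unfolding h_ring_def by (rule coproduct_rmap_hom[OF cop])

lemma hC_closed: "x \<in> XS \<Longrightarrow> hC x \<in> carrier C"
  unfolding h_entry_def h_ring_def
  by (intro ring_hom_closed[OF coproduct_inr_hom[OF cop]])
     (auto simp: h_free_def intro!: free_galg_letter_closed[OF ring_K])

lemma hC_grade: "x \<in> XS \<Longrightarrow> hC x \<in> grade C (h_degree \<beta> \<gamma> x)"
  unfolding h_entry_def h_ring_def
  by (intro coproduct_inr_grade[OF cop])
     (auto simp: h_free_def intro!: free_galg_letter_closed[OF ring_K] free_galg_symbol_grade[OF ring_K])

text \<open>The constants of the free algebra come from \<open>K\<close>, and the coproduct
  identifies them with constants coming from \<open>R\<close>; hence \<open>R\<close> and the
  symbols generate.\<close>

lemma C_subring: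
  assumes U: "subring U C" and r: "\<And>r. r \<in> carrier R \<Longrightarrow> rmap C r \<in> U" and h: "\<And>x. x \<in> XS \<Longrightarrow> hC x \<in> U"
  shows "carrier C \<subseteq> U"
proof -
  let ?j = "\<lambda>b. coproduct_letter K R Fr (Inr b)"
  have "carrier Fr \<subseteq> {b \<in> carrier Fr. ?j b \<in> U}"
    unfolding h_free_def
  proof (rule free_galg_subring[OF ring_K], fold h_free_def)
    show "subring {b \<in> carrier Fr. ?j b \<in> U} Fr"
      by (rule subring_preimage[OF ring_Fr ring_C, unfolded h_ring_def, OF coproduct_inr_hom[OF cop] U[unfolded h_ring_def]])
    fix c assume c: "c \<in> carrier K"
    show "kmap Fr c \<in> {b \<in> carrier Fr. ?j b \<in> U}"
      using c r[OF ring_hom_closed[OF kmap_R(2)]] ring_hom_closed[OF kmap_Fr]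
      by (simp add: coproduct_kmap_inr[OF cop] h_ring_def)
  next
    fix x assume "x \<in> XS"
    then show "free_galg_letter K XS (h_degree \<beta> \<gamma>) (Inr x) \<in> {b \<in> carrier Fr. ?j b \<in> U}"
      using h free_galg_letter_closed[OF ring_K, of "Inr x" XS] by (simp add: h_entry_def h_free_def InrI)
  qed
  then show ?thesis
    using U r unfolding h_ring_def by (intro coproduct_subring[OF cop]) auto
qed

lemma C_grade:
  assumes G: "graded_family C G" and r: "\<And>r \<delta>. r \<in> grade R \<delta> \<Longrightarrow> rmap C r \<in> G \<delta>"
    and h: "\<And>x. x \<in> XS \<Longrightarrow> hC x \<in> G (h_degree \<beta> \<gamma> x)"
  shows "grade C \<delta> \<subseteq> G \<delta>"
proof -
  let ?j = "\<lambda>b. coproduct_letter K R Fr (Inr b)"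
  have "grade Fr \<delta> \<subseteq> {b \<in> carrier Fr. ?j b \<in> G \<delta>}" for \<delta>
    unfolding h_free_def
  proof (rule free_galg_grade[OF ring_K], fold h_free_def)
    show "graded_family Fr (\<lambda>\<delta>. {b \<in> carrier Fr. ?j b \<in> G \<delta>})"
      by (rule graded_family_preimage[OF ring_Fr ring_C, unfolded h_ring_def, OF coproduct_inr_hom[OF cop] G[unfolded h_ring_def]])
    fix c \<delta> assume c: "c \<in> carrier K" "c \<in> grade K \<delta>"
    then have "kmap R c \<in> grade R \<delta>" using kmap_R(1) by (auto simp: gring_hom_def)
    then show "kmap Fr c \<in> {b \<in> carrier Fr. ?j b \<in> G \<delta>}"
      using c r ring_hom_closed[OF kmap_Fr]
      by (simp add: coproduct_kmap_inr[OF cop] h_ring_def)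
  next
    fix x assume "x \<in> XS"
    then show "free_galg_letter K XS (h_degree \<beta> \<gamma>) (Inr x) \<in> {b \<in> carrier Fr. ?j b \<in> G (h_degree \<beta> \<gamma> x)}"
      using h free_galg_letter_closed[OF ring_K, of "Inr x" XS] by (simp add: h_entry_def h_free_def InrI)
  qed
  then show ?thesis
    using G r unfolding h_ring_def by (intro coproduct_grade[OF cop]) auto
qed

text \<open>The condition \<open>central\<close> replaces an algebra structure on the target. It
  makes \<rho> after \<open>kmap R\<close> commute with the values of the symbols, as the lift from
  the free algebra demands, and that lift agrees with \<rho> on \<open>K\<close> by
  construction.\<close>

lemma C_lift:
  assumes T: "ring T" and \<rho>: "\<rho> \<in> ring_hom R T"
    and central: "\<And>c t. c \<in> carrier K \<Longrightarrow> t \<in> carrier T \<Longrightarrow> \<rho> (kmap R c) \<otimes>\<^bsub>T\<^esub> t = t \<otimes>\<^bsub>T\<^esub> \<rho> (kmap R c)"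
    and \<eta>: "\<And>x. x \<in> XS \<Longrightarrow> \<eta> x \<in> carrier T"
  obtains \<psi> where "\<psi> \<in> ring_hom C T" "\<And>r. r \<in> carrier R \<Longrightarrow> \<psi> (rmap C r) = \<rho> r"
    "\<And>x. x \<in> XS \<Longrightarrow> \<psi> (hC x) = \<eta> x"
proof -
  obtain g where g: "g \<in> ring_hom Fr T" "\<And>c. c \<in> carrier K \<Longrightarrow> g (kmap Fr c) = \<rho> (kmap R c)"
    "\<And>x. x \<in> XS \<Longrightarrow> g (free_galg_letter K XS (h_degree \<beta> \<gamma>) (Inr x)) = \<eta> x"
    unfolding h_free_def
    using free_galg_lift[OF ring_K T ring_hom_compose[OF kmap_R(2) \<rho>], of XS \<eta> "h_degree \<beta> \<gamma>"] central \<eta> by blast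
  obtain \<psi> where \<psi>: "\<psi> \<in> ring_hom C T" "\<And>r. r \<in> carrier R \<Longrightarrow> \<psi> (rmap C r) = \<rho> r"
    "\<And>b. b \<in> carrier Fr \<Longrightarrow> \<psi> (coproduct_letter K R Fr (Inr b)) = g b"
    unfolding h_ring_def using coproduct_lift[OF cop T \<rho> g(1)] g(2) by metis
  have "\<psi> (hC x) = \<eta> x" if "x \<in> XS" for x
    using that \<psi>(3) g(3) free_galg_letter_closed[OF ring_K, of "Inr x" XS]
    by (simp add: h_entry_def h_free_def InrI)
  then show ?thesis using that \<psi> by blast
qed

abbreviation "hMat \<phi> \<equiv> (\<lambda>j k. \<phi> (H j k))"
abbreviation "hMat' \<phi> \<equiv> (\<lambda>k j. \<phi> (HStar k j))"

lemma C_mat_closed: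
  shows "i < n \<Longrightarrow> j < n \<Longrightarrow> rmap C (e i j) \<in> carrier C" "k < m \<Longrightarrow> l < m \<Longrightarrow> rmap C (f k l) \<in> carrier C"
    "i < n \<Longrightarrow> k < m \<Longrightarrow> hC (H i k) \<in> carrier C" "i < n \<Longrightarrow> k < m \<Longrightarrow> hC (HStar k i) \<in> carrier C"
  using ring_hom_closed[OF rmap_C_hom] e_closed f_closed hC_closed by auto

lemma rels_closed: "rels \<subseteq> carrier C"
proof -
  interpret C: ring C by (rule ring_C)
  show ?thesis
    unfolding h_relations_def Let_def mat_relations_def
    by (intro Un_least subsetI; elim CollectE exE conjE; simp; intro C.minus_closed C.mat_mult_closed C_mat_closed; assumption)
qed

text \<open>Used in both directions: for the quotient map it yields the relations in
  \<open>B\<close>, and for a homomorphism out of \<open>C\<close> it shows that the map descends to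
  \<open>B\<close>.\<close>

lemma rels_vanish_iff:
  assumes T: "ring T" and \<psi>: "\<psi> \<in> ring_hom C T"
  shows "(\<forall>r\<in>rels. \<psi> r = \<zero>\<^bsub>T\<^esub>) \<longleftrightarrow>
    iso_matrices T n m (\<lambda>i j. \<psi> (rmap C (e i j))) (\<lambda>i j. \<psi> (rmap C (f i j)))
      (hMat (\<lambda>x. \<psi> (hC x))) (hMat' (\<lambda>x. \<psi> (hC x)))"
proof -
  interpret C: ring C by (rule ring_C)
  interpret T: ring T by fact
  note cl = C_mat_closed C.mat_mult_closed
  note mm = ring_hom_mat_mult[OF ring_C T \<psi>]
  have \<psi>c: "x \<in> carrier C \<Longrightarrow> \<psi> x \<in> carrier T" for x by (rule ring_hom_closed[OF \<psi>])
  have 1: "\<psi> (mat_mult C m (mat_mult C n (\<lambda>i j. rmap C (e i j)) (hMat hC)) (\<lambda>i j. rmap C (f i j)) i j) =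
      mat_mult T m (mat_mult T n (\<lambda>i j. \<psi> (rmap C (e i j))) (hMat (\<lambda>x. \<psi> (hC x)))) (\<lambda>i j. \<psi> (rmap C (f i j))) i j"
    if "i < n" "j < m" for i j
  proof -
    have "\<psi> (mat_mult C m (mat_mult C n (\<lambda>i j. rmap C (e i j)) (hMat hC)) (\<lambda>i j. rmap C (f i j)) i j) =
        mat_mult T m (\<lambda>s t. \<psi> (mat_mult C n (\<lambda>i j. rmap C (e i j)) (hMat hC) s t)) (\<lambda>s t. \<psi> (rmap C (f s t))) i j"
      using that by (intro mm cl)
    also have "\<dots> = mat_mult T m (mat_mult T n (\<lambda>i j. \<psi> (rmap C (e i j))) (hMat (\<lambda>x. \<psi> (hC x)))) (\<lambda>i j. \<psi> (rmap C (f i j))) i j"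
      unfolding mat_mult_row[of T m] using that
      by (intro T.row_mult_cong mm cl T.mat_mult_closed \<psi>c refl)
    finally show ?thesis .
  qed
  have 2: "\<psi> (mat_mult C n (mat_mult C m (\<lambda>i j. rmap C (f i j)) (hMat' hC)) (\<lambda>i j. rmap C (e i j)) i j) =
      mat_mult T n (mat_mult T m (\<lambda>i j. \<psi> (rmap C (f i j))) (hMat' (\<lambda>x. \<psi> (hC x)))) (\<lambda>i j. \<psi> (rmap C (e i j))) i j"
    if "i < m" "j < n" for i j
  proof -
    have "\<psi> (mat_mult C n (mat_mult C m (\<lambda>i j. rmap C (f i j)) (hMat' hC)) (\<lambda>i j. rmap C (e i j)) i j) =
        mat_mult T n (\<lambda>s t. \<psi> (mat_mult C m (\<lambda>i j. rmap C (f i j)) (hMat' hC) s t)) (\<lambda>s t. \<psi> (rmap C (e s t))) i j"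
      using that by (intro mm cl)
    also have "\<dots> = mat_mult T n (mat_mult T m (\<lambda>i j. \<psi> (rmap C (f i j))) (hMat' (\<lambda>x. \<psi> (hC x)))) (\<lambda>i j. \<psi> (rmap C (e i j))) i j"
      unfolding mat_mult_row[of T n] using that
      by (intro T.row_mult_cong mm cl T.mat_mult_closed \<psi>c refl)
    finally show ?thesis .
  qed
  have 3: "\<psi> (mat_mult C m (hMat hC) (hMat' hC) i j) = mat_mult T m (hMat (\<lambda>x. \<psi> (hC x))) (hMat' (\<lambda>x. \<psi> (hC x))) i j"
    if "i < n" "j < n" for i j
    using that by (intro mm cl)
  have 4: "\<psi> (mat_mult C n (hMat' hC) (hMat hC) i j) = mat_mult T n (hMat' (\<lambda>x. \<psi> (hC x))) (hMat (\<lambda>x. \<psi> (hC x))) i j"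
    if "i < m" "j < m" for i j
    using that by (intro mm cl)
  note iff = mat_relations_vanish_iff[OF ring_C T \<psi>]
  show ?thesis
    unfolding h_relations_def Let_def iso_matrices_def ball_Un
    by (subst iff, (intro cl; assumption), (intro cl; assumption))+ (simp add: 1 2 3 4 conj_assoc)
qed

section \<open>The quotient by the matrix relations\<close>

lemma B_presents: "presents C rels B (quotient_class C rels)"
  by (rule quotient_presents[OF ring_C rels_closed])
     (simp_all add: presented_ring_def grring_quotient_def gring.defs galg.defs)

lemma ring_B: "ring B" and qB_hom: "quotient_class C rels \<in> ring_hom C B"
  using B_presents by (simp_all add: presents_def)

lemma rmap_B: "rmap B r = quotient_class C rels (rmap C r)"
  by (simp add: presented_ring_def grring_quotient_def gring.defs galg.defs grring.defs)

lemma kmap_B: "kmap B c = rmap B (kmap R c)"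
  unfolding rmap_B h_ring_def kmap_coproduct[OF cop, symmetric]
  by (simp add: presented_ring_def grring_quotient_def gring.defs galg.defs grring.defs h_ring_def)

lemma rmap_B_hom: "rmap B \<in> ring_hom R B"
  using ring_hom_compose[OF rmap_C_hom qB_hom] by (simp add: rmap_B[abs_def])

lemma hB_closed: "x \<in> XS \<Longrightarrow> hB x \<in> carrier B"
  unfolding hB_def by (intro ring_hom_closed[OF qB_hom] hC_closed)

lemma grade_B: "grade B \<delta> = quotient_class C rels ` grade C \<delta>"
  using B_presents by (simp add: presents_def)

lemma hB_grade: "x \<in> XS \<Longrightarrow> hB x \<in> grade B (h_degree \<beta> \<gamma> x)"
  unfolding hB_def grade_B by (intro imageI hC_grade)

lemma rmap_B_grade: "r \<in> grade R \<delta> \<Longrightarrow> rmap B r \<in> grade B \<delta>"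
  unfolding rmap_B grade_B h_ring_def
  by (intro imageI coproduct_rmap_grade[OF cop] graded_ringD(3)[OF graded_R])

lemma B_family: "graded_family B (grade B)"
  by (rule presents_graded_family[OF B_presents])
     (simp add: h_ring_def coproduct_family[OF cop])

lemma B_relations: "iso_matrices B n m (\<lambda>i j. rmap B (e i j)) (\<lambda>i j. rmap B (f i j)) (hMat hB) (hMat' hB)"
proof -
  have "\<forall>r\<in>rels. quotient_class C rels r = \<zero>\<^bsub>B\<^esub>" using presents_relation[OF B_presents] by blast
  then show ?thesis
    unfolding rels_vanish_iff[OF ring_B qB_hom] by (simp add: rmap_B[abs_def] hB_def[abs_def])
qed

lemma B_subring:
  assumes U: "subring U B" and r: "\<And>r. r \<in> carrier R \<Longrightarrow> rmap B r \<in> U" and h: "\<And>x. x \<in> XS \<Longrightarrow> hB x \<in> U"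
  shows "carrier B \<subseteq> U"
proof -
  have "carrier C \<subseteq> {c \<in> carrier C. quotient_class C rels c \<in> U}"
    using r h hC_closed ring_hom_closed[OF rmap_C_hom]
    by (intro C_subring subring_preimage[OF ring_C ring_B qB_hom U]) (auto simp: rmap_B hB_def)
  then have "quotient_class C rels ` carrier C \<subseteq> U" by blast
  moreover have "quotient_class C rels ` carrier C = carrier B"
    using B_presents by (simp add: presents_def)
  ultimately show ?thesis by simp
qed

lemma B_grade:
  assumes G: "graded_family B G" and r: "\<And>r \<delta>. r \<in> grade R \<delta> \<Longrightarrow> rmap B r \<in> G \<delta>"
    and h: "\<And>x. x \<in> XS \<Longrightarrow> hB x \<in> G (h_degree \<beta> \<gamma> x)"
  shows "grade B \<delta> \<subseteq> G \<delta>"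
proof -
  have "grade C \<delta> \<subseteq> {c \<in> carrier C. quotient_class C rels c \<in> G \<delta>}"
    using r h hC_closed ring_hom_closed[OF rmap_C_hom] graded_ringD(3)[OF graded_R]
    by (intro C_grade graded_family_preimage[OF ring_C ring_B qB_hom G]) (auto simp: rmap_B hB_def)
  then have "quotient_class C rels ` grade C \<delta> \<subseteq> G \<delta>" by blast
  then show ?thesis unfolding grade_B .
qed

lemma B_lift:
  assumes T: "ring T" and \<rho>: "\<rho> \<in> ring_hom R T"
    and central: "\<And>c t. c \<in> carrier K \<Longrightarrow> t \<in> carrier T \<Longrightarrow> \<rho> (kmap R c) \<otimes>\<^bsub>T\<^esub> t = t \<otimes>\<^bsub>T\<^esub> \<rho> (kmap R c)"
    and \<eta>: "\<And>x. x \<in> XS \<Longrightarrow> \<eta> x \<in> carrier T"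
    and iso: "iso_matrices T n m (\<lambda>i j. \<rho> (e i j)) (\<lambda>i j. \<rho> (f i j)) (hMat \<eta>) (hMat' \<eta>)"
  obtains \<psi> where "\<psi> \<in> ring_hom B T" "\<And>r. r \<in> carrier R \<Longrightarrow> \<psi> (rmap B r) = \<rho> r"
    "\<And>x. x \<in> XS \<Longrightarrow> \<psi> (hB x) = \<eta> x"
proof -
  interpret T: ring T by fact
  obtain \<chi> where \<chi>: "\<chi> \<in> ring_hom C T" "\<And>r. r \<in> carrier R \<Longrightarrow> \<chi> (rmap C r) = \<rho> r"
    "\<And>x. x \<in> XS \<Longrightarrow> \<chi> (hC x) = \<eta> x"
    by (rule C_lift[OF T \<rho>, of \<eta>]) (use central \<eta> in blast)+
  note \<rho>c = ring_hom_closed[OF \<rho>]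
  have entries: "\<chi> (rmap C (e i j)) = \<rho> (e i j)" if "i < n" "j < n" for i j using \<chi> e_closed that by blast
  have entriesf: "\<chi> (rmap C (f i j)) = \<rho> (f i j)" if "i < m" "j < m" for i j using \<chi> f_closed that by blast
  \<comment> \<open>Outside the index range the entries of \<open>e\<close> and \<open>f\<close>
    need not lie in \<open>R\<close>, so \<chi> and \<rho> are known to match only on indices in
    range and the matrices cannot simply be rewritten.\<close>
  have cong: "mat_mult T l M N i j = mat_mult T l M' N' i j"
    if "\<And>s. s < l \<Longrightarrow> M i s = M' i s" "\<And>s. s < l \<Longrightarrow> N s j = N' s j"
      "\<And>s. s < l \<Longrightarrow> M' i s \<in> carrier T" "\<And>s. s < l \<Longrightarrow> N' s j \<in> carrier T" for l M N M' N' i j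
    unfolding mat_mult_row using that by (rule T.row_mult_cong)
  have "iso_matrices T n m (\<lambda>i j. \<chi> (rmap C (e i j))) (\<lambda>i j. \<chi> (rmap C (f i j)))
      (hMat (\<lambda>x. \<chi> (hC x))) (hMat' (\<lambda>x. \<chi> (hC x)))"
    unfolding iso_matrices_def
  proof (intro conjI allI impI)
    fix i j assume ij: "i < n" "j < m"
    have "mat_mult T m (mat_mult T n (\<lambda>i j. \<chi> (rmap C (e i j))) (hMat (\<lambda>x. \<chi> (hC x)))) (\<lambda>i j. \<chi> (rmap C (f i j))) i j =
        mat_mult T m (mat_mult T n (\<lambda>i j. \<rho> (e i j)) (hMat \<eta>)) (\<lambda>i j. \<rho> (f i j)) i j"
      using ij by (intro cong T.mat_mult_closed) (auto simp: \<chi> entries entriesf \<eta> \<rho>c e_closed f_closed)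
    then show "mat_mult T m (mat_mult T n (\<lambda>i j. \<chi> (rmap C (e i j))) (hMat (\<lambda>x. \<chi> (hC x)))) (\<lambda>i j. \<chi> (rmap C (f i j))) i j = \<chi> (hC (H i j))"
      using ij iso by (simp add: iso_matrices_def \<chi>)
  next
    fix i j assume ij: "i < m" "j < n"
    have "mat_mult T n (mat_mult T m (\<lambda>i j. \<chi> (rmap C (f i j))) (hMat' (\<lambda>x. \<chi> (hC x)))) (\<lambda>i j. \<chi> (rmap C (e i j))) i j =
        mat_mult T n (mat_mult T m (\<lambda>i j. \<rho> (f i j)) (hMat' \<eta>)) (\<lambda>i j. \<rho> (e i j)) i j"
      using ij by (intro cong T.mat_mult_closed) (auto simp: \<chi> entries entriesf \<eta> \<rho>c e_closed f_closed)
    then show "mat_mult T n (mat_mult T m (\<lambda>i j. \<chi> (rmap C (f i j))) (hMat' (\<lambda>x. \<chi> (hC x)))) (\<lambda>i j. \<chi> (rmap C (e i j))) i j = \<chi> (hC (HStar i j))"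
      using ij iso by (simp add: iso_matrices_def \<chi>)
  next
    fix i j assume ij: "i < n" "j < n"
    have "mat_mult T m (hMat (\<lambda>x. \<chi> (hC x))) (hMat' (\<lambda>x. \<chi> (hC x))) i j = mat_mult T m (hMat \<eta>) (hMat' \<eta>) i j"
      using ij by (intro cong) (auto simp: \<chi> \<eta>)
    then show "mat_mult T m (hMat (\<lambda>x. \<chi> (hC x))) (hMat' (\<lambda>x. \<chi> (hC x))) i j = \<chi> (rmap C (e i j))"
      using ij iso by (simp add: iso_matrices_def entries)
  next
    fix i j assume ij: "i < m" "j < m"
    have "mat_mult T n (hMat' (\<lambda>x. \<chi> (hC x))) (hMat (\<lambda>x. \<chi> (hC x))) i j = mat_mult T n (hMat' \<eta>) (hMat \<eta>) i j"
      using ij by (intro cong) (auto simp: \<chi> \<eta>)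
    then show "mat_mult T n (hMat' (\<lambda>x. \<chi> (hC x))) (hMat (\<lambda>x. \<chi> (hC x))) i j = \<chi> (rmap C (f i j))"
      using ij iso by (simp add: iso_matrices_def entriesf)
  qed
  then have "\<And>r. r \<in> rels \<Longrightarrow> \<chi> r = \<zero>\<^bsub>T\<^esub>" using rels_vanish_iff[OF T \<chi>(1)] by blast
  then obtain \<psi> where \<psi>: "\<psi> \<in> ring_hom B T" "\<And>c. c \<in> carrier C \<Longrightarrow> \<psi> (quotient_class C rels c) = \<chi> c"
    using presents_lift[OF B_presents T \<chi>(1)] by blast
  show ?thesis
    by (rule that[OF \<psi>(1)]) (simp_all add: rmap_B hB_def \<psi>(2) \<chi> ring_hom_closed[OF rmap_C_hom] hC_closed)
qed

lemma B_hom_eqI: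
  assumes "ring T" "\<phi> \<in> ring_hom B T" "\<psi> \<in> ring_hom B T"
    "\<And>r. r \<in> carrier R \<Longrightarrow> \<phi> (rmap B r) = \<psi> (rmap B r)" "\<And>x. x \<in> XS \<Longrightarrow> \<phi> (hB x) = \<psi> (hB x)"
    "b \<in> carrier B"
  shows "\<phi> b = \<psi> b"
proof -
  have "carrier B \<subseteq> {b \<in> carrier B. \<phi> b = \<psi> b}"
    using assms ring_hom_closed[OF rmap_B_hom] hB_closed
    by (intro B_subring subring_equalizer ring_B) auto
  then show ?thesis using assms by blast
qed

text \<open>A centraliser is a subring. This one contains the image of \<open>R\<close>, as
  \<open>K\<close> is central in \<open>R\<close>, and the symbols, which commute with the constants
  of the free algebra; the coproduct identifies these constants with the image of \<open>K\<close>
  in \<open>R\<close>.\<close>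

lemma kmap_B_central:
  assumes "c \<in> carrier K" "b \<in> carrier B"
  shows "kmap B c \<otimes>\<^bsub>B\<^esub> b = b \<otimes>\<^bsub>B\<^esub> kmap B c"
proof -
  interpret B: ring B by (rule ring_B)
  interpret Fr: ring Fr by (rule ring_Fr)
  let ?k = "kmap B c"
  have k: "?k \<in> carrier B"
    unfolding kmap_B using assms by (intro ring_hom_closed[OF rmap_B_hom] ring_hom_closed[OF kmap_R(2)])
  let ?U = "{b \<in> carrier B. ?k \<otimes>\<^bsub>B\<^esub> b = b \<otimes>\<^bsub>B\<^esub> ?k}"
  have "subring ?U B"
  proof (rule B.subringI)
    fix x y assume xy: "x \<in> ?U" "y \<in> ?U"
    then have "?k \<otimes>\<^bsub>B\<^esub> (x \<otimes>\<^bsub>B\<^esub> y) = (x \<otimes>\<^bsub>B\<^esub> ?k) \<otimes>\<^bsub>B\<^esub> y" using k by (simp add: B.m_assoc[symmetric])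
    also have "\<dots> = x \<otimes>\<^bsub>B\<^esub> (?k \<otimes>\<^bsub>B\<^esub> y)" using xy k by (intro B.m_assoc) auto
    also have "\<dots> = (x \<otimes>\<^bsub>B\<^esub> y) \<otimes>\<^bsub>B\<^esub> ?k" using xy k by (simp add: B.m_assoc)
    finally show "x \<otimes>\<^bsub>B\<^esub> y \<in> ?U" using xy by simp
  qed (use k in \<open>auto simp: B.l_distr B.r_distr B.l_minus B.r_minus\<close>)
  moreover have "rmap B r \<in> ?U" if "r \<in> carrier R" for r
  proof -
    have "rmap B (kmap R c \<otimes>\<^bsub>R\<^esub> r) = rmap B (r \<otimes>\<^bsub>R\<^esub> kmap R c)" using assms that by (simp add: kmap_R_central)
    then show ?thesis
      using that assms ring_hom_closed[OF kmap_R(2)] ring_hom_closed[OF rmap_B_hom]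
      by (simp add: ring_hom_mult[OF rmap_B_hom] kmap_B)
  qed
  moreover have "hB x \<in> ?U" if x: "x \<in> XS" for x
  proof -
    let ?j = "\<lambda>b. quotient_class C rels (coproduct_letter K R Fr (Inr b))"
    let ?x = "free_galg_letter K XS (h_degree \<beta> \<gamma>) (Inr x)"
    have j: "?j \<in> ring_hom Fr B"
      using coproduct_inr_hom[OF cop] qB_hom unfolding h_ring_def by (rule ring_hom_compose)
    have xc: "?x \<in> carrier Fr" "kmap Fr c \<in> carrier Fr"
      using x assms free_galg_letter_closed[OF ring_K, of "Inr x" XS] ring_hom_closed[OF kmap_Fr] by (auto simp: h_free_def)
    have "kmap Fr c \<otimes>\<^bsub>Fr\<^esub> ?x = ?x \<otimes>\<^bsub>Fr\<^esub> kmap Fr c"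
      unfolding h_free_def using assms x by (intro free_galg_commute[OF ring_K])
    then have "?j (kmap Fr c) \<otimes>\<^bsub>B\<^esub> ?j ?x = ?j ?x \<otimes>\<^bsub>B\<^esub> ?j (kmap Fr c)"
      using ring_hom_mult[OF j xc(1,2)] ring_hom_mult[OF j xc(2,1)] by simp
    moreover have "?j (kmap Fr c) = ?k"
      using coproduct_kmap_inr[OF cop assms(1)] by (simp add: kmap_B rmap_B h_ring_def)
    moreover have "?j ?x = hB x" by (simp add: hB_def h_entry_def)
    ultimately show ?thesis using hB_closed[OF x] by simp
  qed
  ultimately have "carrier B \<subseteq> ?U" by (rule B_subring)
  then show ?thesis using assms by blast
qed

text \<open>The map \<phi> into the group ring tags each generator with its degree. Whether it
  exists is a question about relations only, and since \<open>e\<close> and \<open>f\<close> are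
  homogeneous entry by entry, the tags telescope and the relations of \<open>B\<close> reappear as
  equations between monomials.\<close>

lemma graded_ring_B: "graded_ring B"
proof -
  interpret B: ring B by (rule ring_B)
  let ?G = "group_ring B :: ('g \<Rightarrow> ('k, 'r) h_elem set) ring"
  interpret G: ring ?G by (rule B.ring_group_ring)
  interpret rB: abelian_group_hom R B "rmap B" by (rule ring_hom_imp_abelian_group_hom[OF ring_R ring_B rmap_B_hom])
  define \<rho> where "\<rho> r = (\<lambda>\<delta>. rmap B (components R r \<delta>))" for r
  define \<eta> where "\<eta> x = gmono B (h_degree \<beta> \<gamma> x) (hB x)" for x
  have \<rho>: "\<rho> \<in> ring_hom R ?G"
    unfolding \<rho>_def
    using ring_hom_compose[OF components_ring_hom[OF graded_R] group_ring_map[OF ring_R ring_B rmap_B_hom]] by simp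
  have \<rho>_mono: "\<rho> r = gmono B \<delta> (rmap B r)" if "r \<in> grade R \<delta>" for r \<delta>
    by (auto simp: \<rho>_def components_homogeneous[OF graded_R that] gmono_def fun_eq_iff)
  have \<eta>c: "\<eta> x \<in> carrier ?G" if "x \<in> XS" for x
    unfolding \<eta>_def using that by (intro B.gmono_closed hB_closed)
  \<comment> \<open>The structure map of \<open>R\<close> is graded, so the coefficients are images
    of the components of \<open>c\<close>, again elements of \<open>K\<close>, and therefore central
    in \<open>B\<close>.\<close>
  have central: "\<rho> (kmap R c) \<otimes>\<^bsub>?G\<^esub> t = t \<otimes>\<^bsub>?G\<^esub> \<rho> (kmap R c)" if "c \<in> carrier K" "t \<in> carrier ?G" for c t
  proof (rule B.group_ring_central[OF _ that(2)])
    show "\<rho> (kmap R c) \<in> carrier ?G"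
      using that by (intro ring_hom_closed[OF \<rho>] ring_hom_closed[OF kmap_R(2)])
    fix \<delta> x assume x: "x \<in> carrier B"
    have "\<rho> (kmap R c) \<delta> = kmap B (components K c \<delta>)"
      by (simp add: \<rho>_def components_gring_hom[OF graded_K graded_R kmap_R(1) that(1)] kmap_B)
    moreover have "components K c \<delta> \<in> carrier K"
      using components(2)[OF graded_K that(1)] by (simp add: group_ring_simps)
    ultimately show "\<rho> (kmap R c) \<delta> \<otimes>\<^bsub>B\<^esub> x = x \<otimes>\<^bsub>B\<^esub> \<rho> (kmap R c) \<delta>"
      using x by (simp add: kmap_B_central)
  qed
  note ec = rB.hom_closed[OF e_closed] and fc = rB.hom_closed[OF f_closed]
  have hc: "hB (H i k) \<in> carrier B" "hB (HStar k i) \<in> carrier B" if "i < n" "k < m" for i k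
    using that by (auto intro: hB_closed)
  note em = \<rho>_mono[OF e_grade] and fm = \<rho>_mono[OF f_grade]
  have \<eta>m: "\<eta> (H i k) = gmono B (\<gamma> k - \<beta> i) (hB (H i k))" "\<eta> (HStar k i) = gmono B (\<beta> i - \<gamma> k) (hB (HStar k i))" for i k
    by (simp_all add: \<eta>_def)
  have iso: "iso_matrices ?G n m (\<lambda>i j. \<rho> (e i j)) (\<lambda>i j. \<rho> (f i j)) (hMat \<eta>) (hMat' \<eta>)"
    unfolding iso_matrices_def
  proof (intro conjI allI impI)
    fix i j assume ij: "i < n" "j < m"
    have inner: "mat_mult ?G n (\<lambda>i j. \<rho> (e i j)) (hMat \<eta>) i t = gmono B (\<gamma> t - \<beta> i) (mat_mult B n (\<lambda>i j. rmap B (e i j)) (hMat hB) i t)"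
      if "t < m" for t
      using ij that by (intro mat_mult_gmono[OF ring_B, where v = \<beta>] ec hc em \<eta>m)
    have "mat_mult ?G m (mat_mult ?G n (\<lambda>i j. \<rho> (e i j)) (hMat \<eta>)) (\<lambda>i j. \<rho> (f i j)) i j =
        gmono B (\<gamma> j - \<beta> i) (mat_mult B m (mat_mult B n (\<lambda>i j. rmap B (e i j)) (hMat hB)) (\<lambda>i j. rmap B (f i j)) i j)"
      by (rule mat_mult_gmono[OF ring_B, where v = \<gamma>])
         (use ij in \<open>auto intro!: B.mat_mult_closed ec fc hc simp: inner fm\<close>)
    then show "mat_mult ?G m (mat_mult ?G n (\<lambda>i j. \<rho> (e i j)) (hMat \<eta>)) (\<lambda>i j. \<rho> (f i j)) i j = \<eta> (H i j)"
      using ij B_relations by (simp add: iso_matrices_def \<eta>m)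
  next
    fix i j assume ij: "i < m" "j < n"
    have inner: "mat_mult ?G m (\<lambda>i j. \<rho> (f i j)) (hMat' \<eta>) i t = gmono B (\<beta> t - \<gamma> i) (mat_mult B m (\<lambda>i j. rmap B (f i j)) (hMat' hB) i t)"
      if "t < n" for t
      using ij that by (intro mat_mult_gmono[OF ring_B, where v = \<gamma>] fc hc fm \<eta>m)
    have "mat_mult ?G n (mat_mult ?G m (\<lambda>i j. \<rho> (f i j)) (hMat' \<eta>)) (\<lambda>i j. \<rho> (e i j)) i j =
        gmono B (\<beta> j - \<gamma> i) (mat_mult B n (mat_mult B m (\<lambda>i j. rmap B (f i j)) (hMat' hB)) (\<lambda>i j. rmap B (e i j)) i j)"
      by (rule mat_mult_gmono[OF ring_B, where v = \<beta>])
         (use ij in \<open>auto intro!: B.mat_mult_closed ec fc hc simp: inner em\<close>)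
    then show "mat_mult ?G n (mat_mult ?G m (\<lambda>i j. \<rho> (f i j)) (hMat' \<eta>)) (\<lambda>i j. \<rho> (e i j)) i j = \<eta> (HStar i j)"
      using ij B_relations by (simp add: iso_matrices_def \<eta>m)
  next
    fix i j assume ij: "i < n" "j < n"
    have "mat_mult ?G m (hMat \<eta>) (hMat' \<eta>) i j = gmono B (\<beta> j - \<beta> i) (mat_mult B m (hMat hB) (hMat' hB) i j)"
      using ij by (intro mat_mult_gmono[OF ring_B, where v = \<gamma>] hc \<eta>m)
    then show "mat_mult ?G m (hMat \<eta>) (hMat' \<eta>) i j = \<rho> (e i j)"
      using ij B_relations by (simp add: iso_matrices_def em)
  next
    fix i j assume ij: "i < m" "j < m"
    have "mat_mult ?G n (hMat' \<eta>) (hMat \<eta>) i j = gmono B (\<gamma> j - \<gamma> i) (mat_mult B n (hMat' hB) (hMat hB) i j)"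
      using ij by (intro mat_mult_gmono[OF ring_B, where v = \<beta>] hc \<eta>m)
    then show "mat_mult ?G n (hMat' \<eta>) (hMat \<eta>) i j = \<rho> (f i j)"
      using ij B_relations by (simp add: iso_matrices_def fm)
  qed
  obtain \<phi> where \<phi>: "\<phi> \<in> ring_hom B ?G" "\<And>r. r \<in> carrier R \<Longrightarrow> \<phi> (rmap B r) = \<rho> r"
    "\<And>x. x \<in> XS \<Longrightarrow> \<phi> (hB x) = \<eta> x"
    by (rule B_lift[OF G.ring_axioms \<rho>, of \<eta>]) (use central \<eta>c iso in blast)+
  interpret \<phi>: abelian_group_hom B ?G \<phi> by (rule ring_hom_imp_abelian_group_hom[OF ring_B G.ring_axioms \<phi>(1)])
  note famD = graded_familyD[OF B_family]
  \<comment> \<open>The subgroups \<open>?H\<close> form a multiplicative family with the generators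
    in their degrees, and \<open>grade B\<close> is contained in every such family.\<close>
  have mono: "\<phi> b = gmono B \<delta> b" if b: "b \<in> grade B \<delta>" for b \<delta>
  proof -
    let ?H = "\<lambda>\<delta>. {b \<in> carrier B. \<phi> b = gmono B \<delta> b}"
    have "graded_family B ?H"
      unfolding graded_family_def
    proof (intro conjI allI ballI)
      show "additive_subgroup (?H \<delta>) B" for \<delta>
        by (rule additive_subgroup_equalizer[OF \<phi>.abelian_group_hom_axioms B.gmono_hom])
      show "\<one>\<^bsub>B\<^esub> \<in> ?H 0" using ring_hom_one[OF \<phi>(1)] by (simp add: group_ring_simps)
      show "x \<otimes>\<^bsub>B\<^esub> y \<in> ?H (\<delta> + \<epsilon>)" if "x \<in> ?H \<delta>" "y \<in> ?H \<epsilon>" for x y \<delta> \<epsilon>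
        using that ring_hom_mult[OF \<phi>(1)] by (simp add: B.gmono_mult)
    qed
    then have "grade B \<delta> \<subseteq> ?H \<delta>"
      using \<phi> \<rho>_mono graded_ringD(3)[OF graded_R] hB_closed
      by (intro B_grade) (auto simp: \<eta>_def)
    then show ?thesis using b by blast
  qed
  \<comment> \<open>Elements of the group ring with a coefficient of degree \<delta> at each
    \<delta> form a subring. It contains the images of all generators, also of inhomogeneous
    elements of \<open>R\<close>, which \<rho> spreads out by components.\<close>
  have gr: "\<phi> x \<delta> \<in> grade B \<delta>" if x: "x \<in> carrier B" for x \<delta>
  proof -
    let ?U = "{c \<in> carrier ?G. \<forall>\<delta>. c \<delta> \<in> grade B \<delta>}"
    have mono_in: "gmono B \<delta> b \<in> ?U" if "b \<in> grade B \<delta>" for b \<delta>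
      using that famD(3) additive_subgroup.zero_closed[OF famD(1)] B.gmono_closed[of b \<delta>] by (auto simp: gmono_def)
    have "subring ?U ?G"
    proof (rule G.subringI)
      show "\<one>\<^bsub>?G\<^esub> \<in> ?U" using mono_in[OF famD(2)] by (simp add: group_ring_simps(2))
      fix c assume c: "c \<in> ?U"
      have "(\<ominus>\<^bsub>?G\<^esub> c) \<delta> = \<ominus>\<^bsub>B\<^esub> c \<delta>" for \<delta>
        using abelian_group_hom.hom_a_inv[OF B.group_ring_eval_hom] c by auto
      then show "\<ominus>\<^bsub>?G\<^esub> c \<in> ?U"
        using c additive_subgroup.a_inv_closed[OF famD(1)] by auto
      fix d assume d: "d \<in> ?U"
      show "c \<otimes>\<^bsub>?G\<^esub> d \<in> ?U"
        using c d by (auto intro!: group_ring_mult_in_grade[where G = "grade B"] ring_B famD(1) famD(4))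
      show "c \<oplus>\<^bsub>?G\<^esub> d \<in> ?U"
        using c d additive_subgroup.a_closed[OF famD(1)] G.add.m_closed[of c d] by (auto simp: group_ring_simps(4))
    qed auto
    from subring_preimage[OF ring_B G.ring_axioms \<phi>(1) this]
    have "carrier B \<subseteq> {x \<in> carrier B. \<phi> x \<in> ?U}"
    proof (rule B_subring)
      fix r assume r: "r \<in> carrier R"
      have "\<rho> r \<in> ?U"
        using r ring_hom_closed[OF \<rho>] rmap_B_grade components(1)[OF graded_R] by (auto simp: \<rho>_def)
      then show "rmap B r \<in> {x \<in> carrier B. \<phi> x \<in> ?U}" using r \<phi>(2) rB.hom_closed by auto
    next
      fix y assume y: "y \<in> XS"
      then have "\<eta> y \<in> ?U" unfolding \<eta>_def by (intro mono_in hB_grade)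
      then show "hB y \<in> {x \<in> carrier B. \<phi> x \<in> ?U}" using y \<phi>(3) hB_closed by auto
    qed
    then show ?thesis using x by blast
  qed
  \<comment> \<open>The augmentation after \<phi> is an endomorphism of \<open>B\<close> that fixes
    the generators: it drops the tag of a symbol and adds up the components of an element of
    \<open>R\<close>.\<close>
  have aug: "augmentation B (\<phi> x) = x" if "x \<in> carrier B" for x
  proof (rule B_hom_eqI[OF ring_B ring_hom_compose[OF \<phi>(1) B.augmentation_ring_hom] _ _ _ that])
    show "(\<lambda>x. x) \<in> ring_hom B B" by (auto simp: ring_hom_def)
    show "augmentation B (\<phi> (hB y)) = hB y" if "y \<in> XS" for y
      using that by (simp add: \<phi> \<eta>_def B.augmentation_gmono hB_closed)
    fix r assume r: "r \<in> carrier R"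
    have cr: "components R r \<in> carrier (group_ring R)" using components(2)[OF graded_R r] .
    have "augmentation B (\<rho> r) = (\<Oplus>\<^bsub>B\<^esub>\<delta>\<in>support R (components R r). rmap B (components R r \<delta>))"
      unfolding \<rho>_def using cr by (intro B.augmentation_superset) (auto simp: group_ring_simps support_def)
    also have "\<dots> = rmap B (augmentation R (components R r))"
      using cr unfolding augmentation_def by (subst rB.hom_finsum) (auto simp: group_ring_simps)
    finally show "augmentation B (\<phi> (rmap B r)) = rmap B r"
      using r components(3)[OF graded_R r] \<phi>(2) by simp
  qed
  show ?thesis by (rule graded_ring_by_projections[OF ring_B B_family \<phi>(1) mono gr aug])
qed

lemma graded_rring_B: "graded_rring K R B"
proof -
  have "rmap B \<in> gring_hom R B" using rmap_B_hom rmap_B_grade by (auto simp: gring_hom_def)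
  moreover have "kmap B \<in> gring_hom K B"
  proof -
    have "kmap B \<in> ring_hom K B"
      using ring_hom_compose[OF kmap_R(2) rmap_B_hom] by (simp add: kmap_B[abs_def])
    moreover have "kmap B c \<in> grade B \<delta>" if "c \<in> grade K \<delta>" for c \<delta>
      unfolding kmap_B using that kmap_R(1) by (intro rmap_B_grade) (auto simp: gring_hom_def)
    ultimately show ?thesis by (auto simp: gring_hom_def)
  qed
  ultimately show ?thesis
    using graded_ring_B kmap_B_central by (auto simp: graded_rring_def graded_algebra_def galg_hom_def kmap_B)
qed

end

section \<open>Extension of scalars\<close>

lemma left_moduleD:
  assumes "left_module A M"
  shows "ring A" "abelian_group M" "a \<in> carrier A \<Longrightarrow> x \<in> carrier M \<Longrightarrow> a \<odot>\<^bsub>M\<^esub> x \<in> carrier M"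
    "a \<in> carrier A \<Longrightarrow> b \<in> carrier A \<Longrightarrow> x \<in> carrier M \<Longrightarrow> (a \<oplus>\<^bsub>A\<^esub> b) \<odot>\<^bsub>M\<^esub> x = a \<odot>\<^bsub>M\<^esub> x \<oplus>\<^bsub>M\<^esub> b \<odot>\<^bsub>M\<^esub> x"
    "a \<in> carrier A \<Longrightarrow> x \<in> carrier M \<Longrightarrow> y \<in> carrier M \<Longrightarrow> a \<odot>\<^bsub>M\<^esub> (x \<oplus>\<^bsub>M\<^esub> y) = a \<odot>\<^bsub>M\<^esub> x \<oplus>\<^bsub>M\<^esub> a \<odot>\<^bsub>M\<^esub> y"
    "a \<in> carrier A \<Longrightarrow> b \<in> carrier A \<Longrightarrow> x \<in> carrier M \<Longrightarrow> (a \<otimes>\<^bsub>A\<^esub> b) \<odot>\<^bsub>M\<^esub> x = a \<odot>\<^bsub>M\<^esub> (b \<odot>\<^bsub>M\<^esub> x)"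
    "x \<in> carrier M \<Longrightarrow> \<one>\<^bsub>A\<^esub> \<odot>\<^bsub>M\<^esub> x = x"
  using assms by (auto simp: left_module_def)

lemma smult_hom_left:
  assumes "left_module A M" "x \<in> carrier M"
  shows "abelian_group_hom A M (\<lambda>a. a \<odot>\<^bsub>M\<^esub> x)"
  using left_moduleD(3,4)[OF assms(1)] assms(2)
  by (intro abelian_group_homI'[OF ring.is_abelian_group[OF left_moduleD(1)[OF assms(1)]] left_moduleD(2)[OF assms(1)]]) auto

lemma abelian_group_hom_finsum:
  assumes "abelian_group A" "abelian_group B" "\<And>i. i \<in> I \<Longrightarrow> abelian_group_hom A B (h i)"
  shows "abelian_group_hom A B (\<lambda>x. \<Oplus>\<^bsub>B\<^esub>i\<in>I. h i x)"
proof -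
  interpret B: abelian_group B by fact
  have cl: "h i x \<in> carrier B" if "i \<in> I" "x \<in> carrier A" for i x
    using abelian_group_hom.hom_closed[OF assms(3)] that by blast
  show ?thesis
  proof (intro abelian_group_homI' assms(1,2))
    fix x y assume xy: "x \<in> carrier A" "y \<in> carrier A"
    show "(\<Oplus>\<^bsub>B\<^esub>i\<in>I. h i x) \<in> carrier B" using cl xy by (intro B.finsum_closed) auto
    have "(\<Oplus>\<^bsub>B\<^esub>i\<in>I. h i (x \<oplus>\<^bsub>A\<^esub> y)) = (\<Oplus>\<^bsub>B\<^esub>i\<in>I. h i x \<oplus>\<^bsub>B\<^esub> h i y)"
      using cl xy abelian_group_hom.hom_add[OF assms(3)] by (intro B.finsum_cong') auto
    also have "\<dots> = (\<Oplus>\<^bsub>B\<^esub>i\<in>I. h i x) \<oplus>\<^bsub>B\<^esub> (\<Oplus>\<^bsub>B\<^esub>i\<in>I. h i y)"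
      using cl xy by (intro B.finsum_addf) auto
    finally show "(\<Oplus>\<^bsub>B\<^esub>i\<in>I. h i (x \<oplus>\<^bsub>A\<^esub> y)) = (\<Oplus>\<^bsub>B\<^esub>i\<in>I. h i x) \<oplus>\<^bsub>B\<^esub> (\<Oplus>\<^bsub>B\<^esub>i\<in>I. h i y)" .
  qed
qed

text \<open>Scalar multiplication by \<open>t\<close> is written as the map induced by s \<mapsto>
  ts, so that the results on induced maps cover it.\<close>

lemma tensor_simps:
  "carrier (tensor R T M) = carrier (free_Abelian_group (carrier T \<times> carrier M) Mod tensor_kernel R T M)"
  "ring.zero (tensor R T M) = one (free_Abelian_group (carrier T \<times> carrier M) Mod tensor_kernel R T M)"
  "ring.add (tensor R T M) = mult (free_Abelian_group (carrier T \<times> carrier M) Mod tensor_kernel R T M)"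
  "smult (tensor R T M) t X = tensor_map R T M (\<lambda>s. t \<otimes>\<^bsub>T\<^esub> s) X"
  "mgrade (tensor R T M) \<gamma> = tensor_class R T M ` generate (free_Abelian_group (carrier T \<times> carrier M))
     {frag_of (t, x) | t x \<delta> \<epsilon>. t \<in> grade T \<delta> \<and> x \<in> mgrade M \<epsilon> \<and> \<delta> + \<epsilon> = \<gamma>}"
  by (simp_all add: tensor_def Let_def tensor_map_def)

text \<open>The pure tensor of \<open>t\<close> and \<open>x\<close>.\<close>

definition tensor_elem ::
    "('g, 'k, 'r) galg \<Rightarrow> ('g, 'k, 'r, 't) grring \<Rightarrow> ('g, 'r, 'm) gmod \<Rightarrow> 't \<Rightarrow> 'm \<Rightarrow> ('t \<times> 'm \<Rightarrow>\<^sub>0 int) set" where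
  "tensor_elem R T M t x = tensor_class R T M (frag_of (t, x))"

locale scalar_extension =
  fixes R :: "('g::ab_group_add, 'k, 'r) galg" and T :: "('g, 'k, 'r, 't) grring" and M :: "('g, 'r, 'm) gmod"
  assumes module: "left_module R M" and ring_T: "ring T" and rmap_hom: "rmap T \<in> ring_hom R T"
begin

abbreviation "F \<equiv> free_Abelian_group (carrier T \<times> carrier M)"
abbreviation "N \<equiv> tensor_kernel R T M"
abbreviation "cls \<equiv> tensor_class R T M"
abbreviation "te \<equiv> tensor_elem R T M"
abbreviation "TM \<equiv> tensor R T M"

lemmas mod = left_moduleD[OF module]

sublocale T: ring T by (rule ring_T)
sublocale F: comm_group F by (rule abelian_free_Abelian_group)

lemma M_add_closed: "x \<in> carrier M \<Longrightarrow> y \<in> carrier M \<Longrightarrow> x \<oplus>\<^bsub>M\<^esub> y \<in> carrier M"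
  using mod(2) by (rule abelian_groupE(1))

lemma relations_closed: "tensor_relations R T M \<subseteq> carrier F"
  using ring_hom_closed[OF rmap_hom] mod(3) M_add_closed
  unfolding tensor_relations_def
  by (intro Un_least subsetI; elim CollectE exE conjE; simp add: keys_minus_subset)

lemma subgroup_N: "subgroup N F"
  unfolding tensor_kernel_def using relations_closed by (rule F.generate_is_subgroup)

lemma normal_N: "N \<lhd> F"
  using subgroup_N by (rule F.subgroup_imp_normal)

lemma N_closed:
  "0 \<in> N" "a \<in> N \<Longrightarrow> b \<in> N \<Longrightarrow> a + b \<in> N" "a \<in> N \<Longrightarrow> Poly_Mapping.keys a \<subseteq> carrier T \<times> carrier M"
  "a \<in> N \<Longrightarrow> - a \<in> N"
  using subgroup.one_closed[OF subgroup_N] subgroup.m_closed[OF subgroup_N, of a b]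
    subgroup.mem_carrier[OF subgroup_N, of a] subgroup.m_inv_closed[OF subgroup_N, of a] by auto

lemma cls_eq: "cls c = {n + c | n. n \<in> N}"
  by (auto simp: tensor_class_def r_coset_def)

lemma cls_eq_iff: "cls c = cls d \<longleftrightarrow> c - d \<in> N"
proof
  assume eq: "cls c = cls d"
  have "c \<in> cls c" using N_closed(1) unfolding cls_eq by force
  then have "c \<in> cls d" unfolding eq .
  then show "c - d \<in> N" unfolding cls_eq by auto
next
  assume cd: "c - d \<in> N"
  have *: "cls c \<subseteq> cls d" if cd: "c - d \<in> N" for c d
  proof
    fix z assume "z \<in> cls c"
    then obtain n where n: "n \<in> N" "z = n + c" unfolding cls_eq by blast
    then have "z = (n + (c - d)) + d" "n + (c - d) \<in> N" using N_closed(2)[OF n(1) cd] by simp_all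
    then show "z \<in> cls d" unfolding cls_eq by blast
  qed
  have "d - c \<in> N" using N_closed(4)[OF cd] by simp
  then show "cls c = cls d" using *[OF cd] * by (intro equalityI)
qed

lemma abelian_group_tensor: "abelian_group TM"
proof (rule comm_group_abelian_groupI)
  have *: "comm_group (F Mod N)" by (rule F.abelian_FactGroup[OF subgroup_N])
  show "comm_group (add_monoid TM)"
    using comm_groupE[OF *] by (intro comm_groupI) (simp_all add: tensor_simps)
qed

sublocale TM: abelian_group TM by (rule abelian_group_tensor)

lemma carrier_tensor: "carrier TM = cls ` carrier F"
  by (simp add: tensor_simps carrier_FactGroup tensor_class_def[abs_def])

lemma cls_add: "c \<in> carrier F \<Longrightarrow> d \<in> carrier F \<Longrightarrow> cls (c + d) = cls c \<oplus>\<^bsub>TM\<^esub> cls d"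
  using hom_mult[OF normal.r_coset_hom_Mod[OF normal_N], of c d] by (simp add: tensor_simps tensor_class_def)

lemma cls_zero: "cls 0 = \<zero>\<^bsub>TM\<^esub>"
  by (auto simp: tensor_simps cls_eq)

lemma cls_minus: "c \<in> carrier F \<Longrightarrow> cls (- c) = \<ominus>\<^bsub>TM\<^esub> cls c"
  using cls_add[of "- c" c] cls_zero carrier_tensor
  by (intro TM.minus_equality[symmetric]) auto

lemma cls_diff: "c \<in> carrier F \<Longrightarrow> d \<in> carrier F \<Longrightarrow> cls (c - d) = cls c \<ominus>\<^bsub>TM\<^esub> cls d"
  using cls_add[of c "- d"] cls_minus[of d] by (simp add: a_minus_def)

lemma te_closed: "t \<in> carrier T \<Longrightarrow> x \<in> carrier M \<Longrightarrow> te t x \<in> carrier TM"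
  by (auto simp: carrier_tensor tensor_elem_def)

lemma relations_in_N:
  shows "s \<in> carrier T \<Longrightarrow> t \<in> carrier T \<Longrightarrow> x \<in> carrier M \<Longrightarrow>
      frag_of (s \<oplus>\<^bsub>T\<^esub> t, x) - frag_of (s, x) - frag_of (t, x) \<in> N"
    and "t \<in> carrier T \<Longrightarrow> x \<in> carrier M \<Longrightarrow> y \<in> carrier M \<Longrightarrow>
      frag_of (t, x \<oplus>\<^bsub>M\<^esub> y) - frag_of (t, x) - frag_of (t, y) \<in> N"
    and "t \<in> carrier T \<Longrightarrow> r \<in> carrier R \<Longrightarrow> x \<in> carrier M \<Longrightarrow>
      frag_of (t \<otimes>\<^bsub>T\<^esub> rmap T r, x) - frag_of (t, r \<odot>\<^bsub>M\<^esub> x) \<in> N"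
  unfolding tensor_kernel_def tensor_relations_def by (rule generate.incl; blast)+

lemma te_add_left:
  assumes "s \<in> carrier T" "t \<in> carrier T" "x \<in> carrier M"
  shows "te (s \<oplus>\<^bsub>T\<^esub> t) x = te s x \<oplus>\<^bsub>TM\<^esub> te t x"
proof -
  have "frag_of (s \<oplus>\<^bsub>T\<^esub> t, x) - frag_of (s, x) - frag_of (t, x) \<in> N"
    using assms by (rule relations_in_N)
  then have "cls (frag_of (s \<oplus>\<^bsub>T\<^esub> t, x)) = cls (frag_of (s, x) + frag_of (t, x))"
    by (simp add: cls_eq_iff diff_diff_eq)
  then show ?thesis using assms by (simp add: tensor_elem_def cls_add)
qed

lemma te_add_right:
  assumes "t \<in> carrier T" "x \<in> carrier M" "y \<in> carrier M"
  shows "te t (x \<oplus>\<^bsub>M\<^esub> y) = te t x \<oplus>\<^bsub>TM\<^esub> te t y"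
proof -
  have "frag_of (t, x \<oplus>\<^bsub>M\<^esub> y) - frag_of (t, x) - frag_of (t, y) \<in> N"
    using assms by (rule relations_in_N)
  then have "cls (frag_of (t, x \<oplus>\<^bsub>M\<^esub> y)) = cls (frag_of (t, x) + frag_of (t, y))"
    by (simp add: cls_eq_iff diff_diff_eq)
  then show ?thesis using assms by (simp add: tensor_elem_def cls_add)
qed

lemma te_balanced:
  assumes "t \<in> carrier T" "r \<in> carrier R" "x \<in> carrier M"
  shows "te (t \<otimes>\<^bsub>T\<^esub> rmap T r) x = te t (r \<odot>\<^bsub>M\<^esub> x)"
proof -
  have "frag_of (t \<otimes>\<^bsub>T\<^esub> rmap T r, x) - frag_of (t, r \<odot>\<^bsub>M\<^esub> x) \<in> N"
    using assms by (rule relations_in_N)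
  then show ?thesis by (simp add: cls_eq_iff tensor_elem_def)
qed

lemma te_hom_right: "t \<in> carrier T \<Longrightarrow> abelian_group_hom M TM (te t)"
  by (intro abelian_group_homI' mod(2) abelian_group_tensor te_closed te_add_right)

lemma tensor_additive_subgroup:
  assumes U: "additive_subgroup U TM" and te: "\<And>t x. t \<in> carrier T \<Longrightarrow> x \<in> carrier M \<Longrightarrow> te t x \<in> U"
  shows "carrier TM \<subseteq> U"
proof -
  interpret U: additive_subgroup U TM by fact
  have "cls c \<in> U" if "Poly_Mapping.keys c \<subseteq> carrier T \<times> carrier M" for c
  proof (rule free_Abelian_group_induct[OF that])
    show "cls 0 \<in> U" using cls_zero by simp
    show "cls (x - y) \<in> U" if "Poly_Mapping.keys x \<subseteq> carrier T \<times> carrier M"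
      "Poly_Mapping.keys y \<subseteq> carrier T \<times> carrier M" "cls x \<in> U" "cls y \<in> U" for x y
      using cls_diff[of x y] that by (simp add: a_minus_def)
    show "cls (frag_of p) \<in> U" if "p \<in> carrier T \<times> carrier M" for p
      using te[of "fst p" "snd p"] that by (auto simp: tensor_elem_def)
  qed
  then show ?thesis by (auto simp: carrier_tensor)
qed

lemma tensor_hom_eqI:
  assumes "abelian_group_hom TM G g" "abelian_group_hom TM G h"
    "\<And>t x. t \<in> carrier T \<Longrightarrow> x \<in> carrier M \<Longrightarrow> g (te t x) = h (te t x)" "X \<in> carrier TM"
  shows "g X = h X"
  using tensor_additive_subgroup[OF additive_subgroup_equalizer[OF assms(1,2)]] assms(3,4) te_closed by blast

text \<open>The additive extension of \<open>b\<close> to the free abelian group kills each of the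
  three kinds of relations, hence the subgroup they generate, and factors through the
  quotient.\<close>

lemma tensor_lift:
  assumes G: "abelian_group G"
    and cl: "\<And>t x. t \<in> carrier T \<Longrightarrow> x \<in> carrier M \<Longrightarrow> b t x \<in> carrier G"
    and addl: "\<And>s t x. s \<in> carrier T \<Longrightarrow> t \<in> carrier T \<Longrightarrow> x \<in> carrier M \<Longrightarrow> b (s \<oplus>\<^bsub>T\<^esub> t) x = b s x \<oplus>\<^bsub>G\<^esub> b t x"
    and addr: "\<And>t x y. t \<in> carrier T \<Longrightarrow> x \<in> carrier M \<Longrightarrow> y \<in> carrier M \<Longrightarrow> b t (x \<oplus>\<^bsub>M\<^esub> y) = b t x \<oplus>\<^bsub>G\<^esub> b t y"
    and bal: "\<And>t r x. t \<in> carrier T \<Longrightarrow> r \<in> carrier R \<Longrightarrow> x \<in> carrier M \<Longrightarrow> b (t \<otimes>\<^bsub>T\<^esub> rmap T r) x = b t (r \<odot>\<^bsub>M\<^esub> x)"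
  obtains h where "abelian_group_hom TM G h" "\<And>t x. t \<in> carrier T \<Longrightarrow> x \<in> carrier M \<Longrightarrow> h (te t x) = b t x"
proof -
  interpret G: abelian_group G by fact
  have "(\<lambda>(t, x). b t x) ` (carrier T \<times> carrier M) \<subseteq> carrier (add_monoid G)" using cl by auto
  then obtain h where h: "h \<in> hom F (add_monoid G)" and hb: "\<And>p. p \<in> carrier T \<times> carrier M \<Longrightarrow> h (frag_of p) = (\<lambda>(t, x). b t x) p"
    using comm_group.free_Abelian_group_universal[OF G.a_comm_group] by metis
  interpret h: group_hom F "add_monoid G" h
    using h G.a_group by (simp add: group_hom_def group_hom_axioms_def)
  have h_add: "h (c + d) = h c \<oplus>\<^bsub>G\<^esub> h d" if "c \<in> carrier F" "d \<in> carrier F" for c d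
    using h.hom_mult[OF that] by simp
  have h_cl: "h c \<in> carrier G" if "c \<in> carrier F" for c
    using h.hom_closed[OF that] by simp
  have h_eq: "h c = h d" if "h (c - d) = \<zero>\<^bsub>G\<^esub>" "c \<in> carrier F" "d \<in> carrier F" for c d
    using h_add[of "c - d" d] h_cl that keys_minus_subset[of c _ d] by simp
  \<comment> \<open>Relations are differences of formal sums, while the hypotheses on
    \<open>b\<close> are equations in \<open>G\<close>; this and \<open>h_eq\<close> translate
    between the two.\<close>
  have h_diff: "h (c - d) = \<zero>\<^bsub>G\<^esub>" if "h c = h d" "c \<in> carrier F" "d \<in> carrier F" for c d
  proof -
    have cd: "c - d \<in> carrier F" using that keys_minus_subset[of c _ d] by simp
    have "h c = h d \<oplus>\<^bsub>G\<^esub> h (c - d)" using h_add[OF that(3) cd] by simp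
    then have "h c \<ominus>\<^bsub>G\<^esub> h d = h (c - d)" using h_cl cd that by (simp only: G.minus_eq_iff)
    then show ?thesis using h_cl that G.minus_eq_zero_iff[of "h d" "h d"] by simp
  qed
  have rel0: "h r = \<zero>\<^bsub>G\<^esub>" if "r \<in> tensor_relations R T M" for r
    using that unfolding tensor_relations_def
  proof (elim UnE CollectE exE conjE)
    fix s t x assume *: "r = frag_of (s \<oplus>\<^bsub>T\<^esub> t, x) - frag_of (s, x) - frag_of (t, x)" "s \<in> carrier T" "t \<in> carrier T" "x \<in> carrier M"
    have "h (frag_of (s \<oplus>\<^bsub>T\<^esub> t, x) - (frag_of (s, x) + frag_of (t, x))) = \<zero>\<^bsub>G\<^esub>"
      using * by (intro h_diff) (simp_all add: hb h_add addl keys_plus_subset)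
    then show ?thesis by (simp add: * diff_diff_eq)
  next
    fix t x y assume *: "r = frag_of (t, x \<oplus>\<^bsub>M\<^esub> y) - frag_of (t, x) - frag_of (t, y)" "t \<in> carrier T" "x \<in> carrier M" "y \<in> carrier M"
    have "h (frag_of (t, x \<oplus>\<^bsub>M\<^esub> y) - (frag_of (t, x) + frag_of (t, y))) = \<zero>\<^bsub>G\<^esub>"
      using * by (intro h_diff) (simp_all add: hb h_add addr keys_plus_subset M_add_closed)
    then show ?thesis by (simp add: * diff_diff_eq)
  next
    fix t s x assume *: "r = frag_of (t \<otimes>\<^bsub>T\<^esub> rmap T s, x) - frag_of (t, s \<odot>\<^bsub>M\<^esub> x)" "t \<in> carrier T" "s \<in> carrier R" "x \<in> carrier M"
    have "h (frag_of (t \<otimes>\<^bsub>T\<^esub> rmap T s, x) - frag_of (t, s \<odot>\<^bsub>M\<^esub> x)) = \<zero>\<^bsub>G\<^esub>"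
      using * ring_hom_closed[OF rmap_hom] by (intro h_diff) (simp_all add: hb bal mod(3))
    then show ?thesis by (simp add: *)
  qed
  have ker: "N \<subseteq> kernel F (add_monoid G) h"
    unfolding tensor_kernel_def
  proof (rule F.generate_subgroup_incl[OF _ h.subgroup_kernel], rule subsetI)
    fix r assume r: "r \<in> tensor_relations R T M"
    then have "r \<in> carrier F" using relations_closed by blast
    then show "r \<in> kernel F (add_monoid G) h" using rel0[OF r] by (simp add: kernel_def)
  qed
  have "h c = h d" if "c \<in> carrier F" "d \<in> carrier F" "N #>\<^bsub>F\<^esub> c = N #>\<^bsub>F\<^esub> d" for c d
  proof (rule h_eq[OF _ that(1,2)])
    have "c - d \<in> N" using that(3) cls_eq_iff by (simp add: tensor_class_def)
    then show "h (c - d) = \<zero>\<^bsub>G\<^esub>" using ker by (auto simp: kernel_def)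
  qed
  then obtain g where g: "g \<in> hom (F Mod N) (add_monoid G)" "\<And>c. c \<in> carrier F \<Longrightarrow> g (N #>\<^bsub>F\<^esub> c) = h c"
    using FactGroup_universal[OF h normal_N] by metis
  have "abelian_group_hom TM G g"
    using g(1) by (intro abelian_group_homI' abelian_group_tensor G) (auto simp: tensor_simps hom_def)
  moreover have "g (te t x) = b t x" if "t \<in> carrier T" "x \<in> carrier M" for t x
    using that by (simp add: tensor_elem_def tensor_class_def g(2) hb)
  ultimately show ?thesis using that by blast
qed

section \<open>The grading of the tensor product\<close>

lemma mgrade_in:
  assumes "t \<in> grade T \<delta>" "x \<in> mgrade M \<epsilon>"
  shows "te t x \<in> mgrade TM (\<delta> + \<epsilon>)"
  unfolding tensor_simps tensor_elem_def using assms by (intro imageI generate.incl) auto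

context
  assumes gradeT: "\<And>\<delta>. grade T \<delta> \<subseteq> carrier T" and gradeM: "\<And>\<epsilon>. mgrade M \<epsilon> \<subseteq> carrier M"
begin

lemma mgrade_gens:
  "{frag_of (t, x) | t x \<delta> \<epsilon>. t \<in> grade T \<delta> \<and> x \<in> mgrade M \<epsilon> \<and> \<delta> + \<epsilon> = \<gamma>} \<subseteq> carrier F"
  using gradeT gradeM by fastforce

lemma mgrade_subgroup: "additive_subgroup (mgrade TM \<gamma>) TM"
proof (rule additive_subgroupI'[OF abelian_group_tensor])
  let ?H = "generate F {frag_of (t, x) | t x \<delta> \<epsilon>. t \<in> grade T \<delta> \<and> x \<in> mgrade M \<epsilon> \<and> \<delta> + \<epsilon> = \<gamma>}"
  have H: "subgroup ?H F" by (rule F.generate_is_subgroup[OF mgrade_gens])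
  have Hc: "c \<in> carrier F" if "c \<in> ?H" for c using subgroup.mem_carrier[OF H that] .
  show "mgrade TM \<gamma> \<subseteq> carrier TM"
    unfolding carrier_tensor unfolding tensor_simps using Hc by blast
  show "\<zero>\<^bsub>TM\<^esub> \<in> mgrade TM \<gamma>"
    unfolding cls_zero[symmetric] tensor_simps(5) using subgroup.one_closed[OF H] by simp
  fix X assume "X \<in> mgrade TM \<gamma>"
  then obtain c where c: "c \<in> ?H" "X = cls c" unfolding tensor_simps(5) by blast
  have "- c \<in> ?H" using subgroup.m_inv_closed[OF H c(1)] Hc[OF c(1)] by simp
  then show "\<ominus>\<^bsub>TM\<^esub> X \<in> mgrade TM \<gamma>"
    unfolding tensor_simps(5) c(2) cls_minus[OF Hc[OF c(1)], symmetric] by (rule imageI)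
  fix Y assume "Y \<in> mgrade TM \<gamma>"
  then obtain d where d: "d \<in> ?H" "Y = cls d" unfolding tensor_simps(5) by blast
  have "c + d \<in> ?H" using subgroup.m_closed[OF H c(1) d(1)] by simp
  then show "X \<oplus>\<^bsub>TM\<^esub> Y \<in> mgrade TM \<gamma>"
    unfolding c(2) d(2) cls_add[OF Hc[OF c(1)] Hc[OF d(1)], symmetric] unfolding tensor_simps(5) by (rule imageI)
qed

lemma mgrade_subset:
  assumes U: "additive_subgroup U TM"
    and te: "\<And>t x \<delta> \<epsilon>. t \<in> grade T \<delta> \<Longrightarrow> x \<in> mgrade M \<epsilon> \<Longrightarrow> \<delta> + \<epsilon> = \<gamma> \<Longrightarrow> te t x \<in> U"
  shows "mgrade TM \<gamma> \<subseteq> U"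
proof -
  interpret U: additive_subgroup U TM by fact
  let ?S = "{frag_of (t, x) | t x \<delta> \<epsilon>. t \<in> grade T \<delta> \<and> x \<in> mgrade M \<epsilon> \<and> \<delta> + \<epsilon> = \<gamma>}"
  have "c \<in> carrier F \<and> cls c \<in> U" if "c \<in> generate F ?S" for c
    using that
  proof (induction rule: generate.induct)
    case one then show ?case using cls_zero by simp
  next
    case (incl h)
    have "h \<in> carrier F" using subsetD[OF mgrade_gens incl] .
    then show ?case using incl te by (auto simp: tensor_elem_def)
  next
    case (inv h)
    have h: "h \<in> carrier F" using subsetD[OF mgrade_gens inv] .
    have "cls h \<in> U" using inv te by (auto simp: tensor_elem_def)
    then show ?case using h cls_minus[of h] by simp
  next
    case (eng h1 h2)
    then show ?case using cls_add[of h1 h2] by (simp add: keys_plus_subset)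
  qed
  then show ?thesis unfolding tensor_simps by blast
qed

end

end

text \<open>The map \<open>a\<close> is additive and compatible with \<open>R\<close> on the right,
  but not assumed multiplicative. Both homomorphisms of \<open>R\<close>-rings and left
  multiplications by a fixed element are instances.\<close>

locale scalar_map = S?: scalar_extension R S M + T: scalar_extension R T M
  for R :: "('g::ab_group_add, 'k, 'r) galg" and S :: "('g, 'k, 'r, 's) grring"
    and T :: "('g, 'k, 'r, 't) grring" and M :: "('g, 'r, 'm) gmod" +
  fixes a :: "'s \<Rightarrow> 't"
  assumes a_closed: "s \<in> carrier S \<Longrightarrow> a s \<in> carrier T"
    and a_add: "s \<in> carrier S \<Longrightarrow> t \<in> carrier S \<Longrightarrow> a (s \<oplus>\<^bsub>S\<^esub> t) = a s \<oplus>\<^bsub>T\<^esub> a t"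
    and a_balanced: "s \<in> carrier S \<Longrightarrow> r \<in> carrier R \<Longrightarrow> a (s \<otimes>\<^bsub>S\<^esub> rmap S r) = a s \<otimes>\<^bsub>T\<^esub> rmap T r"
begin

abbreviation "\<theta> \<equiv> frag_extend (\<lambda>(s, x). frag_of (a s, x))"

lemma theta_closed:
  assumes "Poly_Mapping.keys c \<subseteq> carrier S \<times> carrier M"
  shows "Poly_Mapping.keys (\<theta> c) \<subseteq> carrier T \<times> carrier M"
proof -
  have "Poly_Mapping.keys (\<theta> c) \<subseteq> (\<Union>p\<in>Poly_Mapping.keys c. Poly_Mapping.keys ((\<lambda>(s, x). frag_of (a s, x)) p))"
    by (rule keys_frag_extend)
  also have "\<dots> \<subseteq> carrier T \<times> carrier M" using assms a_closed by auto
  finally show ?thesis .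
qed

lemma theta_kernel:
  assumes "c \<in> tensor_kernel R S M"
  shows "\<theta> c \<in> tensor_kernel R T M"
proof -
  have rel: "\<theta> r \<in> tensor_kernel R T M" if "r \<in> tensor_relations R S M" for r
    using that unfolding tensor_relations_def
  proof (elim UnE CollectE exE conjE)
    fix s t x assume *: "r = frag_of (s \<oplus>\<^bsub>S\<^esub> t, x) - frag_of (s, x) - frag_of (t, x)" "s \<in> carrier S" "t \<in> carrier S" "x \<in> carrier M"
    then have "\<theta> r = frag_of (a s \<oplus>\<^bsub>T\<^esub> a t, x) - frag_of (a s, x) - frag_of (a t, x)"
      by (simp add: frag_extend_diff a_add)
    then show ?thesis using * a_closed by (simp only: T.relations_in_N(1))
  next
    fix t x y assume *: "r = frag_of (t, x \<oplus>\<^bsub>M\<^esub> y) - frag_of (t, x) - frag_of (t, y)" "t \<in> carrier S" "x \<in> carrier M" "y \<in> carrier M"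
    then have "\<theta> r = frag_of (a t, x \<oplus>\<^bsub>M\<^esub> y) - frag_of (a t, x) - frag_of (a t, y)"
      by (simp add: frag_extend_diff)
    then show ?thesis using * a_closed by (simp only: T.relations_in_N(2))
  next
    fix t q x assume *: "r = frag_of (t \<otimes>\<^bsub>S\<^esub> rmap S q, x) - frag_of (t, q \<odot>\<^bsub>M\<^esub> x)" "t \<in> carrier S" "q \<in> carrier R" "x \<in> carrier M"
    then have "\<theta> r = frag_of (a t \<otimes>\<^bsub>T\<^esub> rmap T q, x) - frag_of (a t, q \<odot>\<^bsub>M\<^esub> x)"
      by (simp add: frag_extend_diff a_balanced)
    then show ?thesis using * a_closed by (simp only: T.relations_in_N(3))
  qed
  show ?thesis
    using assms unfolding tensor_kernel_def[of R S M]
  proof (induction rule: generate.induct)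
    case one then show ?case using T.N_closed(1) by simp
  next
    case (inv h)
    then have "h \<in> carrier S.F" using S.relations_closed by blast
    then show ?case using rel[OF inv] T.N_closed(4) by (simp add: frag_extend_minus)
  next
    case (eng h1 h2)
    then show ?case using T.N_closed(2) by (simp add: frag_extend_add)
  qed (rule rel)
qed

text \<open>Members of a coset differ by elements of the kernel, which \<open>\<theta>\<close> sends
  into the kernel; the union in \<open>tensor_map\<close> is over copies of one coset.\<close>

lemma tensor_map_cls: "tensor_map R T M a (S.cls c) = T.cls (\<theta> c)"
proof -
  have "T.cls (\<theta> d) = T.cls (\<theta> c)" if d: "d \<in> S.cls c" for d
  proof -
    obtain n where "n \<in> S.N" "d = n + c" using d unfolding S.cls_eq by blast
    then show ?thesis using theta_kernel by (simp add: T.cls_eq_iff frag_extend_add)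
  qed
  moreover have "c \<in> S.cls c" using S.N_closed(1) unfolding S.cls_eq by force
  ultimately show ?thesis unfolding tensor_map_def by blast
qed

lemma tensor_map_te: "tensor_map R T M a (S.te s x) = T.te (a s) x"
  by (simp add: tensor_elem_def tensor_map_cls)

lemma tensor_map_hom: "abelian_group_hom S.TM T.TM (tensor_map R T M a)"
proof (intro abelian_group_homI' S.abelian_group_tensor T.abelian_group_tensor)
  fix X Y assume "X \<in> carrier S.TM" "Y \<in> carrier S.TM"
  then obtain c d where cd: "c \<in> carrier S.F" "d \<in> carrier S.F" "X = S.cls c" "Y = S.cls d"
    unfolding S.carrier_tensor by blast
  have th: "\<theta> c \<in> carrier T.F" "\<theta> d \<in> carrier T.F" using cd theta_closed by auto
  then show "tensor_map R T M a X \<in> carrier T.TM" by (simp only: cd tensor_map_cls T.carrier_tensor imageI)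
  show "tensor_map R T M a (X \<oplus>\<^bsub>S.TM\<^esub> Y) = tensor_map R T M a X \<oplus>\<^bsub>T.TM\<^esub> tensor_map R T M a Y"
    using cd(1,2) th by (simp only: cd(3,4) S.cls_add[symmetric] T.cls_add[symmetric] tensor_map_cls frag_extend_add)
qed

end

section \<open>The tensor product as a module over the new ring\<close>

context scalar_extension
begin

lemma smult_map:
  assumes "t \<in> carrier T"
  shows "scalar_map R T T M (\<lambda>s. t \<otimes>\<^bsub>T\<^esub> s)"
proof (unfold_locales)
  fix s r assume "s \<in> carrier T" "r \<in> carrier R"
  then show "t \<otimes>\<^bsub>T\<^esub> (s \<otimes>\<^bsub>T\<^esub> rmap T r) = t \<otimes>\<^bsub>T\<^esub> s \<otimes>\<^bsub>T\<^esub> rmap T r"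
    using assms ring_hom_closed[OF rmap_hom] by (simp add: T.m_assoc)
qed (use assms in \<open>auto simp: T.r_distr\<close>)

lemma smult_te: "t \<in> carrier T \<Longrightarrow> t \<odot>\<^bsub>TM\<^esub> te s x = te (t \<otimes>\<^bsub>T\<^esub> s) x"
  unfolding tensor_simps by (rule scalar_map.tensor_map_te[OF smult_map])

lemma smult_hom: "t \<in> carrier T \<Longrightarrow> abelian_group_hom TM TM (\<lambda>X. t \<odot>\<^bsub>TM\<^esub> X)"
  unfolding tensor_simps by (rule scalar_map.tensor_map_hom[OF smult_map])

lemma left_module_tensor: "left_module T TM"
  unfolding left_module_def
proof (intro conjI ballI ring_T abelian_group_tensor)
  note h = smult_hom and hc = abelian_group_hom.hom_closed[OF smult_hom]
  show "a \<odot>\<^bsub>TM\<^esub> X \<in> carrier TM" if "a \<in> carrier T" "X \<in> carrier TM" for a X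
    using that by (rule hc)
  show "a \<odot>\<^bsub>TM\<^esub> (X \<oplus>\<^bsub>TM\<^esub> Y) = a \<odot>\<^bsub>TM\<^esub> X \<oplus>\<^bsub>TM\<^esub> a \<odot>\<^bsub>TM\<^esub> Y"
    if "a \<in> carrier T" "X \<in> carrier TM" "Y \<in> carrier TM" for a X Y
    using abelian_group_hom.hom_add[OF h[OF that(1)]] that by simp
  show "(a \<oplus>\<^bsub>T\<^esub> b) \<odot>\<^bsub>TM\<^esub> X = a \<odot>\<^bsub>TM\<^esub> X \<oplus>\<^bsub>TM\<^esub> b \<odot>\<^bsub>TM\<^esub> X"
    if ab: "a \<in> carrier T" "b \<in> carrier T" "X \<in> carrier TM" for a b X
  proof (rule tensor_hom_eqI[OF h _ _ ab(3)])
    show "abelian_group_hom TM TM (\<lambda>X. a \<odot>\<^bsub>TM\<^esub> X \<oplus>\<^bsub>TM\<^esub> b \<odot>\<^bsub>TM\<^esub> X)"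
      using ab hc abelian_group_hom.hom_add[OF h]
      by (intro abelian_group_homI' abelian_group_tensor) (auto simp: TM.a_ac)
  qed (use ab in \<open>auto simp: smult_te te_add_left T.l_distr\<close>)
  show "(a \<otimes>\<^bsub>T\<^esub> b) \<odot>\<^bsub>TM\<^esub> X = a \<odot>\<^bsub>TM\<^esub> (b \<odot>\<^bsub>TM\<^esub> X)"
    if ab: "a \<in> carrier T" "b \<in> carrier T" "X \<in> carrier TM" for a b X
    by (rule tensor_hom_eqI[OF h abelian_group_hom_compose[OF h h] _ ab(3)])
       (use ab in \<open>auto simp: smult_te T.m_assoc\<close>)
  show "\<one>\<^bsub>T\<^esub> \<odot>\<^bsub>TM\<^esub> X = X" if X: "X \<in> carrier TM" for X
  proof (rule tensor_hom_eqI[OF h _ _ X])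
    show "abelian_group_hom TM TM (\<lambda>X. X)" by (intro abelian_group_homI' abelian_group_tensor) auto
  qed (auto simp: smult_te)
qed

end

section \<open>Graded dual bases\<close>

text \<open>The image of an idempotent matrix \<open>E\<close> is encoded by generators \<open>b\<close> and coordinate functionals
  \<open>c\<close> that reproduce every element and whose mutual values are the entries of \<open>E\<close>.\<close>

locale graded_dual_basis =
  fixes A :: "('g::ab_group_add, 'a, 'z) gring_scheme" and M :: "('g, 'a, 'm) gmod" and n :: nat
    and \<beta> :: "nat \<Rightarrow> 'g" and E :: "nat \<Rightarrow> nat \<Rightarrow> 'a" and b :: "nat \<Rightarrow> 'm" and c :: "nat \<Rightarrow> 'm \<Rightarrow> 'a"
  assumes gr: "graded_ring A" and lmod: "left_module A M"
    and sub: "additive_subgroup (mgrade M \<delta>) M"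
    and smult_grade: "t \<in> grade A \<delta> \<Longrightarrow> x \<in> mgrade M \<epsilon> \<Longrightarrow> t \<odot>\<^bsub>M\<^esub> x \<in> mgrade M (\<delta> + \<epsilon>)"
    and basis: "i < n \<Longrightarrow> b i \<in> mgrade M (- \<beta> i)"
    and coord_hom: "i < n \<Longrightarrow> abelian_group_hom M A (c i)"
    and coord_smult: "i < n \<Longrightarrow> t \<in> carrier A \<Longrightarrow> x \<in> carrier M \<Longrightarrow> c i (t \<odot>\<^bsub>M\<^esub> x) = t \<otimes>\<^bsub>A\<^esub> c i x"
    and coord_grade: "i < n \<Longrightarrow> x \<in> mgrade M \<delta> \<Longrightarrow> c i x \<in> grade A (\<beta> i + \<delta>)"
    and expansion: "x \<in> carrier M \<Longrightarrow> (\<Oplus>\<^bsub>M\<^esub>i\<in>{..<n}. c i x \<odot>\<^bsub>M\<^esub> b i) = x"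
    and coord_basis: "i < n \<Longrightarrow> j < n \<Longrightarrow> c j (b i) = E i j"
begin

lemma basis_closed: "i < n \<Longrightarrow> b i \<in> carrier M"
  using basis additive_subgroup.a_Hcarr[OF sub] by blast

lemma coord_closed: "i < n \<Longrightarrow> x \<in> carrier M \<Longrightarrow> c i x \<in> carrier A"
  using abelian_group_hom.hom_closed[OF coord_hom] .

lemma E_closed: "i < n \<Longrightarrow> j < n \<Longrightarrow> E i j \<in> carrier A"
  using coord_closed basis_closed coord_basis by metis

lemma E_grade: "i < n \<Longrightarrow> j < n \<Longrightarrow> E i j \<in> grade A (\<beta> j - \<beta> i)"
  using coord_grade[OF _ basis, of j i] coord_basis by simp

end

text \<open>The functional induced by \<open>c\<close> on the tensor product, with values in T
  \<otimes> R = T. It is taken by choice since \<open>tensor_lift\<close> asserts only existence;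
  its values on the carrier are forced, pure tensors being generators.\<close>

definition tensor_coord ::
    "('g::ab_group_add, 'k, 'r) galg \<Rightarrow> ('g, 'k, 'r, 't) grring \<Rightarrow> ('g, 'r, 'm) gmod \<Rightarrow> ('m \<Rightarrow> 'r) \<Rightarrow>
     ('t \<times> 'm \<Rightarrow>\<^sub>0 int) set \<Rightarrow> 't" where
  "tensor_coord R T M c = (SOME h. abelian_group_hom (tensor R T M) T h \<and>
     (\<forall>t \<in> carrier T. \<forall>x \<in> carrier M. h (tensor_elem R T M t x) = t \<otimes>\<^bsub>T\<^esub> rmap T (c x)))"

lemma (in scalar_extension) tensor_coord:
  assumes c: "abelian_group_hom M R c"
    and lin: "\<And>r x. r \<in> carrier R \<Longrightarrow> x \<in> carrier M \<Longrightarrow> c (r \<odot>\<^bsub>M\<^esub> x) = r \<otimes>\<^bsub>R\<^esub> c x"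
  shows "abelian_group_hom TM T (tensor_coord R T M c)"
    "t \<in> carrier T \<Longrightarrow> x \<in> carrier M \<Longrightarrow> tensor_coord R T M c (te t x) = t \<otimes>\<^bsub>T\<^esub> rmap T (c x)"
proof -
  interpret c: abelian_group_hom M R c by fact
  note rc = ring_hom_closed[OF rmap_hom]
  obtain h where "abelian_group_hom TM T h"
    "\<And>t x. t \<in> carrier T \<Longrightarrow> x \<in> carrier M \<Longrightarrow> h (te t x) = t \<otimes>\<^bsub>T\<^esub> rmap T (c x)"
  proof (rule tensor_lift[OF T.is_abelian_group, of "\<lambda>t x. t \<otimes>\<^bsub>T\<^esub> rmap T (c x)"])
    fix t r x assume "t \<in> carrier T" "r \<in> carrier R" "x \<in> carrier M"
    then show "t \<otimes>\<^bsub>T\<^esub> rmap T r \<otimes>\<^bsub>T\<^esub> rmap T (c x) = t \<otimes>\<^bsub>T\<^esub> rmap T (c (r \<odot>\<^bsub>M\<^esub> x))"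
      using rc by (simp add: lin ring_hom_mult[OF rmap_hom] T.m_assoc)
  qed (use rc in \<open>auto simp: T.l_distr T.r_distr ring_hom_add[OF rmap_hom]\<close>)
  then have "\<exists>h. abelian_group_hom TM T h \<and> (\<forall>t \<in> carrier T. \<forall>x \<in> carrier M. h (te t x) = t \<otimes>\<^bsub>T\<^esub> rmap T (c x))"
    by blast
  from someI_ex[OF this]
  show "abelian_group_hom TM T (tensor_coord R T M c)"
    "t \<in> carrier T \<Longrightarrow> x \<in> carrier M \<Longrightarrow> tensor_coord R T M c (te t x) = t \<otimes>\<^bsub>T\<^esub> rmap T (c x)"
    unfolding tensor_coord_def by blast+
qed

lemma graded_rringD:
  assumes "graded_rring K R T"
  shows "graded_ring T" "ring T" "rmap T \<in> gring_hom R T" "rmap T \<in> ring_hom R T"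
    "c \<in> carrier K \<Longrightarrow> rmap T (kmap R c) = kmap T c"
    "c \<in> carrier K \<Longrightarrow> t \<in> carrier T \<Longrightarrow> kmap T c \<otimes>\<^bsub>T\<^esub> t = t \<otimes>\<^bsub>T\<^esub> kmap T c"
  using assms by (auto simp: graded_rring_def graded_algebra_def galg_hom_def gring_hom_def graded_ring_def)

lemma scalar_extensionI:
  assumes "left_module R M" "graded_rring K R T"
  shows "scalar_extension R T M"
  using assms graded_rringD[OF assms(2)] by (simp add: scalar_extension_def)

text \<open>Each axiom is preserved by sums and so reduces to pure tensors. The expansion rests on
  balancing: s c_i(y) \<otimes> b_i = s \<otimes> c_i(y) b_i, and these add up to s \<otimes> y. The
  values of the coordinates on the generators are the entries of \<open>e\<close> mapped to
  \<open>T\<close>.\<close>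

lemma tensor_dual_basis:
  fixes K :: "('g::ab_group_add, 'k) gring" and R :: "('g, 'k, 'r) galg" and T :: "('g, 'k, 'r, 't) grring"
    and M :: "('g, 'r, 'm) gmod"
  assumes basis: "graded_dual_basis R M n \<beta> e b c" and T: "graded_rring K R T"
  shows "graded_dual_basis T (tensor R T M) n \<beta> (\<lambda>i j. rmap T (e i j))
    (\<lambda>i. tensor_elem R T M \<one>\<^bsub>T\<^esub> (b i)) (\<lambda>j. tensor_coord R T M (c j))"
proof -
  interpret M: graded_dual_basis R M n \<beta> e b c by fact
  interpret X: scalar_extension R T M using M.lmod T by (rule scalar_extensionI)
  note Td = graded_rringD[OF T]
  note grT = graded_ringD(3)[OF Td(1)]
  have subT: "grade T \<delta> \<subseteq> carrier T" for \<delta> using grT by blast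
  have subM: "mgrade M \<epsilon> \<subseteq> carrier M" for \<epsilon> using additive_subgroup.a_subset[OF M.sub] .
  have rc: "rmap T r \<in> carrier T" if "r \<in> carrier R" for r using ring_hom_closed[OF Td(4) that] .
  have rg: "rmap T r \<in> grade T \<delta>" if "r \<in> grade R \<delta>" for r \<delta> using Td(3) that by (auto simp: gring_hom_def)
  note coord = X.tensor_coord[OF M.coord_hom M.coord_smult]
  show ?thesis
  proof (rule graded_dual_basis.intro)
    show "graded_ring T" by (rule Td)
    show "left_module T (tensor R T M)" by (rule X.left_module_tensor)
    show sub: "additive_subgroup (mgrade (tensor R T M) \<delta>) (tensor R T M)" for \<delta>
      by (rule X.mgrade_subgroup[OF subT subM])
    show "t \<odot>\<^bsub>tensor R T M\<^esub> x \<in> mgrade (tensor R T M) (\<delta> + \<epsilon>)"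
      if t: "t \<in> grade T \<delta>" and x: "x \<in> mgrade (tensor R T M) \<epsilon>" for t \<delta> x \<epsilon>
    proof -
      have tc: "t \<in> carrier T" using t grT by blast
      have "mgrade (tensor R T M) \<epsilon> \<subseteq> {x \<in> carrier X.TM. t \<odot>\<^bsub>X.TM\<^esub> x \<in> mgrade X.TM (\<delta> + \<epsilon>)}"
      proof (rule X.mgrade_subset[OF subT subM additive_subgroup_preimage[OF X.smult_hom[OF tc] sub]])
        fix s y \<delta>' \<epsilon>' assume *: "s \<in> grade T \<delta>'" "y \<in> mgrade M \<epsilon>'" "\<delta>' + \<epsilon>' = \<epsilon>"
        have "X.te (t \<otimes>\<^bsub>T\<^esub> s) y \<in> mgrade X.TM ((\<delta> + \<delta>') + \<epsilon>')"
          using graded_ringD(4)[OF Td(1) t *(1)] *(2) by (rule X.mgrade_in)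
        then show "X.te s y \<in> {x \<in> carrier X.TM. t \<odot>\<^bsub>X.TM\<^esub> x \<in> mgrade X.TM (\<delta> + \<epsilon>)}"
          using * subT subM tc by (auto simp: X.smult_te add.assoc intro!: X.te_closed)
      qed
      then show ?thesis using x by blast
    qed
    fix i assume i: "i < n"
    show "X.te \<one>\<^bsub>T\<^esub> (b i) \<in> mgrade (tensor R T M) (- \<beta> i)"
      using X.mgrade_in[OF one_in_grade_zero[OF Td(1)] M.basis[OF i]] by simp
    show hom: "abelian_group_hom (tensor R T M) T (tensor_coord R T M (c i))"
      using i by (intro coord)
    show "tensor_coord R T M (c i) (t \<odot>\<^bsub>tensor R T M\<^esub> x) = t \<otimes>\<^bsub>T\<^esub> tensor_coord R T M (c i) x"
      if t: "t \<in> carrier T" and x: "x \<in> carrier (tensor R T M)" for t x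
    proof (rule X.tensor_hom_eqI[OF abelian_group_hom_compose[OF X.smult_hom[OF t] hom] _ _ x])
      have "abelian_group_hom T T (\<lambda>s. t \<otimes>\<^bsub>T\<^esub> s)"
        using t by (intro abelian_group_homI' X.T.is_abelian_group) (auto simp: X.T.r_distr)
      then show "abelian_group_hom X.TM T (\<lambda>x. t \<otimes>\<^bsub>T\<^esub> tensor_coord R T M (c i) x)"
        by (rule abelian_group_hom_compose[OF hom])
      show "tensor_coord R T M (c i) (t \<odot>\<^bsub>tensor R T M\<^esub> X.te s y) = t \<otimes>\<^bsub>T\<^esub> tensor_coord R T M (c i) (X.te s y)"
        if "s \<in> carrier T" "y \<in> carrier M" for s y
        using t i that rc[OF M.coord_closed] by (simp add: X.smult_te coord(2) X.T.m_assoc)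
    qed
    show "tensor_coord R T M (c i) x \<in> grade T (\<beta> i + \<delta>)" if x: "x \<in> mgrade (tensor R T M) \<delta>" for x \<delta>
    proof -
      have "mgrade (tensor R T M) \<delta> \<subseteq> {x \<in> carrier X.TM. tensor_coord R T M (c i) x \<in> grade T (\<beta> i + \<delta>)}"
      proof (rule X.mgrade_subset[OF subT subM additive_subgroup_preimage[OF hom graded_ringD(2)[OF Td(1)]]])
        fix s y \<delta>' \<epsilon>' assume *: "s \<in> grade T \<delta>'" "y \<in> mgrade M \<epsilon>'" "\<delta>' + \<epsilon>' = \<delta>"
        have "s \<otimes>\<^bsub>T\<^esub> rmap T (c i y) \<in> grade T (\<delta>' + (\<beta> i + \<epsilon>'))"
          using i * by (intro graded_ringD(4)[OF Td(1)] rg M.coord_grade)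
        \<comment> \<open>The degree of \<open>s\<close> has to move past the shift \<beta>_i, which
          uses that \<Gamma> is abelian.\<close>
        moreover have "\<delta>' + (\<beta> i + \<epsilon>') = \<beta> i + \<delta>" using *(3) by (simp add: algebra_simps)
        ultimately show "X.te s y \<in> {x \<in> carrier X.TM. tensor_coord R T M (c i) x \<in> grade T (\<beta> i + \<delta>)}"
          using i * subT subM coord(2)[OF i] by (auto simp: subset_iff intro!: X.te_closed)
      qed
      then show ?thesis using x by blast
    qed
    fix j assume j: "j < n"
    show "tensor_coord R T M (c j) (X.te \<one>\<^bsub>T\<^esub> (b i)) = rmap T (e i j)"
      using i j M.basis_closed M.E_closed rc by (simp add: coord(2) M.coord_basis)
  next
    fix x assume x: "x \<in> carrier (tensor R T M)"
    show "(\<Oplus>\<^bsub>tensor R T M\<^esub>i\<in>{..<n}. tensor_coord R T M (c i) x \<odot>\<^bsub>tensor R T M\<^esub> X.te \<one>\<^bsub>T\<^esub> (b i)) = x"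
    proof (rule X.tensor_hom_eqI[OF _ _ _ x])
      show "abelian_group_hom X.TM X.TM (\<lambda>x. x)" by (intro abelian_group_homI' X.abelian_group_tensor) auto
      show "abelian_group_hom X.TM X.TM (\<lambda>x. \<Oplus>\<^bsub>X.TM\<^esub>i\<in>{..<n}. tensor_coord R T M (c i) x \<odot>\<^bsub>X.TM\<^esub> X.te \<one>\<^bsub>T\<^esub> (b i))"
        using X.te_closed[OF X.T.one_closed M.basis_closed]
        by (intro abelian_group_hom_finsum X.abelian_group_tensor
            abelian_group_hom_compose[OF coord(1) smult_hom_left[OF X.left_module_tensor]]) auto
      fix s y assume s: "s \<in> carrier T" and y: "y \<in> carrier M"
      interpret te: abelian_group_hom M X.TM "X.te s" using s by (rule X.te_hom_right)
      have cy: "c i y \<in> carrier R" "b i \<in> carrier M" if "i < n" for i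
        using that y by (auto intro: M.coord_closed M.basis_closed)
      have "(\<Oplus>\<^bsub>X.TM\<^esub>i\<in>{..<n}. tensor_coord R T M (c i) (X.te s y) \<odot>\<^bsub>X.TM\<^esub> X.te \<one>\<^bsub>T\<^esub> (b i)) =
          (\<Oplus>\<^bsub>X.TM\<^esub>i\<in>{..<n}. X.te s (c i y \<odot>\<^bsub>M\<^esub> b i))"
        using s y cy rc X.te_balanced[OF s]
        by (intro X.TM.finsum_cong') (auto simp: coord(2) X.smult_te X.mod(3))
      also have "\<dots> = X.te s (\<Oplus>\<^bsub>M\<^esub>i\<in>{..<n}. c i y \<odot>\<^bsub>M\<^esub> b i)"
        using cy by (subst te.hom_finsum) (auto simp: X.mod(3))
      finally show "(\<Oplus>\<^bsub>X.TM\<^esub>i\<in>{..<n}. tensor_coord R T M (c i) (X.te s y) \<odot>\<^bsub>X.TM\<^esub> X.te \<one>\<^bsub>T\<^esub> (b i)) = X.te s y"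
        using M.expansion[OF y] by simp
    qed
  qed
qed

text \<open>Via \<open>p\<close>, elements of P are row vectors: coordinates are their entries, and
  the generators correspond to the rows of \<open>e\<close>. The combination of these rows with
  coefficients from a vector v is ve, which is v itself for v in the image of the
  idempotent.\<close>

lemma image_of_idempotent_dual_basis:
  fixes R :: "('g::ab_group_add, 'a, 'z) gring_scheme" and P :: "('g, 'a, 'p) gmod"
  assumes P: "graded_module R P" and img: "image_of_idempotent R P n \<beta> e"
  obtains b c where "graded_dual_basis R P n \<beta> e b c"
proof -
  let ?V = "shifted_free R n \<beta>"
  let ?E = "right_mult R n e"
  let ?W = "image_module ?V ?E"
  have gR: "graded_ring R" and lP: "left_module R P" using P by (auto simp: graded_module_def)
  interpret R: ring R using gR by (rule graded_ringD)
  note Pm = left_moduleD[OF lP]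
  interpret P: abelian_group P by (rule Pm)
  have e: "e i j \<in> grade R (\<beta> j - \<beta> i)" if "i < n" "j < n" for i j
    using img that by (auto simp: image_of_idempotent_def degree0_matrices_def)
  have ec: "e i j \<in> carrier R" if "i < n" "j < n" for i j using e[OF that] graded_ringD(3)[OF gR] by blast
  obtain p where p: "p \<in> gmod_iso R P ?W" using img by (auto simp: image_of_idempotent_def)
  have V: "carrier ?V = {..<n} \<rightarrow>\<^sub>E carrier R" "mgrade ?V = (\<lambda>\<gamma>. {v \<in> {..<n} \<rightarrow>\<^sub>E carrier R. \<forall>j<n. v j \<in> grade R (\<beta> j + \<gamma>)})"
    by (simp_all add: shifted_free_def)
  have W: "carrier ?W = ?E ` carrier ?V" "mgrade ?W \<gamma> = mgrade ?V \<gamma> \<inter> ?E ` carrier ?V" for \<gamma>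
    by (simp_all add: image_module_def)
  have W_add: "(v \<oplus>\<^bsub>?W\<^esub> w) j = v j \<oplus>\<^bsub>R\<^esub> w j" and W_smult: "(a \<odot>\<^bsub>?W\<^esub> v) j = a \<otimes>\<^bsub>R\<^esub> v j" if "j < n" for v w a j
    using that by (simp_all add: image_module_def shifted_free_def)
  have E_V: "?E v \<in> carrier ?V" if "v \<in> carrier ?V" for v
    using that ec unfolding V right_mult_def by (auto intro!: R.finsum_closed)
  have idem: "?E w = w" if "w \<in> carrier ?W" for w
    using img that unfolding W image_of_idempotent_def by auto
  have W_V: "carrier ?W \<subseteq> carrier ?V" unfolding W using E_V by blast
  have p_add: "p (x \<oplus>\<^bsub>P\<^esub> y) = p x \<oplus>\<^bsub>?W\<^esub> p y" if "x \<in> carrier P" "y \<in> carrier P" for x y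
    using p that by (auto simp: gmod_iso_def gmod_hom_def)
  have p_smult: "p (a \<odot>\<^bsub>P\<^esub> x) = a \<odot>\<^bsub>?W\<^esub> p x" if "a \<in> carrier R" "x \<in> carrier P" for x a
    using p that by (auto simp: gmod_iso_def gmod_hom_def)
  have p_cl: "p x \<in> carrier ?W" if "x \<in> carrier P" for x
    using p that by (auto simp: gmod_iso_def gmod_hom_def)
  have p_V: "p x j \<in> carrier R" if "x \<in> carrier P" "j < n" for x j
    using subsetD[OF W_V p_cl[OF that(1)]] that(2) unfolding V by auto
  have p_inj: "inj_on p (carrier P)" and p_gr: "p ` mgrade P \<gamma> = mgrade ?W \<gamma>" for \<gamma>
    using p by (auto simp: gmod_iso_def bij_betw_def)
  have sub: "additive_subgroup (mgrade P \<delta>) P" for \<delta> using P by (auto simp: graded_module_def is_grading_def)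
  \<comment> \<open>Row i is the image of the i-th unit vector, whose degree is -\<beta>_i because
    R(\<beta>_i) in degree -\<beta>_i is the degree 0 part of R.\<close>
  have row: "(\<lambda>j\<in>{..<n}. e i j) \<in> mgrade ?W (- \<beta> i)" if i: "i < n" for i
  proof -
    let ?u = "\<lambda>j\<in>{..<n}. if i = j then \<one>\<^bsub>R\<^esub> else \<zero>\<^bsub>R\<^esub>"
    have "(\<Oplus>\<^bsub>R\<^esub>k\<in>{..<n}. ?u k \<otimes>\<^bsub>R\<^esub> e k j) = e i j" if j: "j < n" for j
    proof -
      have "(\<Oplus>\<^bsub>R\<^esub>k\<in>{..<n}. ?u k \<otimes>\<^bsub>R\<^esub> e k j) = (\<Oplus>\<^bsub>R\<^esub>k\<in>{..<n}. if i = k then e k j else \<zero>\<^bsub>R\<^esub>)"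
        using ec j by (intro R.finsum_cong') auto
      also have "\<dots> = e i j" using i ec j by (intro R.finsum_singleton) auto
      finally show ?thesis .
    qed
    then have "?E ?u = (\<lambda>j\<in>{..<n}. e i j)" by (auto simp: right_mult_def fun_eq_iff restrict_def)
    moreover have "?u \<in> carrier ?V" unfolding V by auto
    ultimately have "(\<lambda>j\<in>{..<n}. e i j) \<in> ?E ` carrier ?V" by (metis imageI)
    then show ?thesis unfolding W using i e ec by (auto simp: V)
  qed
  define b where "b i = (SOME x. x \<in> mgrade P (- \<beta> i) \<and> p x = (\<lambda>j\<in>{..<n}. e i j))" for i
  have b: "b i \<in> mgrade P (- \<beta> i)" "p (b i) = (\<lambda>j\<in>{..<n}. e i j)" if "i < n" for i
  proof -
    have "\<exists>x. x \<in> mgrade P (- \<beta> i) \<and> p x = (\<lambda>j\<in>{..<n}. e i j)"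
      using row[OF that] unfolding p_gr[symmetric] by (auto simp: image_iff)
    from someI_ex[OF this] show "b i \<in> mgrade P (- \<beta> i)" "p (b i) = (\<lambda>j\<in>{..<n}. e i j)"
      unfolding b_def by blast+
  qed
  have bc: "b i \<in> carrier P" if "i < n" for i using b(1)[OF that] additive_subgroup.a_Hcarr[OF sub] by blast
  have hom: "abelian_group_hom P R (\<lambda>x. p x i)" if "i < n" for i
    using p_V that R.zero_closed by (intro abelian_group_homI' P.abelian_group_axioms R.is_abelian_group) (auto simp: p_add W_add)
  have "graded_dual_basis R P n \<beta> e b (\<lambda>j x. p x j)"
  proof (rule graded_dual_basis.intro)
    show "t \<odot>\<^bsub>P\<^esub> x \<in> mgrade P (\<delta> + \<epsilon>)" if "t \<in> grade R \<delta>" "x \<in> mgrade P \<epsilon>" for t \<delta> x \<epsilon>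
      using P that by (auto simp: graded_module_def)
    show "p x i \<in> grade R (\<beta> i + \<delta>)" if "i < n" "x \<in> mgrade P \<delta>" for i x \<delta>
    proof -
      have "p x \<in> mgrade ?W \<delta>" using p_gr that by blast
      then show ?thesis using that unfolding W by (auto simp: V)
    qed
    show "p (t \<odot>\<^bsub>P\<^esub> x) i = t \<otimes>\<^bsub>R\<^esub> p x i" if "i < n" "t \<in> carrier R" "x \<in> carrier P" for i t x
      using that by (simp add: p_smult W_smult)
    show "p (b i) j = e i j" if "i < n" "j < n" for i j using that by (simp add: b)
    show "(\<Oplus>\<^bsub>P\<^esub>i\<in>{..<n}. p x i \<odot>\<^bsub>P\<^esub> b i) = x" if x: "x \<in> carrier P" for x
    proof -
      let ?y = "\<Oplus>\<^bsub>P\<^esub>i\<in>{..<n}. p x i \<odot>\<^bsub>P\<^esub> b i"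
      have yc: "?y \<in> carrier P" using x by (auto intro!: P.finsum_closed Pm(3) p_V bc)
      have "p ?y j = p x j" for j
      proof (cases "j < n")
        case True
        have "p ?y j = (\<Oplus>\<^bsub>R\<^esub>i\<in>{..<n}. p (p x i \<odot>\<^bsub>P\<^esub> b i) j)"
          using x by (intro abelian_group_hom.hom_finsum[OF hom[OF True]]) (auto intro!: Pm(3) p_V bc)
        also have "\<dots> = (\<Oplus>\<^bsub>R\<^esub>i\<in>{..<n}. p x i \<otimes>\<^bsub>R\<^esub> e i j)"
          using x True by (intro R.finsum_cong') (auto simp: p_smult W_smult bc p_V b ec)
        also have "\<dots> = ?E (p x) j" using True by (simp add: right_mult_def)
        finally show ?thesis using idem[OF p_cl[OF x]] by simp
      next
        \<comment> \<open>Beyond the index range both vectors are \<open>undefined\<close>, elements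
          of the free module being extensional functions.\<close>
        case False
        then show ?thesis
          using subsetD[OF W_V p_cl[OF x]] subsetD[OF W_V p_cl[OF yc]] unfolding V by (auto simp: PiE_def extensional_def)
      qed
      then have "p ?y = p x" by blast
      then show ?thesis using p_inj x yc by (auto dest: inj_onD)
    qed
  qed (use gR lP sub b hom in auto)
  then show ?thesis by (rule that)
qed

section \<open>Isomorphisms as pairs of matrices\<close>

context graded_dual_basis
begin

text \<open>Apply the j-th coordinate to the expansion of x. Rows of coordinates are thus exactly
  compatible with \<open>E\<close>, and taking x among the generators makes \<open>E\<close>
  idempotent.\<close>

lemma coord_row:
  assumes x: "x \<in> carrier M" and j: "j < n"
  shows "row_mult A n (\<lambda>i. c i x) E j = c j x"
proof -
  interpret A: ring A using gr by (rule graded_ringD)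
  note m = left_moduleD[OF lmod]
  have "c j x = c j (\<Oplus>\<^bsub>M\<^esub>i\<in>{..<n}. c i x \<odot>\<^bsub>M\<^esub> b i)" using expansion[OF x] by simp
  also have "\<dots> = (\<Oplus>\<^bsub>A\<^esub>i\<in>{..<n}. c j (c i x \<odot>\<^bsub>M\<^esub> b i))"
    using x by (intro abelian_group_hom.hom_finsum[OF coord_hom[OF j]]) (auto intro!: m(3) coord_closed basis_closed)
  also have "\<dots> = row_mult A n (\<lambda>i. c i x) E j"
    unfolding row_mult_def using x j
    by (intro A.finsum_cong') (auto simp: coord_smult coord_closed basis_closed coord_basis E_closed)
  finally show ?thesis by simp
qed

lemma E_idem: "i < n \<Longrightarrow> j < n \<Longrightarrow> row_mult A n (E i) E j = E i j"
proof -
  assume i: "i < n" and j: "j < n"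
  interpret A: ring A using gr by (rule graded_ringD)
  have "row_mult A n (E i) E j = row_mult A n (\<lambda>k. c k (b i)) E j"
    using i j by (intro A.row_mult_cong) (auto simp: coord_basis E_closed)
  then show "row_mult A n (E i) E j = E i j"
    using coord_row[OF basis_closed[OF i] j] i j by (simp add: coord_basis)
qed

lemma coord_eqI:
  assumes "x \<in> carrier M" "y \<in> carrier M" "\<And>i. i < n \<Longrightarrow> c i x = c i y"
  shows "x = y"
proof -
  interpret M: abelian_group M by (rule left_moduleD[OF lmod])
  have "(\<Oplus>\<^bsub>M\<^esub>i\<in>{..<n}. c i x \<odot>\<^bsub>M\<^esub> b i) = (\<Oplus>\<^bsub>M\<^esub>i\<in>{..<n}. c i y \<odot>\<^bsub>M\<^esub> b i)"
    using assms by (intro M.finsum_cong') (auto intro!: left_moduleD(3)[OF lmod] coord_closed basis_closed)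
  then show ?thesis using assms by (simp add: expansion)
qed

end

text \<open>The linear map with matrix \<open>h\<close> in the row convention: coordinates times
  \<open>h\<close>, used as coefficients of the target generators.\<close>

definition basis_map ::
    "('a, 'z) ring_scheme \<Rightarrow> ('g, 'a, 'b) gmod \<Rightarrow> nat \<Rightarrow> nat \<Rightarrow> (nat \<Rightarrow> 'm \<Rightarrow> 'a) \<Rightarrow> (nat \<Rightarrow> nat \<Rightarrow> 'a) \<Rightarrow>
     (nat \<Rightarrow> 'b) \<Rightarrow> 'm \<Rightarrow> 'b" where
  "basis_map A N n m c h b' x = (\<Oplus>\<^bsub>N\<^esub>k\<in>{..<m}. row_mult A n (\<lambda>i. c i x) h k \<odot>\<^bsub>N\<^esub> b' k)"

lemma iso_matrices_sym: "iso_matrices A n m E F h h' \<Longrightarrow> iso_matrices A m n F E h' h"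
  by (auto simp: iso_matrices_def)

locale dual_basis_pair = P: graded_dual_basis A M n \<beta> E b c + Q: graded_dual_basis A N m \<gamma> F b' d
  for A :: "('g::ab_group_add, 'a, 'z) gring_scheme" and M :: "('g, 'a, 'p) gmod" and n \<beta> E b c
    and N :: "('g, 'a, 'q) gmod" and m \<gamma> F b' d
begin

sublocale A: ring A by (rule graded_ringD[OF P.gr])
sublocale M: abelian_group M by (rule left_moduleD[OF P.lmod])
sublocale N: abelian_group N by (rule left_moduleD[OF Q.lmod])

text \<open>The situation is symmetric, so all statements about the inverse direction are instances
  of those already shown.\<close>

lemma flip: "dual_basis_pair A N m \<gamma> F b' d M n \<beta> E b c"
  by unfold_locales

lemma linear_map_coord:
  assumes g: "g \<in> gmod_hom A M N" and x: "x \<in> carrier M" and k: "k < m"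
  shows "d k (g x) = row_mult A n (\<lambda>i. c i x) (\<lambda>i k. d k (g (b i))) k"
proof -
  have gh: "abelian_group_hom M N g"
    using g by (intro abelian_group_homI' M.abelian_group_axioms N.abelian_group_axioms) (auto simp: gmod_hom_def)
  interpret gh: abelian_group_hom M N g by (rule gh)
  interpret h: abelian_group_hom M A "\<lambda>x. d k (g x)"
    by (rule abelian_group_hom_compose[OF gh Q.coord_hom[OF k]])
  have gs: "g (a \<odot>\<^bsub>M\<^esub> y) = a \<odot>\<^bsub>N\<^esub> g y" if "a \<in> carrier A" "y \<in> carrier M" for a y
    using g that by (auto simp: gmod_hom_def)
  have "d k (g x) = d k (g (\<Oplus>\<^bsub>M\<^esub>i\<in>{..<n}. c i x \<odot>\<^bsub>M\<^esub> b i))" using P.expansion[OF x] by simp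
  also have "\<dots> = (\<Oplus>\<^bsub>A\<^esub>i\<in>{..<n}. d k (g (c i x \<odot>\<^bsub>M\<^esub> b i)))"
    using x by (intro h.hom_finsum) (auto intro!: left_moduleD(3)[OF P.lmod] P.coord_closed P.basis_closed)
  also have "\<dots> = row_mult A n (\<lambda>i. c i x) (\<lambda>i k. d k (g (b i))) k"
    unfolding row_mult_def using x k
    by (intro A.finsum_cong') (auto simp: gs Q.coord_smult P.coord_closed P.basis_closed gh.hom_closed Q.coord_closed)
  finally show ?thesis .
qed

text \<open>Row i of \<open>h\<close> is the coordinate row of g(b_i), so \<open>F\<close> fixes it
  from the right; \<open>Eh = h\<close> because row i of \<open>E\<close> is the coordinate row of
  b_i. Computing the coordinates of the inverse image of g(b_i) gives \<open>hh' = E\<close>, and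
  the other two relations follow symmetrically. The degrees come from g(b_i) having degree
  -\<beta>_i.\<close>

lemma iso_to_matrices:
  assumes g: "g \<in> gmod_iso A M N"
  defines "h \<equiv> \<lambda>i k. d k (g (b i))" and "h' \<equiv> \<lambda>k i. c i (inv_into (carrier M) g (b' k))"
  shows "iso_matrices A n m E F h h'"
    and "i < n \<Longrightarrow> k < m \<Longrightarrow> h i k \<in> grade A (\<gamma> k - \<beta> i)"
    and "i < n \<Longrightarrow> k < m \<Longrightarrow> h' k i \<in> grade A (\<beta> i - \<gamma> k)"
    and "inv_into (carrier M) g \<in> gmod_iso A N M"
proof -
  let ?g' = "inv_into (carrier M) g"
  have gh: "g \<in> gmod_hom A M N" and bij: "bij_betw g (carrier M) (carrier N)" and gg: "\<And>\<delta>. g ` mgrade M \<delta> = mgrade N \<delta>"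
    using g by (auto simp: gmod_iso_def)
  have g_cl: "g x \<in> carrier N" if "x \<in> carrier M" for x using gh that by (auto simp: gmod_hom_def)
  have g'_cl: "?g' y \<in> carrier M" if "y \<in> carrier N" for y
    using bij that by (metis bij_betw_imp_surj_on inv_into_into)
  have gg': "g (?g' y) = y" if "y \<in> carrier N" for y
    using bij that by (simp add: bij_betw_inv_into_right)
  have g'g: "?g' (g x) = x" if "x \<in> carrier M" for x
    using bij that by (simp add: bij_betw_inv_into_left)
  have g'I: "?g' y = x" if "x \<in> carrier M" "g x = y" for x y using g'g that by blast
  have g'_gr: "?g' ` mgrade N \<delta> = mgrade M \<delta>" for \<delta>
  proof -
    have "?g' ` g ` mgrade M \<delta> = mgrade M \<delta>"
      using g'g additive_subgroup.a_Hcarr[OF P.sub] by (force simp: image_image)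
    then show ?thesis unfolding gg .
  qed
  have g'h: "?g' \<in> gmod_hom A N M"
    unfolding gmod_hom_def
  proof (intro CollectI conjI ballI allI)
    show "?g' (x \<oplus>\<^bsub>N\<^esub> y) = ?g' x \<oplus>\<^bsub>M\<^esub> ?g' y" if "x \<in> carrier N" "y \<in> carrier N" for x y
      using gh that g'_cl gg' by (intro g'I) (auto simp: gmod_hom_def)
    show "?g' (a \<odot>\<^bsub>N\<^esub> x) = a \<odot>\<^bsub>M\<^esub> ?g' x" if "a \<in> carrier A" "x \<in> carrier N" for a x
      using gh that g'_cl gg' left_moduleD(3)[OF P.lmod] by (intro g'I) (auto simp: gmod_hom_def)
  qed (use g'_cl g'_gr in auto)
  then show "?g' \<in> gmod_iso A N M"
    using g'_gr bij_betw_inv_into[OF bij] by (simp add: gmod_iso_def)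
  interpret S: dual_basis_pair A N m \<gamma> F b' d M n \<beta> E b c by (rule flip)
  note bcl = P.basis_closed and b'cl = Q.basis_closed
  have h_cl: "h i k \<in> carrier A" if "i < n" "k < m" for i k
    unfolding h_def using that by (intro Q.coord_closed g_cl bcl)
  have h'_cl: "h' k i \<in> carrier A" if "i < n" "k < m" for i k
    unfolding h'_def using that by (intro P.coord_closed g'_cl b'cl)
  have hd: "d k (g (b i)) = h i k" and h'd: "c i (?g' (b' k)) = h' k i" for i k
    by (simp_all add: h_def h'_def)
  have Eh: "mat_mult A n E h i k = h i k" if "i < n" "k < m" for i k
  proof -
    have "mat_mult A n E h i k = row_mult A n (\<lambda>j. c j (b i)) h k"
      unfolding mat_mult_row using that by (intro A.row_mult_cong) (auto simp: P.coord_basis P.E_closed h_cl)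
    then show ?thesis
      using linear_map_coord[OF gh bcl[OF that(1)] that(2)] by (simp add: h_def)
  qed
  have Fh': "mat_mult A m F h' k i = h' k i" if "i < n" "k < m" for i k
  proof -
    have "mat_mult A m F h' k i = row_mult A m (\<lambda>j. d j (b' k)) h' i"
      unfolding mat_mult_row using that by (intro A.row_mult_cong) (auto simp: Q.coord_basis Q.E_closed h'_cl)
    then show ?thesis
      using S.linear_map_coord[OF g'h b'cl[OF that(2)] that(1)] by (simp add: h'_def)
  qed
  show "iso_matrices A n m E F h h'"
    unfolding iso_matrices_def
  proof (intro conjI allI impI)
    fix i j assume ij: "i < n" "j < m"
    have "mat_mult A m (mat_mult A n E h) F i j = row_mult A m (\<lambda>k. d k (g (b i))) F j"
      unfolding mat_mult_row[of A m] using ij h_cl by (intro A.row_mult_cong) (auto simp: Eh Q.E_closed hd)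
    then show "mat_mult A m (mat_mult A n E h) F i j = h i j"
      using ij Q.coord_row[OF g_cl[OF bcl]] by (simp add: h_def)
  next
    fix i j assume ij: "i < m" "j < n"
    have "mat_mult A n (mat_mult A m F h') E i j = row_mult A n (\<lambda>k. c k (?g' (b' i))) E j"
      unfolding mat_mult_row[of A n] using ij h'_cl by (intro A.row_mult_cong) (auto simp: Fh' P.E_closed h'd)
    then show "mat_mult A n (mat_mult A m F h') E i j = h' i j"
      using ij P.coord_row[OF g'_cl[OF b'cl]] by (simp add: h'_def)
  next
    fix i j assume ij: "i < n" "j < n"
    show "mat_mult A m h h' i j = E i j"
      using S.linear_map_coord[OF g'h g_cl[OF bcl[OF ij(1)]] ij(2)] ij
      by (simp add: mat_mult_row h_def h'_def g'g bcl P.coord_basis)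
  next
    fix i j assume ij: "i < m" "j < m"
    show "mat_mult A n h' h i j = F i j"
      using linear_map_coord[OF gh g'_cl[OF b'cl[OF ij(1)]] ij(2)] ij
      by (simp add: mat_mult_row h_def h'_def gg' b'cl Q.coord_basis)
  qed
  show "h i k \<in> grade A (\<gamma> k - \<beta> i)" if "i < n" "k < m"
  proof -
    have "g (b i) \<in> mgrade N (- \<beta> i)" using gg P.basis[OF that(1)] by blast
    then show ?thesis using Q.coord_grade[OF that(2)] by (force simp: h_def)
  qed
  show "h' k i \<in> grade A (\<beta> i - \<gamma> k)" if "i < n" "k < m"
  proof -
    have "?g' (b' k) \<in> mgrade M (- \<gamma> k)" using g'_gr Q.basis[OF that(2)] by blast
    then show ?thesis using P.coord_grade[OF that(1)] by (force simp: h'_def)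
  qed
qed

section \<open>From matrices back to isomorphisms\<close>

context
  fixes h :: "nat \<Rightarrow> nat \<Rightarrow> 'a" and h' :: "nat \<Rightarrow> nat \<Rightarrow> 'a"
  assumes iso: "iso_matrices A n m E F h h'"
    and h_grade: "\<And>i k. i < n \<Longrightarrow> k < m \<Longrightarrow> h i k \<in> grade A (\<gamma> k - \<beta> i)"
    and h'_grade: "\<And>i k. i < n \<Longrightarrow> k < m \<Longrightarrow> h' k i \<in> grade A (\<beta> i - \<gamma> k)"
begin

lemma h_closed: "i < n \<Longrightarrow> k < m \<Longrightarrow> h i k \<in> carrier A" "i < n \<Longrightarrow> k < m \<Longrightarrow> h' k i \<in> carrier A"
  using h_grade h'_grade graded_ringD(3)[OF P.gr] by blast+

text \<open>Multiply \<open>EhF = h\<close> by \<open>F\<close> on the right and use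
  \<open>FF = F\<close>.\<close>

lemma h_F: "i < n \<Longrightarrow> k < m \<Longrightarrow> row_mult A m (h i) F k = h i k"
proof -
  assume i: "i < n" and k: "k < m"
  have EhF: "row_mult A m (mat_mult A n E h i) F k = h i k" if "k < m" for k
    using iso i that by (simp add: iso_matrices_def mat_mult_row[of A m])
  have Eh: "mat_mult A n E h i t \<in> carrier A" if "t < m" for t
    using i that by (intro A.mat_mult_closed P.E_closed h_closed)
  have "row_mult A m (h i) F k = row_mult A m (row_mult A m (mat_mult A n E h i) F) F k"
    using i k by (intro A.row_mult_cong A.row_mult_closed) (auto simp: EhF h_closed Eh Q.E_closed)
  also have "\<dots> = row_mult A m (mat_mult A n E h i) (mat_mult A m F F) k"
    using k by (intro A.row_mult_assoc) (auto simp: Eh Q.E_closed)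
  also have "\<dots> = row_mult A m (mat_mult A n E h i) F k"
    using k by (intro A.row_mult_cong) (auto simp: Eh[unfolded mat_mult_row] Q.E_closed mat_mult_row Q.E_idem)
  finally show ?thesis using EhF[OF k] by simp
qed

text \<open>\<open>Eh = (hh\<^sup>*)h = h(h\<^sup>*h) = hF = h\<close>\<close>

lemma E_h: "i < n \<Longrightarrow> k < m \<Longrightarrow> row_mult A n (E i) h k = h i k"
proof -
  assume i: "i < n" and k: "k < m"
  have "row_mult A n (E i) h k = row_mult A n (row_mult A m (h i) h') h k"
    using i k iso by (intro A.row_mult_cong) (auto simp: iso_matrices_def mat_mult_row h_closed P.E_closed intro!: A.row_mult_closed)
  also have "\<dots> = row_mult A m (h i) (mat_mult A n h' h) k"
    using i k by (intro A.row_mult_assoc) (auto simp: h_closed)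
  also have "\<dots> = row_mult A m (h i) F k"
    using i k iso by (intro A.row_mult_cong) (auto simp: iso_matrices_def h_closed Q.E_closed)
  finally show ?thesis using h_F[OF i k] by simp
qed

lemma row_closed: "x \<in> carrier M \<Longrightarrow> k < m \<Longrightarrow> row_mult A n (\<lambda>i. c i x) h k \<in> carrier A"
  by (intro A.row_mult_closed P.coord_closed h_closed)

lemma basis_map_closed: "x \<in> carrier M \<Longrightarrow> basis_map A N n m c h b' x \<in> carrier N"
  unfolding basis_map_def
  by (auto intro!: N.finsum_closed left_moduleD(3)[OF Q.lmod] row_closed Q.basis_closed)

text \<open>The target generators may be dependent, so a combination with coefficients w has
  coordinates wF rather than w. For w a multiple of \<open>h\<close> the factor \<open>F\<close> is
  absorbed, as \<open>hF = h\<close>.\<close>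

lemma basis_map_coord:
  assumes x: "x \<in> carrier M" and k: "k < m"
  shows "d k (basis_map A N n m c h b' x) = row_mult A n (\<lambda>i. c i x) h k"
proof -
  let ?w = "row_mult A n (\<lambda>i. c i x) h"
  have "d k (basis_map A N n m c h b' x) = (\<Oplus>\<^bsub>A\<^esub>l\<in>{..<m}. d k (?w l \<odot>\<^bsub>N\<^esub> b' l))"
    unfolding basis_map_def using x
    by (intro abelian_group_hom.hom_finsum[OF Q.coord_hom[OF k]])
       (auto intro!: left_moduleD(3)[OF Q.lmod] row_closed Q.basis_closed)
  also have "\<dots> = row_mult A m ?w F k"
    unfolding row_mult_def[of A m] using x k
    by (intro A.finsum_cong') (auto simp: Q.coord_smult row_closed Q.basis_closed Q.coord_basis Q.E_closed)
  also have "\<dots> = row_mult A n (\<lambda>i. c i x) (mat_mult A m h F) k"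
    using x k by (intro A.row_mult_assoc) (auto simp: P.coord_closed h_closed Q.E_closed)
  also have "\<dots> = ?w k"
    using x k by (intro A.row_mult_cong) (auto simp: P.coord_closed h_closed mat_mult_row h_F)
  finally show ?thesis .
qed

lemma basis_map_basis: "i < n \<Longrightarrow> k < m \<Longrightarrow> d k (basis_map A N n m c h b' (b i)) = h i k"
proof -
  assume i: "i < n" and k: "k < m"
  have "row_mult A n (\<lambda>j. c j (b i)) h k = row_mult A n (E i) h k"
    using i k by (intro A.row_mult_cong) (auto simp: P.coord_basis P.E_closed h_closed)
  then show ?thesis using basis_map_coord[OF P.basis_closed[OF i] k] E_h[OF i k] by simp
qed

text \<open>Coordinates separate points of the target, and the coordinates of the image are a matrix
  product, visibly linear in the argument.\<close>

lemma basis_map_hom: "basis_map A N n m c h b' \<in> gmod_hom A M N"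
  unfolding gmod_hom_def
proof (intro CollectI conjI ballI allI subsetI funcsetI)
  show "basis_map A N n m c h b' x \<in> carrier N" if "x \<in> carrier M" for x
    using that by (rule basis_map_closed)
  show "basis_map A N n m c h b' (x \<oplus>\<^bsub>M\<^esub> y) = basis_map A N n m c h b' x \<oplus>\<^bsub>N\<^esub> basis_map A N n m c h b' y"
    if xy: "x \<in> carrier M" "y \<in> carrier M" for x y
  proof (rule Q.coord_eqI)
    fix k assume k: "k < m"
    have "row_mult A n (\<lambda>i. c i (x \<oplus>\<^bsub>M\<^esub> y)) h k = (\<Oplus>\<^bsub>A\<^esub>i\<in>{..<n}. c i x \<otimes>\<^bsub>A\<^esub> h i k \<oplus>\<^bsub>A\<^esub> c i y \<otimes>\<^bsub>A\<^esub> h i k)"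
      unfolding row_mult_def using xy k abelian_group_hom.hom_add[OF P.coord_hom]
      by (intro A.finsum_cong') (auto simp: P.coord_closed h_closed A.l_distr)
    also have "\<dots> = row_mult A n (\<lambda>i. c i x) h k \<oplus>\<^bsub>A\<^esub> row_mult A n (\<lambda>i. c i y) h k"
      unfolding row_mult_def using xy k by (intro A.finsum_addf) (auto simp: P.coord_closed h_closed)
    finally show "d k (basis_map A N n m c h b' (x \<oplus>\<^bsub>M\<^esub> y)) = d k (basis_map A N n m c h b' x \<oplus>\<^bsub>N\<^esub> basis_map A N n m c h b' y)"
      using xy k abelian_group_hom.hom_add[OF Q.coord_hom[OF k]] by (simp add: basis_map_coord basis_map_closed)
  qed (use xy basis_map_closed in auto)
  show "basis_map A N n m c h b' (a \<odot>\<^bsub>M\<^esub> x) = a \<odot>\<^bsub>N\<^esub> basis_map A N n m c h b' x"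
    if ax: "a \<in> carrier A" "x \<in> carrier M" for a x
  proof (rule Q.coord_eqI)
    fix k assume k: "k < m"
    have "row_mult A n (\<lambda>i. c i (a \<odot>\<^bsub>M\<^esub> x)) h k = (\<Oplus>\<^bsub>A\<^esub>i\<in>{..<n}. a \<otimes>\<^bsub>A\<^esub> (c i x \<otimes>\<^bsub>A\<^esub> h i k))"
      unfolding row_mult_def using ax k
      by (intro A.finsum_cong') (auto simp: P.coord_smult P.coord_closed h_closed A.m_assoc)
    also have "\<dots> = a \<otimes>\<^bsub>A\<^esub> row_mult A n (\<lambda>i. c i x) h k"
      unfolding row_mult_def using ax k by (intro A.finsum_rdistr[symmetric]) (auto simp: P.coord_closed h_closed)
    finally show "d k (basis_map A N n m c h b' (a \<odot>\<^bsub>M\<^esub> x)) = d k (a \<odot>\<^bsub>N\<^esub> basis_map A N n m c h b' x)"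
      using ax k left_moduleD(3)[OF P.lmod] by (simp add: basis_map_coord basis_map_closed Q.coord_smult)
  qed (use ax basis_map_closed left_moduleD(3)[OF P.lmod] left_moduleD(3)[OF Q.lmod] in auto)
  fix \<delta> y assume "y \<in> basis_map A N n m c h b' ` mgrade M \<delta>"
  then obtain x where x: "x \<in> mgrade M \<delta>" "y = basis_map A N n m c h b' x" by blast
  \<comment> \<open>The shifts cancel twice: \<beta>_i between the coordinate and the entry of
    \<open>h\<close>, and then \<gamma>_k between the coefficient and the generator of degree
    -\<gamma>_k.\<close>
  have "row_mult A n (\<lambda>i. c i x) h k \<odot>\<^bsub>N\<^esub> b' k \<in> mgrade N \<delta>" if k: "k < m" for k
  proof -
    have "c i x \<otimes>\<^bsub>A\<^esub> h i k \<in> grade A (\<gamma> k + \<delta>)" if "i < n" for i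
      using graded_ringD(4)[OF P.gr P.coord_grade[OF that x(1)] h_grade[OF that k]] by (simp add: algebra_simps)
    then have "row_mult A n (\<lambda>i. c i x) h k \<in> grade A (\<gamma> k + \<delta>)"
      unfolding row_mult_def
      by (intro additive_subgroup.finsum_in[OF graded_ringD(2)[OF P.gr]] A.is_abelian_group) auto
    from Q.smult_grade[OF this Q.basis[OF k]] show ?thesis by (simp add: algebra_simps)
  qed
  then show "y \<in> mgrade N \<delta>"
    unfolding x(2) basis_map_def
    by (intro additive_subgroup.finsum_in[OF Q.sub] N.abelian_group_axioms) auto
qed

end

text \<open>In coordinates the composite multiplies the row of x by \<open>hh' = E\<close>, and
  \<open>E\<close> fixes rows of coordinates.\<close>

lemma basis_map_inverse:
  assumes iso: "iso_matrices A n m E F h h'"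
    and h: "\<And>i k. i < n \<Longrightarrow> k < m \<Longrightarrow> h i k \<in> grade A (\<gamma> k - \<beta> i)"
    and h': "\<And>i k. i < n \<Longrightarrow> k < m \<Longrightarrow> h' k i \<in> grade A (\<beta> i - \<gamma> k)"
    and x: "x \<in> carrier M"
  shows "basis_map A M m n d h' b (basis_map A N n m c h b' x) = x"
proof -
  interpret S: dual_basis_pair A N m \<gamma> F b' d M n \<beta> E b c by (rule flip)
  note hc = h_closed[OF iso h h']
  let ?y = "basis_map A N n m c h b' x"
  have y: "?y \<in> carrier N" by (rule basis_map_closed[OF iso h h' x])
  show ?thesis
  proof (rule P.coord_eqI[OF S.basis_map_closed[OF iso_matrices_sym[OF iso] h' h y] x])
    fix i assume i: "i < n"
    have "c i (basis_map A M m n d h' b ?y) = row_mult A m (\<lambda>k. d k ?y) h' i"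
      by (rule S.basis_map_coord[OF iso_matrices_sym[OF iso] h' h y i])
    also have "\<dots> = row_mult A m (row_mult A n (\<lambda>i. c i x) h) h' i"
      using i x by (intro A.row_mult_cong) (auto simp: basis_map_coord[OF iso h h'] hc intro!: A.row_mult_closed P.coord_closed)
    also have "\<dots> = row_mult A n (\<lambda>i. c i x) (mat_mult A m h h') i"
      using i x by (intro A.row_mult_assoc) (auto simp: hc P.coord_closed)
    also have "\<dots> = row_mult A n (\<lambda>i. c i x) E i"
      using i x iso by (intro A.row_mult_cong) (auto simp: iso_matrices_def P.E_closed P.coord_closed)
    also have "\<dots> = c i x" by (rule P.coord_row[OF x i])
    finally show "c i (basis_map A M m n d h' b ?y) = c i x" .
  qed
qed

text \<open>The reversed relations make the map with matrix \<open>h'\<close> a two-sided inverse.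
  The second claim says that \<open>h'\<close> is also recovered from the inverse as its matrix,
  which ties the starred symbols to the inverse of the universal isomorphism.\<close>

lemma basis_map_iso:
  assumes iso: "iso_matrices A n m E F h h'"
    and h: "\<And>i k. i < n \<Longrightarrow> k < m \<Longrightarrow> h i k \<in> grade A (\<gamma> k - \<beta> i)"
    and h': "\<And>i k. i < n \<Longrightarrow> k < m \<Longrightarrow> h' k i \<in> grade A (\<beta> i - \<gamma> k)"
  shows "basis_map A N n m c h b' \<in> gmod_iso A M N"
    and "i < n \<Longrightarrow> k < m \<Longrightarrow> c i (inv_into (carrier M) (basis_map A N n m c h b') (b' k)) = h' k i"
proof -
  interpret S: dual_basis_pair A N m \<gamma> F b' d M n \<beta> E b c by (rule flip)
  let ?g = "basis_map A N n m c h b'" and ?g' = "basis_map A M m n d h' b"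
  note g = basis_map_hom[OF iso h h'] and g' = S.basis_map_hom[OF iso_matrices_sym[OF iso] h' h]
  have g'g: "\<And>x. x \<in> carrier M \<Longrightarrow> ?g' (?g x) = x" by (rule basis_map_inverse[OF iso h h'])
  have gg': "\<And>y. y \<in> carrier N \<Longrightarrow> ?g (?g' y) = y" by (rule S.basis_map_inverse[OF iso_matrices_sym[OF iso] h' h])
  have cl: "?g \<in> carrier M \<rightarrow> carrier N" "?g' \<in> carrier N \<rightarrow> carrier M"
    using g g' by (auto simp: gmod_hom_def)
  have bij: "bij_betw ?g (carrier M) (carrier N)"
    by (rule bij_betw_byWitness[where f' = ?g']) (use g'g gg' cl in auto)
  have gr: "?g ` mgrade M \<delta> \<subseteq> mgrade N \<delta>" "?g' ` mgrade N \<delta> \<subseteq> mgrade M \<delta>" for \<delta>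
    using g g' by (auto simp: gmod_hom_def)
  have "mgrade N \<delta> \<subseteq> ?g ` mgrade M \<delta>" for \<delta>
  proof
    fix y assume y: "y \<in> mgrade N \<delta>"
    then have "?g' y \<in> mgrade M \<delta>" using gr(2)[of \<delta>] by blast
    moreover have "y = ?g (?g' y)" using y gg' additive_subgroup.a_Hcarr[OF Q.sub] by simp
    ultimately show "y \<in> ?g ` mgrade M \<delta>" by blast
  qed
  then show "?g \<in> gmod_iso A M N"
    using g bij gr by (simp add: gmod_iso_def subset_antisym)
  show "c i (inv_into (carrier M) ?g (b' k)) = h' k i" if "i < n" "k < m"
  proof -
    have "inv_into (carrier M) ?g (b' k) = ?g' (b' k)"
      using bij cl gg' Q.basis_closed[OF that(2)] by (intro inv_into_f_eq) (auto simp: bij_betw_def)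
    then show ?thesis using S.basis_map_basis[OF iso_matrices_sym[OF iso] h' h] that by simp
  qed
qed

end

section \<open>The universal property\<close>

lemma gmod_isoD:
  assumes "g \<in> gmod_iso A M N"
  shows "g \<in> gmod_hom A M N" "x \<in> carrier M \<Longrightarrow> g x \<in> carrier N"
    "y \<in> carrier N \<Longrightarrow> inv_into (carrier M) g y \<in> carrier M" "y \<in> carrier N \<Longrightarrow> g (inv_into (carrier M) g y) = y"
    "x \<in> carrier M \<Longrightarrow> inv_into (carrier M) g (g x) = x"
proof -
  have bij: "bij_betw g (carrier M) (carrier N)" using assms by (simp add: gmod_iso_def)
  then have im: "g ` carrier M = carrier N" and inj: "inj_on g (carrier M)" by (auto simp: bij_betw_def)
  show "g \<in> gmod_hom A M N" using assms by (simp add: gmod_iso_def)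
  show "g x \<in> carrier N" if "x \<in> carrier M" using im that by blast
  show "inv_into (carrier M) g y \<in> carrier M" if "y \<in> carrier N" using that unfolding im[symmetric] by (rule inv_into_into)
  show "g (inv_into (carrier M) g y) = y" if "y \<in> carrier N" using that unfolding im[symmetric] by (rule f_inv_into_f)
  show "inv_into (carrier M) g (g x) = x" if "x \<in> carrier M" using inj that by (rule inv_into_f_f)
qed

lemma grring_homD:
  assumes "\<phi> \<in> grring_hom K R S T"
  shows "\<phi> \<in> galg_hom K S T" "\<phi> \<in> gring_hom S T" "\<phi> \<in> ring_hom S T"
    "r \<in> carrier R \<Longrightarrow> \<phi> (rmap S r) = rmap T r" "x \<in> grade S \<delta> \<Longrightarrow> \<phi> x \<in> grade T \<delta>"
  using assms by (auto simp: grring_hom_def galg_hom_def gring_hom_def)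

lemma grring_hom_compose:
  assumes "\<phi> \<in> grring_hom K R S T" "\<psi> \<in> grring_hom K R T U"
  shows "(\<lambda>x. \<psi> (\<phi> x)) \<in> grring_hom K R S U"
proof -
  have "\<psi> (\<phi> x) \<in> grade U \<delta>" if "x \<in> grade S \<delta>" for x \<delta>
    using grring_homD(5)[OF assms(2) grring_homD(5)[OF assms(1) that]] .
  then show ?thesis
    using ring_hom_compose[OF grring_homD(3)[OF assms(1)] grring_homD(3)[OF assms(2)]] assms
    by (simp add: grring_hom_def galg_hom_def gring_hom_def image_subset_iff)
qed

lemma grring_hom_id: "(\<lambda>x. x) \<in> grring_hom K R S S"
  by (auto simp: grring_hom_def galg_hom_def gring_hom_def ring_hom_def)

lemma grring_hom_scalar_map:
  assumes "left_module R M" "graded_rring K R S" "graded_rring K R T" "\<phi> \<in> grring_hom K R S T"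
  shows "scalar_map R S T M \<phi>"
proof -
  note h = grring_homD[OF assms(4)]
  have "scalar_map_axioms R S T \<phi>"
  proof
    fix s r assume "s \<in> carrier S" "r \<in> carrier R"
    then show "\<phi> (s \<otimes>\<^bsub>S\<^esub> rmap S r) = \<phi> s \<otimes>\<^bsub>T\<^esub> rmap T r"
      using ring_hom_closed[OF graded_rringD(4)[OF assms(2)]] by (simp add: ring_hom_mult[OF h(3)] h(4))
  qed (use h(3) in \<open>auto simp: ring_hom_def\<close>)
  then show ?thesis
    using assms by (intro scalar_map.intro scalar_extensionI)
qed

lemma tensor_map_compose:
  assumes "left_module R M" "graded_rring K R S" "graded_rring K R T" "graded_rring K R U"
    "\<phi> \<in> grring_hom K R S T" "\<psi> \<in> grring_hom K R T U" "X \<in> carrier (tensor R S M)"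
  shows "tensor_map R U M (\<lambda>x. \<psi> (\<phi> x)) X = tensor_map R U M \<psi> (tensor_map R T M \<phi> X)"
proof -
  interpret m1: scalar_map R S T M \<phi> by (rule grring_hom_scalar_map[OF assms(1-3,5)])
  interpret m2: scalar_map R T U M \<psi> by (rule grring_hom_scalar_map[OF assms(1,3,4,6)])
  interpret m3: scalar_map R S U M "\<lambda>x. \<psi> (\<phi> x)"
    by (rule grring_hom_scalar_map[OF assms(1,2,4) grring_hom_compose[OF assms(5,6)]])
  show ?thesis
    by (rule m1.S.tensor_hom_eqI[OF m3.tensor_map_hom abelian_group_hom_compose[OF m1.tensor_map_hom m2.tensor_map_hom] _ assms(7)])
       (simp add: m1.tensor_map_te m2.tensor_map_te m3.tensor_map_te)
qed

lemma tensor_map_id: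
  assumes "left_module R M" "graded_rring K R S" "X \<in> carrier (tensor R S M)"
  shows "tensor_map R S M (\<lambda>x. x) X = X"
proof -
  interpret scalar_map R S S M "\<lambda>x. x"
    by (rule grring_hom_scalar_map[OF assms(1,2,2) grring_hom_id])
  have "abelian_group_hom S.TM S.TM (\<lambda>x. x)" by (intro abelian_group_homI' S.abelian_group_tensor) auto
  then show ?thesis
    by (rule S.tensor_hom_eqI[OF tensor_map_hom _ _ assms(3)]) (simp add: tensor_map_te)
qed

lemma carries_compose:
  assumes lP: "left_module R P" and lQ: "left_module R Q"
    and S: "graded_rring K R S" and T: "graded_rring K R T" and U: "graded_rring K R U"
    and \<phi>: "\<phi> \<in> grring_hom K R S T" and \<psi>: "\<psi> \<in> grring_hom K R T U"
    and u: "u \<in> gmod_iso S (tensor R S P) (tensor R S Q)"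
    and 1: "carries R P Q S T \<phi> u v" and 2: "carries R P Q T U \<psi> v w"
  shows "carries R P Q S U (\<lambda>x. \<psi> (\<phi> x)) u w"
  unfolding carries_def
proof
  fix X assume X: "X \<in> carrier (tensor R S P)"
  have uX: "u X \<in> carrier (tensor R S Q)" using u X by (auto simp: gmod_iso_def gmod_hom_def)
  interpret p: scalar_map R S T P \<phi> using lP S T \<phi> by (rule grring_hom_scalar_map)
  have "tensor_map R T P \<phi> X \<in> carrier (tensor R T P)"
    using X by (rule abelian_group_hom.hom_closed[OF p.tensor_map_hom])
  then show "w (tensor_map R U P (\<lambda>x. \<psi> (\<phi> x)) X) = tensor_map R U Q (\<lambda>x. \<psi> (\<phi> x)) (u X)"
    using 1 2 X by (simp add: tensor_map_compose[OF lP S T U \<phi> \<psi>] tensor_map_compose[OF lQ S T U \<phi> \<psi> uX] carries_def)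
qed

lemma carries_id:
  assumes "left_module R P" "left_module R Q" "graded_rring K R S" "u \<in> gmod_iso S (tensor R S P) (tensor R S Q)"
  shows "carries R P Q S S (\<lambda>x. x) u u"
proof -
  have "u X \<in> carrier (tensor R S Q)" if "X \<in> carrier (tensor R S P)" for X
    using assms(4) that by (auto simp: gmod_iso_def gmod_hom_def)
  then show ?thesis
    unfolding carries_def by (simp add: tensor_map_id[OF assms(1,3)] tensor_map_id[OF assms(2,3)])
qed

context scalar_map
begin

text \<open>Induced coordinates are natural in the ring: both sides send a pure tensor of s and x to
  \<open>a s\<close> times the image of \<open>c x\<close>.\<close>

lemma tensor_map_coord:
  assumes a: "a \<in> ring_hom S T" and a_rmap: "\<And>r. r \<in> carrier R \<Longrightarrow> a (rmap S r) = rmap T r"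
    and c: "abelian_group_hom M R c" and lin: "\<And>r x. r \<in> carrier R \<Longrightarrow> x \<in> carrier M \<Longrightarrow> c (r \<odot>\<^bsub>M\<^esub> x) = r \<otimes>\<^bsub>R\<^esub> c x"
    and X: "X \<in> carrier S.TM"
  shows "tensor_coord R T M c (tensor_map R T M a X) = a (tensor_coord R S M c X)"
proof (rule S.tensor_hom_eqI[OF _ _ _ X])
  note cS = S.tensor_coord[OF c lin] and cT = T.tensor_coord[OF c lin]
  show "abelian_group_hom S.TM T (\<lambda>X. tensor_coord R T M c (tensor_map R T M a X))"
    by (rule abelian_group_hom_compose[OF tensor_map_hom cT(1)])
  show "abelian_group_hom S.TM T (\<lambda>X. a (tensor_coord R S M c X))"
    by (rule abelian_group_hom_compose[OF cS(1) ring_hom_imp_abelian_group_hom[OF S.ring_T T.ring_T a]])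
  fix s x assume sx: "s \<in> carrier S" "x \<in> carrier M"
  then have "c x \<in> carrier R" using abelian_group_hom.hom_closed[OF c] by blast
  then show "tensor_coord R T M c (tensor_map R T M a (S.te s x)) = a (tensor_coord R S M c (S.te s x))"
    using sx ring_hom_closed[OF S.rmap_hom]
    by (simp add: tensor_map_te cS(2) cT(2) a_closed ring_hom_mult[OF a] a_rmap)
qed

end

locale iso_setup = P: graded_dual_basis R P n \<beta> e p c + Q: graded_dual_basis R Q m \<gamma> f q d
  for R :: "('g::ab_group_add, 'k, 'r) galg" and P :: "('g, 'r, 'p) gmod" and n \<beta> e p c
    and Q :: "('g, 'r, 'q) gmod" and m \<gamma> f q d +
  fixes K :: "('g, 'k) gring"
  assumes K: "graded_ring K" and R: "graded_algebra K R"
begin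

lemma pair:
  assumes "graded_rring K R T"
  shows "dual_basis_pair T (tensor R T P) n \<beta> (\<lambda>i j. rmap T (e i j)) (\<lambda>i. tensor_elem R T P \<one>\<^bsub>T\<^esub> (p i))
    (\<lambda>i. tensor_coord R T P (c i)) (tensor R T Q) m \<gamma> (\<lambda>k l. rmap T (f k l))
    (\<lambda>k. tensor_elem R T Q \<one>\<^bsub>T\<^esub> (q k)) (\<lambda>k. tensor_coord R T Q (d k))"
  by (intro dual_basis_pair.intro tensor_dual_basis[OF _ assms]
      P.graded_dual_basis_axioms Q.graded_dual_basis_axioms)

text \<open>The matrix of \<open>g\<close> with respect to the induced dual bases;
  \<open>hmat'\<close> is that of its inverse.\<close>

definition hmat :: "('g, 'k, 'r, 't) grring \<Rightarrow> (('t \<times> 'p \<Rightarrow>\<^sub>0 int) set \<Rightarrow> ('t \<times> 'q \<Rightarrow>\<^sub>0 int) set) \<Rightarrow> nat \<Rightarrow> nat \<Rightarrow> 't" where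
  "hmat T g i k = tensor_coord R T Q (d k) (g (tensor_elem R T P \<one>\<^bsub>T\<^esub> (p i)))"

definition hmat' :: "('g, 'k, 'r, 't) grring \<Rightarrow> (('t \<times> 'p \<Rightarrow>\<^sub>0 int) set \<Rightarrow> ('t \<times> 'q \<Rightarrow>\<^sub>0 int) set) \<Rightarrow> nat \<Rightarrow> nat \<Rightarrow> 't" where
  "hmat' T g k i = tensor_coord R T P (c i) (inv_into (carrier (tensor R T P)) g (tensor_elem R T Q \<one>\<^bsub>T\<^esub> (q k)))"

lemma tensor_map_one:
  assumes S: "graded_rring K R S" and T: "graded_rring K R T" and \<phi>: "\<phi> \<in> grring_hom K R S T"
  shows "tensor_map R T P \<phi> (tensor_elem R S P \<one>\<^bsub>S\<^esub> x) = tensor_elem R T P \<one>\<^bsub>T\<^esub> x"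
    "tensor_map R T Q \<phi> (tensor_elem R S Q \<one>\<^bsub>S\<^esub> y) = tensor_elem R T Q \<one>\<^bsub>T\<^esub> y"
  using scalar_map.tensor_map_te[OF grring_hom_scalar_map[OF P.lmod S T \<phi>]]
    scalar_map.tensor_map_te[OF grring_hom_scalar_map[OF Q.lmod S T \<phi>]] ring_hom_one[OF grring_homD(3)[OF \<phi>]]
  by simp_all

lemma coord_map:
  assumes S: "graded_rring K R S" and T: "graded_rring K R T" and \<phi>: "\<phi> \<in> grring_hom K R S T"
  shows "i < n \<Longrightarrow> X \<in> carrier (tensor R S P) \<Longrightarrow> tensor_coord R T P (c i) (tensor_map R T P \<phi> X) = \<phi> (tensor_coord R S P (c i) X)"
    "k < m \<Longrightarrow> Y \<in> carrier (tensor R S Q) \<Longrightarrow> tensor_coord R T Q (d k) (tensor_map R T Q \<phi> Y) = \<phi> (tensor_coord R S Q (d k) Y)"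
  by (rule scalar_map.tensor_map_coord[OF grring_hom_scalar_map[OF P.lmod S T \<phi>] grring_homD(3)[OF \<phi>] grring_homD(4)[OF \<phi>]
        P.coord_hom P.coord_smult]; assumption)
     (rule scalar_map.tensor_map_coord[OF grring_hom_scalar_map[OF Q.lmod S T \<phi>] grring_homD(3)[OF \<phi>] grring_homD(4)[OF \<phi>]
        Q.coord_hom Q.coord_smult]; assumption)

text \<open>Generators and coordinates over \<open>S\<close> are sent to those over
  \<open>T\<close>, so the commuting square, evaluated on generators, compares matrix entries. This
  is the source of uniqueness in the universal property.\<close>

lemma carries_imp_matrices:
  assumes S: "graded_rring K R S" and T: "graded_rring K R T" and \<phi>: "\<phi> \<in> grring_hom K R S T"
    and u: "u \<in> gmod_iso S (tensor R S P) (tensor R S Q)" and g: "g \<in> gmod_iso T (tensor R T P) (tensor R T Q)"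
    and carr: "carries R P Q S T \<phi> u g" and ik: "i < n" "k < m"
  shows "\<phi> (hmat S u i k) = hmat T g i k" "\<phi> (hmat' S u k i) = hmat' T g k i"
proof -
  interpret S: dual_basis_pair S "tensor R S P" n \<beta> "\<lambda>i j. rmap S (e i j)" "\<lambda>i. tensor_elem R S P \<one>\<^bsub>S\<^esub> (p i)"
    "\<lambda>i. tensor_coord R S P (c i)" "tensor R S Q" m \<gamma> "\<lambda>k l. rmap S (f k l)"
    "\<lambda>k. tensor_elem R S Q \<one>\<^bsub>S\<^esub> (q k)" "\<lambda>k. tensor_coord R S Q (d k)" using S by (rule pair)
  note one = tensor_map_one[OF S T \<phi>] and cm = coord_map[OF S T \<phi>]
  note bP = S.P.basis_closed[OF ik(1)] and bQ = S.Q.basis_closed[OF ik(2)]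
  have "\<phi> (hmat S u i k) = tensor_coord R T Q (d k) (tensor_map R T Q \<phi> (u (tensor_elem R S P \<one>\<^bsub>S\<^esub> (p i))))"
    using cm(2)[OF ik(2) gmod_isoD(2)[OF u bP]] by (simp add: hmat_def)
  also have "\<dots> = hmat T g i k"
    using carr bP by (simp add: carries_def hmat_def one[symmetric])
  finally show "\<phi> (hmat S u i k) = hmat T g i k" .
  \<comment> \<open>The square at \<open>?Y\<close> shows that the image of \<open>?Y\<close> is the
    preimage under \<open>g\<close> of the generator over \<open>T\<close>. The inverses are
    therefore carried along, although \<open>carries\<close> does not mention them.\<close>
  let ?Y = "inv_into (carrier (tensor R S P)) u (tensor_elem R S Q \<one>\<^bsub>S\<^esub> (q k))"
  have Y: "?Y \<in> carrier (tensor R S P)" "u ?Y = tensor_elem R S Q \<one>\<^bsub>S\<^esub> (q k)"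
    using gmod_isoD[OF u] bQ by auto
  interpret pm: scalar_map R S T P \<phi> by (rule grring_hom_scalar_map[OF P.lmod S T \<phi>])
  have mc: "tensor_map R T P \<phi> ?Y \<in> carrier (tensor R T P)"
    by (rule abelian_group_hom.hom_closed[OF pm.tensor_map_hom Y(1)])
  have "g (tensor_map R T P \<phi> ?Y) = tensor_elem R T Q \<one>\<^bsub>T\<^esub> (q k)"
    using carr Y by (simp add: carries_def one)
  then have "inv_into (carrier (tensor R T P)) g (tensor_elem R T Q \<one>\<^bsub>T\<^esub> (q k)) = tensor_map R T P \<phi> ?Y"
    using gmod_isoD(5)[OF g mc] by simp
  then show "\<phi> (hmat' S u k i) = hmat' T g k i"
    using cm(1)[OF ik(1) Y(1)] by (simp add: hmat'_def)
qed

text \<open>Both legs of the square have coordinates computed by the matrix of \<open>u\<close>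
  pushed along \<phi>, and coordinates separate points. This is the source of existence in the
  universal property.\<close>

lemma matrices_imp_carries:
  assumes S: "graded_rring K R S" and T: "graded_rring K R T" and \<phi>: "\<phi> \<in> grring_hom K R S T"
    and u: "u \<in> gmod_iso S (tensor R S P) (tensor R S Q)" and g: "g \<in> gmod_iso T (tensor R T P) (tensor R T Q)"
    and mat: "\<And>i k. i < n \<Longrightarrow> k < m \<Longrightarrow> \<phi> (hmat S u i k) = hmat T g i k"
  shows "carries R P Q S T \<phi> u g"
  unfolding carries_def
proof
  fix X assume X: "X \<in> carrier (tensor R S P)"
  interpret S: dual_basis_pair S "tensor R S P" n \<beta> "\<lambda>i j. rmap S (e i j)" "\<lambda>i. tensor_elem R S P \<one>\<^bsub>S\<^esub> (p i)"
    "\<lambda>i. tensor_coord R S P (c i)" "tensor R S Q" m \<gamma> "\<lambda>k l. rmap S (f k l)"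
    "\<lambda>k. tensor_elem R S Q \<one>\<^bsub>S\<^esub> (q k)" "\<lambda>k. tensor_coord R S Q (d k)" using S by (rule pair)
  interpret T: dual_basis_pair T "tensor R T P" n \<beta> "\<lambda>i j. rmap T (e i j)" "\<lambda>i. tensor_elem R T P \<one>\<^bsub>T\<^esub> (p i)"
    "\<lambda>i. tensor_coord R T P (c i)" "tensor R T Q" m \<gamma> "\<lambda>k l. rmap T (f k l)"
    "\<lambda>k. tensor_elem R T Q \<one>\<^bsub>T\<^esub> (q k)" "\<lambda>k. tensor_coord R T Q (d k)" using T by (rule pair)
  interpret pm: scalar_map R S T P \<phi> by (rule grring_hom_scalar_map[OF P.lmod S T \<phi>])
  interpret qm: scalar_map R S T Q \<phi> by (rule grring_hom_scalar_map[OF Q.lmod S T \<phi>])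
  note cm = coord_map[OF S T \<phi>]
  have mX: "tensor_map R T P \<phi> X \<in> carrier (tensor R T P)"
    by (rule abelian_group_hom.hom_closed[OF pm.tensor_map_hom X])
  have uX: "u X \<in> carrier (tensor R S Q)" by (rule gmod_isoD(2)[OF u X])
  have hS: "hmat S u i k \<in> carrier S" and hT: "hmat T g i k \<in> carrier T" if "i < n" "k < m" for i k
    unfolding hmat_def using that
    by (auto intro!: S.Q.coord_closed T.Q.coord_closed gmod_isoD(2)[OF u] gmod_isoD(2)[OF g] S.P.basis_closed T.P.basis_closed)
  show "g (tensor_map R T P \<phi> X) = tensor_map R T Q \<phi> (u X)"
  proof (rule T.Q.coord_eqI[OF gmod_isoD(2)[OF g mX] abelian_group_hom.hom_closed[OF qm.tensor_map_hom uX]])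
    fix k assume k: "k < m"
    have "tensor_coord R T Q (d k) (g (tensor_map R T P \<phi> X)) =
        row_mult T n (\<lambda>i. tensor_coord R T P (c i) (tensor_map R T P \<phi> X)) (hmat T g) k"
      using T.linear_map_coord[OF gmod_isoD(1)[OF g] mX k] by (simp add: hmat_def[abs_def])
    also have "\<dots> = row_mult T n (\<lambda>i. \<phi> (tensor_coord R S P (c i) X)) (\<lambda>i k. \<phi> (hmat S u i k)) k"
      using k X hT mat by (intro T.A.row_mult_cong) (auto simp: cm(1) intro!: ring_hom_closed[OF grring_homD(3)[OF \<phi>]] S.P.coord_closed)
    also have "\<dots> = \<phi> (row_mult S n (\<lambda>i. tensor_coord R S P (c i) X) (hmat S u) k)"
      using k X hS by (intro ring_hom_row_mult[symmetric] S.A.ring_axioms T.A.ring_axioms grring_homD(3)[OF \<phi>] S.P.coord_closed)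
    also have "\<dots> = \<phi> (tensor_coord R S Q (d k) (u X))"
      using S.linear_map_coord[OF gmod_isoD(1)[OF u] X k] by (simp add: hmat_def[abs_def])
    also have "\<dots> = tensor_coord R T Q (d k) (tensor_map R T Q \<phi> (u X))"
      using cm(2)[OF k uX] by simp
    finally show "tensor_coord R T Q (d k) (g (tensor_map R T P \<phi> X)) = tensor_coord R T Q (d k) (tensor_map R T Q \<phi> (u X))" .
  qed
qed

sublocale presentation K R n m \<beta> \<gamma> e f
  using K R P.E_grade Q.E_grade by unfold_locales (auto simp: degree0_matrices_def)

definition uiso :: "((('k, 'r) h_elem set \<times> 'p) \<Rightarrow>\<^sub>0 int) set \<Rightarrow> ((('k, 'r) h_elem set \<times> 'q) \<Rightarrow>\<^sub>0 int) set" where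
  "uiso = basis_map B (tensor R B Q) n m (\<lambda>i. tensor_coord R B P (c i)) (\<lambda>i k. hB (H i k)) (\<lambda>k. tensor_elem R B Q \<one>\<^bsub>B\<^esub> (q k))"

text \<open>The relations imposed on \<open>B\<close> and the degrees of the symbols are precisely
  the hypotheses of \<open>basis_map_iso\<close>, so the matrix of symbols defines an isomorphism,
  and its two matrices return the symbols.\<close>

lemma uiso:
  shows uiso_iso: "uiso \<in> gmod_iso B (tensor R B P) (tensor R B Q)"
    and uiso_hmat: "i < n \<Longrightarrow> k < m \<Longrightarrow> hmat B uiso i k = hB (H i k)"
    and uiso_hmat': "i < n \<Longrightarrow> k < m \<Longrightarrow> hmat' B uiso k i = hB (HStar k i)"
proof -
  interpret B: dual_basis_pair B "tensor R B P" n \<beta> "\<lambda>i j. rmap B (e i j)" "\<lambda>i. tensor_elem R B P \<one>\<^bsub>B\<^esub> (p i)"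
    "\<lambda>i. tensor_coord R B P (c i)" "tensor R B Q" m \<gamma> "\<lambda>k l. rmap B (f k l)"
    "\<lambda>k. tensor_elem R B Q \<one>\<^bsub>B\<^esub> (q k)" "\<lambda>k. tensor_coord R B Q (d k)" using graded_rring_B by (rule pair)
  have g: "hB (H i k) \<in> grade B (\<gamma> k - \<beta> i)" "hB (HStar k i) \<in> grade B (\<beta> i - \<gamma> k)" if "i < n" "k < m" for i k
    using hB_grade[of "H i k"] hB_grade[of "HStar k i"] that by simp_all
  show "uiso \<in> gmod_iso B (tensor R B P) (tensor R B Q)"
    unfolding uiso_def by (rule B.basis_map_iso(1)[OF B_relations g])
  show "hmat B uiso i k = hB (H i k)" if "i < n" "k < m"
    unfolding uiso_def hmat_def by (rule B.basis_map_basis[OF B_relations g that])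
  show "hmat' B uiso k i = hB (HStar k i)" if "i < n" "k < m"
    unfolding uiso_def hmat'_def by (rule B.basis_map_iso(2)[OF B_relations g that])
qed

text \<open>The matrices of \<open>g\<close> and of its inverse satisfy the relations, hence are the
  values of the symbols under a homomorphism from \<open>B\<close>; no other values are possible.
  Nothing depends on where the target lives, so the type \<open>'t\<close> stays arbitrary.\<close>

lemma presented_ring_universal: "universal_iso_ring TYPE('t) K R P Q B uiso"
  unfolding universal_iso_ring_def
proof (intro conjI allI impI graded_rring_B uiso_iso)
  fix T :: "('g, 'k, 'r, 't) grring" and g
  assume "graded_rring K R T \<and> g \<in> gmod_iso T (tensor R T P) (tensor R T Q)"
  then have T: "graded_rring K R T" and g: "g \<in> gmod_iso T (tensor R T P) (tensor R T Q)" by auto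
  note Td = graded_rringD[OF T]
  interpret T: dual_basis_pair T "tensor R T P" n \<beta> "\<lambda>i j. rmap T (e i j)" "\<lambda>i. tensor_elem R T P \<one>\<^bsub>T\<^esub> (p i)"
    "\<lambda>i. tensor_coord R T P (c i)" "tensor R T Q" m \<gamma> "\<lambda>k l. rmap T (f k l)"
    "\<lambda>k. tensor_elem R T Q \<one>\<^bsub>T\<^esub> (q k)" "\<lambda>k. tensor_coord R T Q (d k)" using T by (rule pair)
  note mats = T.iso_to_matrices(1-3)[OF g, folded hmat_def hmat'_def]
  define \<eta> where "\<eta> x = (case x of H i k \<Rightarrow> hmat T g i k | HStar k i \<Rightarrow> hmat' T g k i)" for x
  have \<eta>_grade: "\<eta> x \<in> grade T (h_degree \<beta> \<gamma> x)" if "x \<in> XS" for x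
    using that mats by (auto simp: h_symbols_def \<eta>_def)
  have \<eta>_closed: "\<eta> x \<in> carrier T" if "x \<in> XS" for x
    using \<eta>_grade[OF that] graded_ringD(3)[OF Td(1)] by blast
  have central: "rmap T (kmap R c) \<otimes>\<^bsub>T\<^esub> t = t \<otimes>\<^bsub>T\<^esub> rmap T (kmap R c)" if "c \<in> carrier K" "t \<in> carrier T" for c t
    using that Td(5,6) by simp
  have iso: "iso_matrices T n m (\<lambda>i j. rmap T (e i j)) (\<lambda>i j. rmap T (f i j)) (\<lambda>j k. \<eta> (H j k)) (\<lambda>k j. \<eta> (HStar k j))"
    using mats(1) by (simp add: \<eta>_def)
  obtain \<phi> where \<phi>: "\<phi> \<in> ring_hom B T" "\<And>r. r \<in> carrier R \<Longrightarrow> \<phi> (rmap B r) = rmap T r"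
    "\<And>x. x \<in> XS \<Longrightarrow> \<phi> (hB x) = \<eta> x"
    by (rule B_lift[OF Td(2,4), of \<eta>]) (use central \<eta>_closed iso in blast)+
  \<comment> \<open>The lift was built without gradings. The preimages of the degrees of
    \<open>T\<close> form a multiplicative family with the generators in their degrees, hence
    contain the grading of \<open>B\<close>.\<close>
  have gr: "grade B \<delta> \<subseteq> {x \<in> carrier B. \<phi> x \<in> grade T \<delta>}" for \<delta>
  proof (rule B_grade[OF graded_family_preimage[OF ring_B Td(2) \<phi>(1) graded_ring_family[OF Td(1)]]])
    fix r \<delta> assume r: "r \<in> grade R \<delta>"
    then have "r \<in> carrier R" by (rule graded_ringD(3)[OF graded_R])
    then show "rmap B r \<in> {x \<in> carrier B. \<phi> x \<in> grade T \<delta>}"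
      using r Td(3) ring_hom_closed[OF rmap_B_hom] by (auto simp: \<phi> gring_hom_def)
  next
    fix x assume "x \<in> XS"
    then show "hB x \<in> {y \<in> carrier B. \<phi> y \<in> grade T (h_degree \<beta> \<gamma> x)}"
      using \<eta>_grade hB_closed by (simp add: \<phi>)
  qed
  have \<phi>_hom: "\<phi> \<in> grring_hom K R B T"
    unfolding grring_hom_def galg_hom_def gring_hom_def
  proof (intro CollectI conjI ballI allI \<phi>(1,2))
    show "\<phi> ` grade B \<delta> \<subseteq> grade T \<delta>" for \<delta> using gr[of \<delta>] by blast
    show "\<phi> (kmap B c) = kmap T c" if "c \<in> carrier K" for c
      unfolding kmap_B using \<phi>(2)[OF ring_hom_closed[OF kmap_R(2) that]] Td(5)[OF that] by simp
  qed
  have carr: "carries R P Q B T \<phi> uiso g"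
    using \<phi>(3) by (intro matrices_imp_carries[OF graded_rring_B T \<phi>_hom uiso_iso g]) (simp add: uiso_hmat \<eta>_def)
  moreover have "\<psi> s = \<phi> s" if \<psi>: "\<psi> \<in> grring_hom K R B T" "carries R P Q B T \<psi> uiso g" and s: "s \<in> carrier B" for \<psi> s
  proof (rule B_hom_eqI[OF Td(2) grring_homD(3)[OF \<psi>(1)] \<phi>(1) _ _ s])
    show "\<psi> (rmap B r) = \<phi> (rmap B r)" if "r \<in> carrier R" for r
      using that grring_homD(4)[OF \<psi>(1)] \<phi>(2) by simp
    note cm = carries_imp_matrices[OF graded_rring_B T \<psi>(1) uiso_iso g \<psi>(2)]
    show "\<psi> (hB x) = \<phi> (hB x)" if x: "x \<in> XS" for x
    proof (cases x)
      case (H i k)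
      then show ?thesis using x cm(1)[of i k] \<phi>(3)[OF x] by (simp add: uiso_hmat \<eta>_def)
    next
      case (HStar k i)
      then show ?thesis using x cm(2)[of i k] \<phi>(3)[OF x] by (simp add: uiso_hmat' \<eta>_def)
    qed
  qed
  ultimately show "\<exists>\<phi>\<in>grring_hom K R B T. carries R P Q B T \<phi> uiso g \<and>
      (\<forall>\<psi>\<in>grring_hom K R B T. carries R P Q B T \<psi> uiso g \<longrightarrow> (\<forall>s\<in>carrier B. \<psi> s = \<phi> s))"
    using \<phi>_hom by blast
qed

end

section \<open>Uniqueness of the universal ring\<close>

lemma universal_iso_ring_hom_unique:
  fixes T :: "('g::ab_group_add, 'k, 'r, 't) grring"
  assumes U: "universal_iso_ring TYPE('t) K R P Q S u"
    and T: "graded_rring K R T" "g \<in> gmod_iso T (tensor R T P) (tensor R T Q)"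
    and \<phi>: "\<phi> \<in> grring_hom K R S T" "carries R P Q S T \<phi> u g"
    and \<psi>: "\<psi> \<in> grring_hom K R S T" "carries R P Q S T \<psi> u g" and s: "s \<in> carrier S"
  shows "\<phi> s = \<psi> s"
proof -
  have "\<exists>\<chi> \<in> grring_hom K R S T. carries R P Q S T \<chi> u g \<and>
      (\<forall>\<psi> \<in> grring_hom K R S T. carries R P Q S T \<psi> u g \<longrightarrow> (\<forall>s \<in> carrier S. \<psi> s = \<chi> s))"
    using U T unfolding universal_iso_ring_def by blast
  then obtain \<chi> where "\<forall>\<psi> \<in> grring_hom K R S T. carries R P Q S T \<psi> u g \<longrightarrow> (\<forall>s \<in> carrier S. \<psi> s = \<chi> s)"
    by blast
  then have "\<phi> s = \<chi> s" "\<psi> s = \<chi> s" using \<phi> \<psi> s by blast+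
  then show ?thesis by (rule trans[OF _ sym])
qed

text \<open>The usual argument with two comparison maps. Each of the four arrows between
  \<open>S\<close> and \<open>B\<close>, endomorphisms included, needs the universal property of its
  source for rings carried by the type of its target, which accounts for the four
  hypotheses.\<close>

lemma universal_iso_ring_unique:
  fixes S :: "('g::ab_group_add, 'k, 'r, 's) grring" and B :: "('g, 'k, 'r, 'b) grring"
  assumes lP: "left_module R P" and lQ: "left_module R Q"
    and SS: "universal_iso_ring TYPE('s) K R P Q S u" and SB: "universal_iso_ring TYPE('b) K R P Q S u"
    and BS: "universal_iso_ring TYPE('s) K R P Q B v" and BB: "universal_iso_ring TYPE('b) K R P Q B v"
  shows "galg_iso K S B \<noteq> {}"
proof -
  have S: "graded_rring K R S" and u: "u \<in> gmod_iso S (tensor R S P) (tensor R S Q)"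
    using SS by (auto simp: universal_iso_ring_def)
  have B: "graded_rring K R B" and v: "v \<in> gmod_iso B (tensor R B P) (tensor R B Q)"
    using BB by (auto simp: universal_iso_ring_def)
  obtain \<phi> where \<phi>: "\<phi> \<in> grring_hom K R S B" "carries R P Q S B \<phi> u v"
    using SB B v unfolding universal_iso_ring_def by blast
  obtain \<psi> where \<psi>: "\<psi> \<in> grring_hom K R B S" "carries R P Q B S \<psi> v u"
    using BS S u unfolding universal_iso_ring_def by blast
  have uniq: "\<psi> (\<phi> s) = s" if "s \<in> carrier S" for s
    by (rule universal_iso_ring_hom_unique[OF SS S u grring_hom_compose[OF \<phi>(1) \<psi>(1)]
          carries_compose[OF lP lQ S B S \<phi>(1) \<psi>(1) u \<phi>(2) \<psi>(2)] grring_hom_id carries_id[OF lP lQ S u] that])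
  have uniq': "\<phi> (\<psi> b) = b" if "b \<in> carrier B" for b
    by (rule universal_iso_ring_hom_unique[OF BB B v grring_hom_compose[OF \<psi>(1) \<phi>(1)]
          carries_compose[OF lP lQ B S B \<psi>(1) \<phi>(1) v \<psi>(2) \<phi>(2)] grring_hom_id carries_id[OF lP lQ B v] that])
  have "bij_betw \<phi> (carrier S) (carrier B)"
    by (rule bij_betw_byWitness[where f' = \<psi>])
       (use uniq uniq' ring_hom_closed[OF grring_homD(3)[OF \<phi>(1)]] ring_hom_closed[OF grring_homD(3)[OF \<psi>(1)]] in auto)
  moreover have "\<phi> ` grade S \<delta> = grade B \<delta>" for \<delta>
  proof
    show "\<phi> ` grade S \<delta> \<subseteq> grade B \<delta>" using grring_homD(5)[OF \<phi>(1)] by blast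
    \<comment> \<open>The inverse \<psi> is graded too, so it provides preimages of the same
      degree.\<close>
    show "grade B \<delta> \<subseteq> \<phi> ` grade S \<delta>"
    proof
      fix b assume b: "b \<in> grade B \<delta>"
      then have "b = \<phi> (\<psi> b)" using uniq' graded_ringD(3)[OF graded_rringD(1)[OF B]] by simp
      then show "b \<in> \<phi> ` grade S \<delta>" using grring_homD(5)[OF \<psi>(1) b] by (rule image_eqI)
    qed
  qed
  ultimately have "\<phi> \<in> galg_iso K S B" using grring_homD(1)[OF \<phi>(1)] by (simp add: galg_iso_def)
  then show ?thesis by blast
qed

text \<open>A universal property formulated for one carrier type determines \<open>S\<close> only
  when tested on the rings being compared, hence the two type instances in the first conjunct. The
  second conjunct, with \<open>'t\<close> arbitrary, shows that the presented ring itself has the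
  property for every type.\<close>

theorem lemma5p8:
  fixes K :: "('g::ab_group_add, 'k) gring"
    and R :: "('g, 'k, 'r) galg"
    and P :: "('g, 'r, 'p) gmod"
    and Q :: "('g, 'r, 'q) gmod"
    and n m :: nat
    and \<beta> \<gamma> :: "nat \<Rightarrow> 'g"
    and e f :: "nat \<Rightarrow> nat \<Rightarrow> 'r"
  assumes "graded_ring K" and "cring K"
    and "graded_algebra K R"
    and "graded_fg_projective R P" and "carrier P \<noteq> {\<zero>\<^bsub>P\<^esub>}"
    and "graded_fg_projective R Q" and "carrier Q \<noteq> {\<zero>\<^bsub>Q\<^esub>}"
    and "image_of_idempotent R P n \<beta> e"
    and "image_of_idempotent R Q m \<gamma> f"
  shows "(\<forall>(S :: ('g, 'k, 'r, 's) grring) u.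
       universal_iso_ring TYPE('s) K R P Q S u \<and>
       universal_iso_ring TYPE(('k, 'r) h_elem set) K R P Q S u \<longrightarrow>
       galg_iso K S (presented_ring K R n m \<beta> \<gamma> e f) \<noteq> {}) \<and>
    (\<exists>v. universal_iso_ring TYPE('t) K R P Q (presented_ring K R n m \<beta> \<gamma> e f) v)"
proof -
  have "graded_module R P" "graded_module R Q"
    using assms(4,6) by (auto simp: graded_fg_projective_def)
  then obtain p c q d where "graded_dual_basis R P n \<beta> e p c" "graded_dual_basis R Q m \<gamma> f q d"
    using image_of_idempotent_dual_basis assms(8,9) by metis
  then interpret iso_setup R P n \<beta> e p c Q m \<gamma> f q d K
    using assms(1,3) by (simp add: iso_setup_def iso_setup_axioms_def)
  show ?thesis
    using universal_iso_ring_unique[OF P.lmod Q.lmod _ _ presented_ring_universal presented_ring_universal]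
      presented_ring_universal by blast
qed

end
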